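(* Let $n\geq 4$, and let $G$ be an $n$-vertex graph with minimum degree $\delta(G)\geq n-3$. Suppose that no connected component of the complement $\overline{G}$ of $G$ is isomorphic to the cycle $C_3$ or the cycle $C_4$. Then $G$ is Maxwell-sharp, that is, $\operatorname{rig}(G)=\mathsf{M}(G)$.
   Context: All graphs are finite and simple. A $d$-dimensional framework $(G,p)$ of a graph $G=(V,E)$ is given by a map $p:V\to\mathbb{R}^d$. It is rigid if every continuous motion of the vertices (starting at $p$) preserving the lengths of all edges preserves all pairwise distances between vertices. The map $p$ is generic if the $d|V|$ coordinates of the points $p(v)$, $v\in V$, are algebraically independent over $\mathbb{Q}$. $G$ is (generically) $d$-rigid if $(G,p)$ is rigid for some, equivalently every, generic $p:V\to\mathbb{R}^d$. Equivalently: either $G$ is a complete graph on at most $d+1$ vertices, or $|V|\ge d+1$ and for generic $p$ the rigidity matrix $R(G,p)$ has rank $d|V|-\binom{d+1}{2}$. Here $R(G,p)$ is the $|E|\times d|V|$ matrix whose row for the edge $uv$ has $p(u)-p(v)$ in the $d$ columns of $u$, $p(v)-p(u)$ in the $d$ columns of $v$, and zeros elsewhere. By convention every graph is $0$-rigid. For an $n$-vertex graph $G$, the rigidity dimension $\operatorname{rig}(G)$ is the largest nonnegative integer $d\le n-1$ for which $G$ is generically $d$-rigid. The Maxwell dimension $\mathsf{M}(G)$ is the largest nonnegative integer $d\le n-1$ satisfying $dn-\binom{d+1}{2}\le |E(G)|$. $G$ is Maxwell-sharp if $\operatorname{rig}(G)=\mathsf{M}(G)$. *)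

theory Defs
  imports "HOL-Analysis.Analysis" "HOL-Library.Poly_Mapping"
begin

section \<open>Finite simple graphs\<close>

record 'a graph =
  verts :: "'a set"
  edges :: "'a set set"

definition all_pairs :: "'a set \<Rightarrow> 'a set set" where
  "all_pairs V = {e. e \<subseteq> V \<and> card e = 2}"

definition simple_graph :: "'a graph \<Rightarrow> bool" where
  "simple_graph G \<longleftrightarrow> finite (verts G) \<and> edges G \<subseteq> all_pairs (verts G)"

definition degree :: "'a graph \<Rightarrow> 'a \<Rightarrow> nat" where
  "degree G v = card {u \<in> verts G. {u, v} \<in> edges G}"

definition min_degree :: "'a graph \<Rightarrow> nat" where
  "min_degree G = Min (degree G ` verts G)"

definition complement :: "'a graph \<Rightarrow> 'a graph" where
  "complement G = \<lparr>verts = verts G, edges = all_pairs (verts G) - edges G\<rparr>"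

definition induced_subgraph :: "'a graph \<Rightarrow> 'a set \<Rightarrow> 'a graph" where
  "induced_subgraph G W = \<lparr>verts = W, edges = {e \<in> edges G. e \<subseteq> W}\<rparr>"

definition connected_components :: "'a graph \<Rightarrow> 'a graph set" where
  "connected_components G =
     (\<lambda>v. induced_subgraph G {u \<in> verts G. (\<lambda>x y. {x, y} \<in> edges G)\<^sup>*\<^sup>* v u}) ` verts G"

definition graph_isomorphic :: "'a graph \<Rightarrow> 'b graph \<Rightarrow> bool" where
  "graph_isomorphic G H \<longleftrightarrow>
     (\<exists>f. bij_betw f (verts G) (verts H) \<and>
          (\<forall>u\<in>verts G. \<forall>v\<in>verts G. {u, v} \<in> edges G \<longleftrightarrow> {f u, f v} \<in> edges H))"

text \<open>The cycle \<open>C\<^sub>k\<close> on vertices \<open>0, \<dots>, k - 1\<close>; meaningful only for \<open>k \<ge> 3\<close>.\<close>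

definition cycle_graph :: "nat \<Rightarrow> nat graph" where
  "cycle_graph k = \<lparr>verts = {..<k}, edges = {{i, (i + 1) mod k} | i. i < k}\<rparr>"

section \<open>Frameworks and generic rigidity\<close>

text \<open>
  Since the dimension \<open>d\<close> is quantified over, a point of \<open>\<real>\<^sup>d\<close> is a function
  \<open>nat \<Rightarrow> real\<close> of which only the values at indices below \<open>d\<close> are used.
  A framework places vertex \<open>v\<close> at \<open>p v\<close>; values of \<open>p\<close> outside the
  vertex set are irrelevant.
\<close>

definition dist_dim :: "nat \<Rightarrow> (nat \<Rightarrow> real) \<Rightarrow> (nat \<Rightarrow> real) \<Rightarrow> real" where
  "dist_dim d x y = L2_set (\<lambda>i. x i - y i) {..<d}"

text \<open>A motion is parametrised by time in \<open>[0, 1]\<close>.\<close>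

definition continuous_motion ::
    "nat \<Rightarrow> 'a graph \<Rightarrow> ('a \<Rightarrow> nat \<Rightarrow> real) \<Rightarrow> (real \<Rightarrow> 'a \<Rightarrow> nat \<Rightarrow> real) \<Rightarrow> bool" where
  "continuous_motion d G p q \<longleftrightarrow>
     (\<forall>v\<in>verts G. \<forall>i<d. continuous_on {0..1} (\<lambda>t. q t v i) \<and> q 0 v i = p v i)"

definition rigid_framework :: "nat \<Rightarrow> 'a graph \<Rightarrow> ('a \<Rightarrow> nat \<Rightarrow> real) \<Rightarrow> bool" where
  "rigid_framework d G p \<longleftrightarrow>
     (\<forall>q. continuous_motion d G p q \<longrightarrow>
          (\<forall>t\<in>{0..1}. \<forall>u\<in>verts G. \<forall>v\<in>verts G. {u, v} \<in> edges G \<longrightarrow>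
             dist_dim d (q t u) (q t v) = dist_dim d (p u) (p v)) \<longrightarrow>
          (\<forall>t\<in>{0..1}. \<forall>u\<in>verts G. \<forall>v\<in>verts G.
             dist_dim d (q t u) (q t v) = dist_dim d (p u) (p v)))"

text \<open>
  A polynomial over \<open>\<rat>\<close> in indeterminates of type \<open>'i\<close> is a finitely supported map from
  monomials to coefficients, a monomial being a finitely supported exponent map.
\<close>

definition eval_poly :: "(('i \<Rightarrow>\<^sub>0 nat) \<Rightarrow>\<^sub>0 rat) \<Rightarrow> ('i \<Rightarrow> real) \<Rightarrow> real" where
  "eval_poly P x =
     (\<Sum>m\<in>Poly_Mapping.keys P. of_rat (Poly_Mapping.lookup P m) *
        (\<Prod>i\<in>Poly_Mapping.keys m. x i ^ Poly_Mapping.lookup m i))"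

definition algebraically_independent :: "'i set \<Rightarrow> ('i \<Rightarrow> real) \<Rightarrow> bool" where
  "algebraically_independent I x \<longleftrightarrow>
     (\<forall>P :: ('i \<Rightarrow>\<^sub>0 nat) \<Rightarrow>\<^sub>0 rat.
        (\<forall>m\<in>Poly_Mapping.keys P. Poly_Mapping.keys m \<subseteq> I) \<and> eval_poly P x = 0 \<longrightarrow> P = 0)"

definition generic :: "nat \<Rightarrow> 'a set \<Rightarrow> ('a \<Rightarrow> nat \<Rightarrow> real) \<Rightarrow> bool" where
  "generic d V p \<longleftrightarrow> algebraically_independent (V \<times> {..<d}) (\<lambda>(v, i). p v i)"

definition generically_rigid :: "nat \<Rightarrow> 'a graph \<Rightarrow> bool" where
  "generically_rigid d G \<longleftrightarrow> (\<exists>p. generic d (verts G) p \<and> rigid_framework d G p)"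

text \<open>
  The convention that every graph is \<open>0\<close>-rigid needs no separate clause; in particular
  the maximum defining \<open>rigidity_dim\<close> below is taken over a nonempty set.
\<close>

lemma generically_rigid_0: "generically_rigid 0 G"
proof -
  have "P = 0" if "\<forall>m\<in>Poly_Mapping.keys P. Poly_Mapping.keys m \<subseteq> {}" and "eval_poly P x = 0"
    for P :: "(('a \<times> nat) \<Rightarrow>\<^sub>0 nat) \<Rightarrow>\<^sub>0 rat" and x
  proof (rule ccontr)
    assume "P \<noteq> 0"
    moreover have "Poly_Mapping.keys P \<subseteq> {0}" using that(1) by auto
    ultimately have "Poly_Mapping.keys P = {0}" by (auto simp: subset_singleton_iff)
    moreover from this have "Poly_Mapping.lookup P 0 \<noteq> 0"
      by (metis in_keys_iff singletonI)
    ultimately show False using that(2) by (simp add: eval_poly_def)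
  qed
  then show ?thesis
    by (auto simp: generically_rigid_def generic_def algebraically_independent_def
        rigid_framework_def dist_dim_def)
qed

section \<open>Rigidity dimension and Maxwell dimension\<close>

definition rigidity_dim :: "'a graph \<Rightarrow> nat" where
  "rigidity_dim G = Max {d. d \<le> card (verts G) - 1 \<and> generically_rigid d G}"

definition maxwell_dim :: "'a graph \<Rightarrow> nat" where
  "maxwell_dim G =
     Max {d. d \<le> card (verts G) - 1 \<and>
             int d * int (card (verts G)) - int ((d + 1) choose 2) \<le> int (card (edges G))}"

definition maxwell_sharp :: "'a graph \<Rightarrow> bool" where
  "maxwell_sharp G \<longleftrightarrow> rigidity_dim G = maxwell_dim G"

end

theory Submission
  imports Defs
begin

text \<open>
  Let \<open>H\<close> be the complement of \<open>G\<close> and \<open>k = n - 1 - d\<close>. Edge counting turns the Maxwell condition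
  into \<open>|E(H)| \<le> k (k + 1) / 2\<close>, the dimension of the symmetric square of \<open>\<real>\<^sup>k\<close>. By Gale duality,
  infinitesimal rigidity of \<open>G\<close> in \<open>\<real>\<^sup>d\<close> means that for generic vectors \<open>y\<^sub>v\<close> in \<open>\<real>\<^sup>k\<close> the symmetric
  products \<open>y\<^sub>u y\<^sub>v\<close> over the edges \<open>uv\<close> of \<open>H\<close> are linearly independent. As \<open>H\<close> has maximum degree
  at most 2, induction on \<open>k\<close> applies: place a well separated set \<open>W\<close> of vertices, meeting at most \<open>k\<close>
  edges and missing at most \<open>k (k - 1) / 2\<close>, at one vector \<open>e\<close> and work modulo \<open>e\<close>. Only
  triangles obstruct the choice of \<open>W\<close>. For infinitesimally rigid \<open>p\<close>, the change of squared distances in a framework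
  with the same edge lengths is bounded by a multiple of its own square, so it cannot leave 0
  continuously. Conversely, with too many missing edges, \<open>G\<close> is a proper subgraph of a graph with
  independent edge lengths, and a fixed point argument moves one of these lengths alone.
\<close>

section \<open>Rational polynomials at algebraically independent points\<close>

text \<open>Algebraic independence gives one tool only: a rational polynomial that is nonzero
  somewhere is nonzero at the generic point. Each generic claim is therefore phrased as a trivial
  kernel of a linear system with polynomial entries and checked at one convenient, usually
  degenerate, point. The Gale dual of a given placement is only rational in its coordinates, so
  rigidity is proved at placements parametrised by affine coordinates, where points and dual vectors
  are both polynomial; this suffices because \<open>generically_rigid\<close> asks for one generic
  placement. The converse must treat every generic placement.

  Edges of the complement are handled as pairs of opposite arcs, which turns
  \<open>k (k + 1) / 2\<close> into \<open>k * Suc k\<close>. Passing from dimension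
  \<open>k + 1\<close> to \<open>k\<close> lowers the number of allowed edges by
  \<open>k + 1\<close>, so in the extremal case the coned set must meet exactly \<open>k + 1\<close>
  edges. If all degrees are 2 and \<open>k + 1\<close> is odd, parity forbids this for an
  independent set; the set then contains both ends of one edge, which must have no common
  neighbour.\<close>

inductive_set ratpoly :: "'i set \<Rightarrow> (('i \<Rightarrow> real) \<Rightarrow> real) set" for I where
  const: "(\<lambda>_. of_rat c) \<in> ratpoly I"
| var: "i \<in> I \<Longrightarrow> (\<lambda>x. x i) \<in> ratpoly I"
| add: "f \<in> ratpoly I \<Longrightarrow> g \<in> ratpoly I \<Longrightarrow> (\<lambda>x. f x + g x) \<in> ratpoly I"
| mult: "f \<in> ratpoly I \<Longrightarrow> g \<in> ratpoly I \<Longrightarrow> (\<lambda>x. f x * g x) \<in> ratpoly I"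

lemma ratpoly_0: "(\<lambda>_. 0) \<in> ratpoly I"
  using ratpoly.const[of 0 I] by simp

lemma ratpoly_1: "(\<lambda>_. 1) \<in> ratpoly I"
  using ratpoly.const[of 1 I] by simp

lemma ratpoly_uminus: "f \<in> ratpoly I \<Longrightarrow> (\<lambda>x. - f x) \<in> ratpoly I"
  using ratpoly.mult[OF ratpoly.const[of "-1"]] by simp

lemma ratpoly_diff:
  "f \<in> ratpoly I \<Longrightarrow> g \<in> ratpoly I \<Longrightarrow> (\<lambda>x. f x - g x) \<in> ratpoly I"
  using ratpoly.add[OF _ ratpoly_uminus] by simp

lemma ratpoly_sum:
  "(\<And>j. j \<in> J \<Longrightarrow> f j \<in> ratpoly I) \<Longrightarrow> (\<lambda>x. \<Sum>j\<in>J. f j x) \<in> ratpoly I"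
  by (induction J rule: infinite_finite_induct) (auto intro: ratpoly_0 ratpoly.add)

lemma ratpoly_prod:
  "(\<And>j. j \<in> J \<Longrightarrow> f j \<in> ratpoly I) \<Longrightarrow> (\<lambda>x. \<Prod>j\<in>J. f j x) \<in> ratpoly I"
  by (induction J rule: infinite_finite_induct) (auto intro: ratpoly_1 ratpoly.mult)

lemma ratpoly_power: "f \<in> ratpoly I \<Longrightarrow> (\<lambda>x. f x ^ n) \<in> ratpoly I"
  by (induction n) (auto intro: ratpoly_1 ratpoly.mult)

lemma ratpoly_if:
  "(c \<Longrightarrow> f \<in> ratpoly I) \<Longrightarrow> (\<not> c \<Longrightarrow> g \<in> ratpoly I) \<Longrightarrow> (\<lambda>x. if c then f x else g x) \<in> ratpoly I"
  by (cases c) auto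

lemmas ratpoly_intros =
  ratpoly_0 ratpoly_1 ratpoly.var ratpoly.add ratpoly.mult ratpoly_uminus ratpoly_diff
  ratpoly_sum ratpoly_prod ratpoly_power ratpoly_if

section \<open>Evaluation of formal polynomials\<close>

definition monomial :: "('i \<Rightarrow>\<^sub>0 nat) \<Rightarrow> ('i \<Rightarrow> real) \<Rightarrow> real" where
  "monomial m x = (\<Prod>i\<in>Poly_Mapping.keys m. x i ^ Poly_Mapping.lookup m i)"

lemma monomial_superset:
  assumes "finite K" "Poly_Mapping.keys m \<subseteq> K"
  shows "monomial m x = (\<Prod>i\<in>K. x i ^ Poly_Mapping.lookup m i)"
  unfolding monomial_def using assms
  by (intro prod.mono_neutral_left) (auto simp: in_keys_iff)

lemma monomial_add: "monomial (m + m') x = monomial m x * monomial m' x"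
proof -
  let ?K = "Poly_Mapping.keys m \<union> Poly_Mapping.keys m'"
  have "monomial (m + m') x = (\<Prod>i\<in>?K. x i ^ Poly_Mapping.lookup (m + m') i)"
    by (intro monomial_superset) (auto dest: subsetD[OF Poly_Mapping.keys_add])
  also have "\<dots> = (\<Prod>i\<in>?K. x i ^ Poly_Mapping.lookup m i) * (\<Prod>i\<in>?K. x i ^ Poly_Mapping.lookup m' i)"
    by (simp add: lookup_add power_add prod.distrib)
  also have "\<dots> = monomial m x * monomial m' x"
    by (simp add: monomial_superset[of ?K])
  finally show ?thesis .
qed

lemma eval_poly_superset:
  assumes "finite K" "Poly_Mapping.keys P \<subseteq> K"
  shows "eval_poly P x = (\<Sum>m\<in>K. of_rat (Poly_Mapping.lookup P m) * monomial m x)"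
  unfolding eval_poly_def monomial_def using assms
  by (intro sum.mono_neutral_left) (auto simp: in_keys_iff)

lemma eval_poly_add: "eval_poly (P + Q) x = eval_poly P x + eval_poly Q x"
proof -
  let ?K = "Poly_Mapping.keys P \<union> Poly_Mapping.keys Q"
  have "eval_poly (P + Q) x = (\<Sum>m\<in>?K. of_rat (Poly_Mapping.lookup (P + Q) m) * monomial m x)"
    by (intro eval_poly_superset) (auto dest: subsetD[OF Poly_Mapping.keys_add])
  also have "\<dots> = (\<Sum>m\<in>?K. of_rat (Poly_Mapping.lookup P m) * monomial m x)
      + (\<Sum>m\<in>?K. of_rat (Poly_Mapping.lookup Q m) * monomial m x)"
    by (simp add: lookup_add of_rat_add distrib_right sum.distrib)
  also have "\<dots> = eval_poly P x + eval_poly Q x"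
    by (simp add: eval_poly_superset[of ?K])
  finally show ?thesis .
qed

lemma eval_poly_0: "eval_poly 0 x = 0"
  by (simp add: eval_poly_def)

lemma eval_poly_sum: "eval_poly (\<Sum>j\<in>J. P j) x = (\<Sum>j\<in>J. eval_poly (P j) x)"
  by (induction J rule: infinite_finite_induct) (auto simp: eval_poly_0 eval_poly_add)

lemma eval_poly_single: "eval_poly (Poly_Mapping.single m c) x = of_rat c * monomial m x"
  by (subst eval_poly_superset[of "{m}"]) auto

definition poly_on :: "'i set \<Rightarrow> (('i \<Rightarrow>\<^sub>0 nat) \<Rightarrow>\<^sub>0 rat) set" where
  "poly_on I = {P. \<forall>m\<in>Poly_Mapping.keys P. Poly_Mapping.keys m \<subseteq> I}"

lemma poly_on_add: "P \<in> poly_on I \<Longrightarrow> Q \<in> poly_on I \<Longrightarrow> P + Q \<in> poly_on I"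
  unfolding poly_on_def using Poly_Mapping.keys_add[of P Q] by blast

lemma poly_on_sum: "(\<And>j. j \<in> J \<Longrightarrow> P j \<in> poly_on I) \<Longrightarrow> (\<Sum>j\<in>J. P j) \<in> poly_on I"
proof (induction J rule: infinite_finite_induct)
  case (insert j J)
  then show ?case by (simp add: poly_on_add)
qed (simp_all add: poly_on_def)

lemma poly_on_single: "Poly_Mapping.keys m \<subseteq> I \<Longrightarrow> Poly_Mapping.single m c \<in> poly_on I"
  by (simp add: poly_on_def)

text \<open>Matrix entries are recognised as polynomial by the closure rules of
  \<open>ratpoly\<close>; this is the passage to formal polynomials, to which algebraic independence
  refers.\<close>

lemma ratpoly_eval_poly:
  assumes "f \<in> ratpoly I"
  shows "\<exists>P\<in>poly_on I. \<forall>x. f x = eval_poly P x"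
  using assms
proof induction
  case (const c)
  show ?case
    by (intro bexI[of _ "Poly_Mapping.single 0 c"] poly_on_single) (auto simp: eval_poly_single monomial_def)
next
  case (var i)
  then show ?case
    by (intro bexI[of _ "Poly_Mapping.single (Poly_Mapping.single i 1) 1"] poly_on_single)
      (auto simp: eval_poly_single monomial_def)
next
  case (add f g)
  then show ?case by (metis eval_poly_add poly_on_add)
next
  case (mult f g)
  then obtain P Q where P: "P \<in> poly_on I" "\<And>x. f x = eval_poly P x"
    and Q: "Q \<in> poly_on I" "\<And>x. g x = eval_poly Q x" by blast
  define R where "R = (\<Sum>m\<in>Poly_Mapping.keys P. \<Sum>m'\<in>Poly_Mapping.keys Q.
    Poly_Mapping.single (m + m') (Poly_Mapping.lookup P m * Poly_Mapping.lookup Q m'))"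
  have "R \<in> poly_on I"
    unfolding R_def
  proof (intro poly_on_sum poly_on_single)
    fix m m' assume "m \<in> Poly_Mapping.keys P" "m' \<in> Poly_Mapping.keys Q"
    then show "Poly_Mapping.keys (m + m') \<subseteq> I"
      using P(1) Q(1) Poly_Mapping.keys_add[of m m'] unfolding poly_on_def by blast
  qed
  moreover have "f x * g x = eval_poly R x" for x
    unfolding R_def eval_poly_sum eval_poly_single P(2) Q(2) monomial_add
    by (simp add: eval_poly_superset[OF finite_keys subset_refl] sum_product of_rat_mult mult_ac)
  ultimately show ?case by blast
qed

lemma algebraically_independent_alt:
  "algebraically_independent I x \<longleftrightarrow> (\<forall>P\<in>poly_on I. eval_poly P x = 0 \<longrightarrow> P = 0)"
  unfolding algebraically_independent_def poly_on_def by auto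

text \<open>The value at \<open>x0\<close> only shows that the polynomial behind \<open>f\<close> is
  not 0; algebraic independence then excludes a zero at \<open>x\<close>. Every transfer from a
  special to a generic point rests on this.\<close>

lemma ratpoly_nonzero:
  assumes "algebraically_independent I x" "f \<in> ratpoly I" "f x0 \<noteq> 0"
  shows "f x \<noteq> 0"
  using ratpoly_eval_poly[OF assms(2)] assms(1,3) eval_poly_0
  unfolding algebraically_independent_alt by metis

lemma eval_poly_ratpoly:
  assumes "P \<in> poly_on I" "\<And>i. i \<in> I \<Longrightarrow> g i \<in> ratpoly J"
  shows "(\<lambda>x. eval_poly P (\<lambda>i. g i x)) \<in> ratpoly J"
  unfolding eval_poly_def
  by (intro ratpoly_intros ratpoly.const) (use assms in \<open>auto simp: poly_on_def\<close>)

text \<open>A polynomial is determined by its finite graph of monomials and coefficients, and a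
  monomial over \<open>I\<close> by its exponents on the finite set \<open>I\<close>.\<close>

lemma countable_poly_on:
  assumes "finite I"
  shows "countable (poly_on I)"
proof -
  let ?M = "{m :: 'a \<Rightarrow>\<^sub>0 nat. Poly_Mapping.keys m \<subseteq> I}"
  have "countable (PiE I (\<lambda>_. UNIV :: nat set))"
    using assms by (intro countable_PiE) auto
  moreover have "inj_on (\<lambda>m. restrict (Poly_Mapping.lookup m) I) ?M"
  proof (intro inj_onI poly_mapping_eqI)
    fix m m' :: "'a \<Rightarrow>\<^sub>0 nat" and i
    assume *: "m \<in> ?M" "m' \<in> ?M" and "restrict (Poly_Mapping.lookup m) I = restrict (Poly_Mapping.lookup m') I"
    then show "Poly_Mapping.lookup m i = Poly_Mapping.lookup m' i"
      by (cases "i \<in> I") (metis restrict_apply', metis (mono_tags) in_keys_iff mem_Collect_eq subsetD)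
  qed
  ultimately have M: "countable ?M"
    by (metis (no_types, lifting) countable_image_inj_on countable_subset image_subset_iff
        restrict_PiE_iff UNIV_I)
  let ?g = "\<lambda>P :: ('a \<Rightarrow>\<^sub>0 nat) \<Rightarrow>\<^sub>0 rat. (\<lambda>m. (m, Poly_Mapping.lookup P m)) ` Poly_Mapping.keys P"
  have "countable {S. finite S \<and> S \<subseteq> ?M \<times> (UNIV :: rat set)}"
    by (rule countable_Collect_finite_subset) (use M in auto)
  moreover have "?g ` poly_on I \<subseteq> {S. finite S \<and> S \<subseteq> ?M \<times> UNIV}"
    unfolding poly_on_def by auto
  ultimately have "countable (?g ` poly_on I)" by (rule countable_subset[rotated])
  moreover have "inj ?g"
  proof (intro injI poly_mapping_eqI)
    fix P Q :: "('a \<Rightarrow>\<^sub>0 nat) \<Rightarrow>\<^sub>0 rat" and m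
    assume eq: "?g P = ?g Q"
    have graph: "(m, c) \<in> ?g R \<longleftrightarrow> c \<noteq> 0 \<and> c = Poly_Mapping.lookup R m" for R c
      by (auto simp: in_keys_iff)
    have "c \<noteq> 0 \<and> c = Poly_Mapping.lookup P m \<longleftrightarrow> c \<noteq> 0 \<and> c = Poly_Mapping.lookup Q m" for c
      unfolding graph[symmetric] eq ..
    then show "Poly_Mapping.lookup P m = Poly_Mapping.lookup Q m"
      by metis
  qed
  ultimately show ?thesis
    using countable_image_inj_on inj_on_subset by blast
qed

text \<open>With the coordinates in \<open>I\<close> fixed at \<open>x\<close>, \<open>P\<close>
  becomes a univariate polynomial whose coefficients are values at \<open>x\<close> of polynomials
  over \<open>I\<close>. Independence keeps one of these coefficients nonzero.\<close>

lemma finite_roots_last_variable: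
  assumes indep: "algebraically_independent I x" and "i \<notin> I" "P \<in> poly_on (insert i I)" "P \<noteq> 0"
  shows "finite {t. eval_poly P (x(i := t)) = 0}"
proof -
  let ?e = "\<lambda>m. Poly_Mapping.lookup m i"
  let ?r = "\<lambda>m. m - Poly_Mapping.single i (?e m)"
  have lk: "Poly_Mapping.lookup (?r m) j = (if j = i then 0 else Poly_Mapping.lookup m j)" for m j
    by (simp add: lookup_minus lookup_single when_def)
  have split: "?r m + Poly_Mapping.single i (?e m) = m" for m
    by (rule poly_mapping_eqI) (simp add: lookup_add lookup_minus lookup_single when_def)
  have mono: "monomial m (x(i := t)) = monomial (?r m) x * t ^ ?e m" for m t
  proof -
    have "monomial m (x(i := t)) = monomial (?r m) (x(i := t)) * monomial (Poly_Mapping.single i (?e m)) (x(i := t))"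
      by (metis monomial_add split)
    also have "monomial (Poly_Mapping.single i (?e m)) (x(i := t)) = t ^ ?e m"
      by (subst monomial_superset[of "{i}"]) auto
    also have "monomial (?r m) (x(i := t)) = monomial (?r m) x"
      unfolding monomial_def
      by (intro prod.cong) (auto simp: in_keys_iff lk)
    finally show ?thesis .
  qed
  define p where "p = (\<Sum>m\<in>Poly_Mapping.keys P.
    Polynomial.monom (of_rat (Poly_Mapping.lookup P m) * monomial (?r m) x) (?e m))"
  have p: "poly p t = eval_poly P (x(i := t))" for t
    unfolding p_def eval_poly_superset[OF finite_keys subset_refl] mono
    by (simp add: poly_sum poly_monom mult_ac)
  obtain m0 where m0: "m0 \<in> Poly_Mapping.keys P"
    using \<open>P \<noteq> 0\<close> by fastforce
  \<comment> \<open>The part of \<open>P\<close> with the same exponent of \<open>i\<close> as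
    \<open>m0\<close>, stripped of that power of \<open>i\<close>, gives \<open>Q\<close>; its value
    at \<open>x\<close> is the coefficient of \<open>p\<close> in degree
    \<open>?e m0\<close>.\<close>
  define K where "K = {m \<in> Poly_Mapping.keys P. ?e m = ?e m0}"
  define Q where "Q = (\<Sum>m\<in>K. Poly_Mapping.single (?r m) (Poly_Mapping.lookup P m))"
  have Q: "Q \<in> poly_on I"
    unfolding Q_def
  proof (intro poly_on_sum poly_on_single subsetI)
    fix m j assume m: "m \<in> K" and "j \<in> Poly_Mapping.keys (?r m)"
    then have "j \<noteq> i" "j \<in> Poly_Mapping.keys m" by (auto simp: in_keys_iff lk split: if_splits)
    then show "j \<in> I" using m assms(3) by (auto simp: poly_on_def K_def)
  qed
  \<comment> \<open>Monomials in \<open>K\<close> share the exponent of \<open>i\<close>, so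
    stripping it is injective and nothing cancels in \<open>Q\<close>.\<close>
  have "?r m = ?r m0 \<longleftrightarrow> m = m0" if "m \<in> K" for m
    using that split[of m] split[of m0] unfolding K_def by (metis (mono_tags, lifting) mem_Collect_eq)
  then have "Poly_Mapping.lookup Q (?r m0) = (\<Sum>m\<in>K. if m = m0 then Poly_Mapping.lookup P m else 0)"
    unfolding Q_def by (auto simp: lookup_sum lookup_single when_def intro!: sum.cong)
  also have "\<dots> = Poly_Mapping.lookup P m0"
    using m0 by (simp add: K_def)
  finally have "Q \<noteq> 0" using m0 by (auto simp: in_keys_iff)
  then have "eval_poly Q x \<noteq> 0"
    using indep Q by (auto simp: algebraically_independent_alt)
  also have "eval_poly Q x = coeff p (?e m0)"
    unfolding p_def Q_def K_def eval_poly_sum eval_poly_single coeff_sum coeff_monom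
    by (intro sum.mono_neutral_cong_left) auto
  finally have "p \<noteq> 0" by auto
  from poly_roots_finite[OF this] show ?thesis by (simp add: p)
qed

text \<open>One coordinate at a time: each of countably many nonzero polynomials excludes finitely
  many values of the new coordinate, and the reals are uncountable.\<close>

theorem ex_algebraically_independent:
  assumes "finite I"
  shows "\<exists>x. algebraically_independent I x"
  using assms
proof (induction I)
  case empty
  have "P = 0" if "P \<in> poly_on {}" "eval_poly P x = 0" for P and x :: "'a \<Rightarrow> real"
  proof (rule ccontr)
    assume "P \<noteq> 0"
    moreover have "Poly_Mapping.keys P \<subseteq> {0}" using that(1) by (auto simp: poly_on_def)
    ultimately have "Poly_Mapping.keys P = {0}" by (auto simp: subset_singleton_iff)
    moreover from this have "Poly_Mapping.lookup P 0 \<noteq> 0" by (metis in_keys_iff singletonI)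
    ultimately show False using that(2) by (simp add: eval_poly_def)
  qed
  then show ?case by (auto simp: algebraically_independent_alt)
next
  case (insert i I)
  then obtain x where x: "algebraically_independent I x" by blast
  have "countable (\<Union>P\<in>poly_on (insert i I) - {0}. {t. eval_poly P (x(i := t)) = 0})"
    using countable_poly_on[of "insert i I"] finite_roots_last_variable[OF x insert(2)] insert(1)
    by (intro countable_UN) (auto intro: countable_finite)
  then obtain t where "t \<notin> (\<Union>P\<in>poly_on (insert i I) - {0}. {t. eval_poly P (x(i := t)) = 0})"
    using uncountable_UNIV_real by (metis UNIV_eq_I)
  then have "algebraically_independent (insert i I) (x(i := t))"
    by (auto simp: algebraically_independent_alt)
  then show ?case by blast
qed

section \<open>Finite linear systems\<close>

text \<open>Full column rank, stated as a trivial kernel over arbitrary index sets because the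
  dimension \<open>d\<close> is a variable.\<close>

definition injective_system :: "'r set \<Rightarrow> 'c set \<Rightarrow> ('r \<Rightarrow> 'c \<Rightarrow> real) \<Rightarrow> bool" where
  "injective_system R J A \<longleftrightarrow>
     (\<forall>z. (\<forall>i\<in>R. (\<Sum>j\<in>J. A i j * z j) = 0) \<longrightarrow> (\<forall>j\<in>J. z j = 0))"

lemma injective_systemI:
  assumes "\<And>z j. (\<And>i. i \<in> R \<Longrightarrow> (\<Sum>j\<in>J. A i j * z j) = 0) \<Longrightarrow> j \<in> J \<Longrightarrow> z j = 0"
  shows "injective_system R J A"
  using assms unfolding injective_system_def by blast

lemma injective_systemD:
  assumes "injective_system R J A" "\<And>i. i \<in> R \<Longrightarrow> (\<Sum>j\<in>J. A i j * z j) = 0" "j \<in> J"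
  shows "z j = 0"
  using assms unfolding injective_system_def by blast

lemma injective_system_pivot:
  assumes "injective_system R J A" "j \<in> J" "finite J"
  shows "\<exists>i\<in>R. A i j \<noteq> 0"
proof (rule ccontr)
  assume "\<not> (\<exists>i\<in>R. A i j \<noteq> 0)"
  then have "(\<Sum>l\<in>J. A i l * (if l = j then 1 else 0)) = 0" if "i \<in> R" for i
    using that by (intro sum.neutral) auto
  from injective_systemD[OF assms(1) this assms(2)] show False by simp
qed

text \<open>Cross-multiplication replaces the division of Gaussian elimination. Row
  \<open>i0\<close> may stay in the system since it becomes zero.\<close>

lemma injective_system_eliminate:
  assumes fin: "finite J" and j0: "j0 \<notin> J" and i0: "i0 \<in> R" and piv: "A i0 j0 \<noteq> 0"
  shows "injective_system R (insert j0 J) A \<longleftrightarrow>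
    injective_system R J (\<lambda>i j. A i0 j0 * A i j - A i j0 * A i0 j)"
    (is "?L \<longleftrightarrow> injective_system R J ?B")
proof -
  have B: "(\<Sum>j\<in>J. ?B i j * z j) = A i0 j0 * (\<Sum>j\<in>J. A i j * z j) - A i j0 * (\<Sum>j\<in>J. A i0 j * z j)"
    for i z by (simp add: sum_subtractf sum_distrib_left left_diff_distrib mult.assoc)
  have ins: "(\<Sum>j\<in>insert j0 J. A i j * z j) = A i j0 * z j0 + (\<Sum>j\<in>J. A i j * z j)" for i z
    using fin j0 by simp
  show ?thesis
  proof
    assume L: ?L
    show "injective_system R J ?B"
    proof (rule injective_systemI)
      fix z j assume z: "\<And>i. i \<in> R \<Longrightarrow> (\<Sum>j\<in>J. ?B i j * z j) = 0" and j: "j \<in> J"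
      define z' where "z' = z(j0 := - (\<Sum>j\<in>J. A i0 j * z j) / A i0 j0)"
      have z': "(\<Sum>j\<in>J. A i j * z' j) = (\<Sum>j\<in>J. A i j * z j)" for i
        unfolding z'_def using j0 by (intro sum.cong) auto
      have "(\<Sum>j\<in>insert j0 J. A i j * z' j) = 0" if "i \<in> R" for i
        using z[OF that] piv unfolding ins z' B by (simp add: z'_def field_simps)
      then have "z' j = 0" using injective_systemD[OF L, of z' j] j by blast
      then show "z j = 0" using j j0 by (auto simp: z'_def split: if_splits)
    qed
  next
    assume inj: "injective_system R J ?B"
    show ?L
    proof (rule injective_systemI)
      fix z j assume z: "\<And>i. i \<in> R \<Longrightarrow> (\<Sum>j\<in>insert j0 J. A i j * z j) = 0" and j: "j \<in> insert j0 J"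
      have "(\<Sum>j\<in>J. ?B i j * z j) = 0" if "i \<in> R" for i
        using z[OF that] z[OF i0] unfolding B ins by algebra
      then have J: "z l = 0" if "l \<in> J" for l
        using injective_systemD[OF inj, of z l] that by blast
      then have "A i0 j0 * z j0 = 0" using z[OF i0] by (simp add: ins)
      then show "z j = 0" using J j piv by auto
    qed
  qed
qed

text \<open>Elimination keeps the entries polynomial, so a pivot that does not vanish at the special
  point does not vanish at the generic one either.\<close>

theorem injective_system_generic:
  assumes "finite J" "\<And>i j. i \<in> R \<Longrightarrow> j \<in> J \<Longrightarrow> A i j \<in> ratpoly I"
    and "algebraically_independent I x" "injective_system R J (\<lambda>i j. A i j x0)"
  shows "injective_system R J (\<lambda>i j. A i j x)"
  using assms(1,2,4)
proof (induction J arbitrary: A)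
  case empty
  then show ?case by (simp add: injective_system_def)
next
  case (insert j0 J)
  obtain i0 where i0: "i0 \<in> R" "A i0 j0 x0 \<noteq> 0"
    using injective_system_pivot[OF insert.prems(2), of j0] insert.hyps by auto
  have "A i0 j0 x \<noteq> 0"
    using i0 insert.prems(1) assms(3) ratpoly_nonzero by blast
  moreover have "injective_system R J (\<lambda>i j. A i0 j0 x * A i j x - A i j0 x * A i0 j x)"
  proof (rule insert.IH)
    show "(\<lambda>x. A i0 j0 x * A i j x - A i j0 x * A i0 j x) \<in> ratpoly I" if "i \<in> R" "j \<in> J" for i j
      by (intro ratpoly_intros insert.prems) (use that i0 in auto)
    show "injective_system R J (\<lambda>i j. A i0 j0 x0 * A i j x0 - A i j0 x0 * A i0 j x0)"
      using injective_system_eliminate[of J j0 i0 R "\<lambda>i j. A i j x0"] insert i0 by blast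
  qed
  ultimately show ?case
    using injective_system_eliminate[of J j0 i0 R "\<lambda>i j. A i j x"] insert.hyps i0 by blast
qed

text \<open>Source of explicit constants: applied to \<open>product_row\<close>, the entries
  \<open>w\<close> bound a vector by its image. The proof undoes one elimination step at a
  time.\<close>

lemma injective_system_left_inverse:
  assumes "finite J" "finite R" "injective_system R J A"
  shows "\<exists>w. \<forall>l\<in>J. \<forall>j\<in>J. (\<Sum>i\<in>R. w l i * A i j) = (if j = l then 1 else 0)"
  using assms
proof (induction J arbitrary: A)
  case empty
  then show ?case by simp
next
  case (insert j0 J)
  obtain i0 where i0: "i0 \<in> R" "A i0 j0 \<noteq> 0"
    using injective_system_pivot[OF insert.prems(2), of j0] insert.hyps by auto
  define D where "D = A i0 j0"
  have D: "D \<noteq> 0" using i0 by (simp add: D_def)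
  have "injective_system R J (\<lambda>i j. D * A i j - A i j0 * A i0 j)"
    using injective_system_eliminate[of J j0 i0 R A] insert.prems insert.hyps i0 by (simp add: D_def)
  then obtain w where w: "\<forall>l\<in>J. \<forall>j\<in>J. (\<Sum>i\<in>R. w l i * (D * A i j - A i j0 * A i0 j)) = (if j = l then 1 else 0)"
    using insert.IH insert.prems by blast
  define s where "s l = (\<Sum>i\<in>R. w l i * A i j0)" for l
  \<comment> \<open>Rewrites a combination of eliminated rows as one of the original rows; by the
    choice of \<open>s\<close> it vanishes in column \<open>j0\<close>.\<close>
  define v where "v l i = D * w l i - (if i = i0 then s l else 0)" for l i
  have v: "(\<Sum>i\<in>R. v l i * A i j) = D * (\<Sum>i\<in>R. w l i * A i j) - s l * A i0 j" for l j
  proof -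
    have "(\<Sum>i\<in>R. (if i = i0 then s l else 0) * A i j) = (\<Sum>i\<in>R. if i = i0 then s l * A i0 j else 0)"
      by (intro sum.cong) auto
    also have "\<dots> = s l * A i0 j" using i0 insert.prems(1) by simp
    finally show ?thesis
      by (simp add: v_def left_diff_distrib sum_subtractf sum_distrib_left mult.assoc)
  qed
  have "(\<Sum>i\<in>R. w l i * (D * A i j - A i j0 * A i0 j)) = (\<Sum>i\<in>R. v l i * A i j)" for l j
    unfolding v by (simp add: right_diff_distrib sum_subtractf sum_distrib_left sum_distrib_right s_def mult_ac)
  then have vJ: "(\<Sum>i\<in>R. v l i * A i j) = (if j = l then 1 else 0)" if "l \<in> J" "j \<in> J" for l j
    using w that by simp
  have v0: "(\<Sum>i\<in>R. v l i * A i j0) = 0" for l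
    unfolding v s_def[symmetric] by (simp add: D_def)
  \<comment> \<open>Row \<open>i0\<close> with its entries outside column \<open>j0\<close> cleared
    by the \<open>v l\<close>, then scaled to pivot 1.\<close>
  define u where "u i = ((if i = i0 then 1 else 0) - (\<Sum>l\<in>J. A i0 l * v l i)) / D" for i
  have u: "(\<Sum>i\<in>R. u i * A i j) = (A i0 j - (\<Sum>l\<in>J. A i0 l * (\<Sum>i\<in>R. v l i * A i j))) / D" for j
  proof -
    have "(\<Sum>i\<in>R. u i * A i j) = (\<Sum>i\<in>R. (if i = i0 then A i0 j else 0) - (\<Sum>l\<in>J. A i0 l * (v l i * A i j))) / D"
      unfolding sum_divide_distrib u_def
      by (intro sum.cong) (auto simp: sum_distrib_right left_diff_distrib mult.assoc)
    also have "\<dots> = (A i0 j - (\<Sum>i\<in>R. \<Sum>l\<in>J. A i0 l * (v l i * A i j))) / D"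
      using i0 insert.prems(1) by (simp add: sum_subtractf)
    also have "(\<Sum>i\<in>R. \<Sum>l\<in>J. A i0 l * (v l i * A i j)) = (\<Sum>l\<in>J. A i0 l * (\<Sum>i\<in>R. v l i * A i j))"
      by (subst sum.swap) (simp add: sum_distrib_left)
    finally show ?thesis .
  qed
  have u0: "(\<Sum>i\<in>R. u i * A i j0) = 1"
    unfolding u v0 using D by (simp add: D_def)
  have uJ: "(\<Sum>i\<in>R. u i * A i j) = 0" if "j \<in> J" for j
  proof -
    have "(\<Sum>l\<in>J. A i0 l * (\<Sum>i\<in>R. v l i * A i j)) = (\<Sum>l\<in>J. if l = j then A i0 j else 0)"
      by (intro sum.cong) (use vJ that in auto)
    also have "\<dots> = A i0 j" using that insert.hyps by simp
    finally show ?thesis unfolding u by simp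
  qed
  show ?case
    by (rule exI[of _ "\<lambda>l. if l = j0 then u else v l"])
      (use insert.hyps u0 uJ vJ v0 in auto)
qed

lemma ex_nontrivial_solution:
  assumes "finite R" "finite J" "card R < card J"
  shows "\<exists>z. (\<exists>j\<in>J. z j \<noteq> 0) \<and> (\<forall>i\<in>R. (\<Sum>j\<in>J. A i j * z j) = (0 :: real))"
  using assms
proof (induction R arbitrary: J A)
  case empty
  then obtain j where "j \<in> J" by fastforce
  then show ?case by (intro exI[of _ "\<lambda>_. 1"]) auto
next
  case (insert i0 R)
  show ?case
  proof (cases "\<exists>j\<in>J. A i0 j \<noteq> 0")
    case False
    obtain z where z: "\<exists>j\<in>J. z j \<noteq> 0" "\<forall>i\<in>R. (\<Sum>j\<in>J. A i j * z j) = 0"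
      using insert.IH[of J A] insert.prems insert.hyps by auto
    moreover have "(\<Sum>j\<in>J. A i0 j * z j) = 0" using False by (intro sum.neutral) auto
    ultimately show ?thesis by (intro exI[of _ z]) auto
  next
    case True
    then obtain j0 where j0: "j0 \<in> J" "A i0 j0 \<noteq> 0" by blast
    define K where "K = J - {j0}"
    have J: "J = insert j0 K" "j0 \<notin> K" "finite K" using j0 insert.prems by (auto simp: K_def)
    have "card R < card K" using insert.prems insert.hyps J by simp
    then obtain z where z: "\<exists>j\<in>K. z j \<noteq> 0"
      "\<forall>i\<in>R. (\<Sum>j\<in>K. (A i0 j0 * A i j - A i j0 * A i0 j) * z j) = 0"
      using insert.IH[of K "\<lambda>i j. A i0 j0 * A i j - A i j0 * A i0 j"] J by blast
    define z' where "z' = z(j0 := - (\<Sum>j\<in>K. A i0 j * z j) / A i0 j0)"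
    have z': "(\<Sum>j\<in>J. A i j * z' j) = A i j0 * z' j0 + (\<Sum>j\<in>K. A i j * z j)" for i
    proof -
      have "(\<Sum>j\<in>K. A i j * z' j) = (\<Sum>j\<in>K. A i j * z j)"
        unfolding z'_def using J by (intro sum.cong) auto
      then show ?thesis using J by simp
    qed
    have "(\<Sum>j\<in>J. A i j * z' j) = 0" if "i \<in> R" for i
    proof -
      have "A i0 j0 * (\<Sum>j\<in>K. A i j * z j) - A i j0 * (\<Sum>j\<in>K. A i0 j * z j) = 0"
        using z(2) that by (simp add: sum_subtractf sum_distrib_left left_diff_distrib mult.assoc)
      then show ?thesis using j0 unfolding z' by (simp add: z'_def field_simps)
    qed
    moreover have "(\<Sum>j\<in>J. A i0 j * z' j) = 0"
      using j0 unfolding z' by (simp add: z'_def)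
    moreover have "\<exists>j\<in>J. z' j \<noteq> 0" using z(1) J by (auto simp: z'_def)
    ultimately show ?thesis by (intro exI[of _ z']) auto
  qed
qed

text \<open>The right-hand side enters as an additional column indexed by \<open>None\<close>. If
  the rows are too few to prevent a kernel vector, injectivity forces its \<open>None\<close> entry
  to be nonzero, and dividing by that entry solves the system.\<close>

lemma injective_system_surjective:
  assumes "finite R" "finite J" "card R \<le> card J" "injective_system R J A"
  shows "\<exists>z. \<forall>i\<in>R. (\<Sum>j\<in>J. A i j * z j) = b i"
proof -
  let ?K = "insert None (Some ` J)"
  let ?A = "\<lambda>i. case_option (- b i) (A i)"
  have "card R < card ?K"
    using assms by (simp add: card_image)
  then obtain z where z: "\<exists>j\<in>?K. z j \<noteq> 0" "\<forall>i\<in>R. (\<Sum>j\<in>?K. ?A i j * z j) = 0"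
    using ex_nontrivial_solution[of R ?K ?A] assms by auto
  have eq: "(\<Sum>j\<in>J. A i j * z (Some j)) = b i * z None" if "i \<in> R" for i
    using z(2) that assms(2) by (auto simp: sum.reindex)
  have "z None \<noteq> 0"
  proof
    assume 0: "z None = 0"
    then have "z (Some j) = 0" if "j \<in> J" for j
      using injective_systemD[OF assms(4), of "\<lambda>j. z (Some j)" j] eq that by simp
    with 0 z(1) show False by auto
  qed
  then have "(\<Sum>j\<in>J. A i j * (z (Some j) / z None)) = b i" if "i \<in> R" for i
    using eq[OF that] by (simp add: sum_divide_distrib[symmetric])
  then show ?thesis by (intro exI ballI)
qed

section \<open>Independent products of vectors\<close>

text \<open>For symmetric \<open>A\<close> this is linear independence in the symmetric square: an
  edge is present as two arcs carrying the same coefficient, so the sums are the coordinates of a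
  symmetric tensor.\<close>

definition indep_products :: "('v \<times> 'v) set \<Rightarrow> 'i set \<Rightarrow> ('v \<Rightarrow> 'i \<Rightarrow> real) \<Rightarrow> bool" where
  "indep_products A I y \<longleftrightarrow>
     (\<forall>\<mu>. (\<forall>(u, v)\<in>A. \<mu> u v = \<mu> v u) \<longrightarrow>
          (\<forall>a\<in>I. \<forall>b\<in>I. (\<Sum>(u, v)\<in>A. \<mu> u v * (y u a * y v b)) = 0) \<longrightarrow>
          (\<forall>(u, v)\<in>A. \<mu> u v = 0))"

lemma indep_productsI:
  assumes "\<And>\<mu> u v. \<lbrakk>\<And>u v. (u, v) \<in> A \<Longrightarrow> \<mu> u v = \<mu> v u;
      \<And>a b. a \<in> I \<Longrightarrow> b \<in> I \<Longrightarrow> (\<Sum>(u, v)\<in>A. \<mu> u v * (y u a * y v b)) = 0;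
      (u, v) \<in> A\<rbrakk> \<Longrightarrow> \<mu> u v = 0"
  shows "indep_products A I y"
  unfolding indep_products_def
proof (intro allI impI, clarify)
  fix \<mu> u v
  assume "\<forall>(u, v)\<in>A. \<mu> u v = \<mu> v u"
    and "\<forall>a\<in>I. \<forall>b\<in>I. (\<Sum>(u, v)\<in>A. \<mu> u v * (y u a * y v b)) = 0" and "(u, v) \<in> A"
  then show "\<mu> u v = 0" by (intro assms[of \<mu> u v]) auto
qed

lemma indep_productsD:
  assumes "indep_products A I y" "\<And>u v. (u, v) \<in> A \<Longrightarrow> \<mu> u v = \<mu> v u"
    "\<And>a b. a \<in> I \<Longrightarrow> b \<in> I \<Longrightarrow> (\<Sum>(u, v)\<in>A. \<mu> u v * (y u a * y v b)) = 0" "(u, v) \<in> A"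
  shows "\<mu> u v = 0"
proof -
  have "(\<forall>(u, v)\<in>A. \<mu> u v = \<mu> v u) \<longrightarrow>
      (\<forall>a\<in>I. \<forall>b\<in>I. (\<Sum>(u, v)\<in>A. \<mu> u v * (y u a * y v b)) = 0) \<longrightarrow> (\<forall>(u, v)\<in>A. \<mu> u v = 0)"
    using assms(1) unfolding indep_products_def by (rule spec)
  moreover have "\<forall>(u, v)\<in>A. \<mu> u v = \<mu> v u" using assms(2) by auto
  moreover have "\<forall>a\<in>I. \<forall>b\<in>I. (\<Sum>(u, v)\<in>A. \<mu> u v * (y u a * y v b)) = 0" using assms(3) by auto
  ultimately have "\<forall>(u, v)\<in>A. \<mu> u v = 0" by (elim impE)
  then show ?thesis using assms(4) by auto
qed

lemma indep_products_mono:
  "indep_products A I y \<Longrightarrow> I \<subseteq> I' \<Longrightarrow> indep_products A I' y"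
proof (rule indep_productsI)
  fix \<mu> u v
  assume "indep_products A I y" "I \<subseteq> I'" "\<And>u v. (u, v) \<in> A \<Longrightarrow> \<mu> u v = \<mu> v u" "(u, v) \<in> A"
    and "\<And>a b. a \<in> I' \<Longrightarrow> b \<in> I' \<Longrightarrow> (\<Sum>(u, v)\<in>A. \<mu> u v * (y u a * y v b)) = 0"
  then show "\<mu> u v = 0" by (intro indep_productsD[where \<mu> = \<mu> and y = y]) (auto simp: subset_eq)
qed

text \<open>\<open>Inl\<close> rows are the tensor coordinates. \<open>Inr\<close> rows impose the
  symmetry of the coefficients as equations, since \<open>injective_system\<close> ranges over all
  vectors.\<close>

primrec product_row :: "('v \<Rightarrow> 'i \<Rightarrow> real) \<Rightarrow> 'i \<times> 'i + 'v \<times> 'v \<Rightarrow> 'v \<times> 'v \<Rightarrow> real" where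
  "product_row y (Inl ab) e = y (fst e) (fst ab) * y (snd e) (snd ab)"
| "product_row y (Inr e') e = (if e = e' then 1 else 0) - (if e = prod.swap e' then 1 else 0)"

lemma indep_products_iff_injective_system:
  assumes "finite A" "sym A"
  shows "indep_products A I y \<longleftrightarrow>
    injective_system (Inl ` (I \<times> I) \<union> Inr ` A) A (product_row y)"
proof -
  have Inl: "(\<Sum>e\<in>A. product_row y (Inl (a, b)) e * z e) = (\<Sum>(u, v)\<in>A. z (u, v) * (y u a * y v b))"
    for a b z by (intro sum.cong) (auto simp: mult_ac)
  have Inr: "(\<Sum>e\<in>A. product_row y (Inr (u, v)) e * z e) = z (u, v) - z (v, u)"
    if "(u, v) \<in> A" for u v z
  proof -
    have "(v, u) \<in> A" using that assms(2) by (auto dest: symD)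
    have "(\<Sum>e\<in>A. product_row y (Inr (u, v)) e * z e)
        = (\<Sum>e\<in>A. (if e = (u, v) then z e else 0) - (if e = (v, u) then z e else 0))"
      by (simp add: left_diff_distrib if_distrib[where f = "\<lambda>c. c * _"] cong: if_cong)
    also have "\<dots> = z (u, v) - z (v, u)"
      using assms(1) that \<open>(v, u) \<in> A\<close> by (simp add: sum_subtractf)
    finally show ?thesis .
  qed
  show ?thesis
  proof
    assume ip: "indep_products A I y"
    show "injective_system (Inl ` (I \<times> I) \<union> Inr ` A) A (product_row y)"
    proof (rule injective_systemI)
      fix z e
      assume z: "\<And>i. i \<in> Inl ` (I \<times> I) \<union> Inr ` A \<Longrightarrow> (\<Sum>j\<in>A. product_row y i j * z j) = 0" and e: "e \<in> A"
      have "z (fst e, snd e) = 0"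
      proof (rule indep_productsD[OF ip, where \<mu> = "\<lambda>u v. z (u, v)"])
        show "z (u, v) = z (v, u)" if "(u, v) \<in> A" for u v
          using z[of "Inr (u, v)"] Inr[OF that, of z] that by simp
        show "(\<Sum>(u, v)\<in>A. z (u, v) * (y u a * y v b)) = 0" if "a \<in> I" "b \<in> I" for a b
          using z[of "Inl (a, b)"] Inl[of a b z] that by simp
      qed (use e in simp)
      then show "z e = 0" by simp
    qed
  next
    assume inj: "injective_system (Inl ` (I \<times> I) \<union> Inr ` A) A (product_row y)"
    show "indep_products A I y"
    proof (rule indep_productsI)
      fix \<mu> u v
      assume sy: "\<And>u v. (u, v) \<in> A \<Longrightarrow> \<mu> u v = \<mu> v u"
        and z: "\<And>a b. a \<in> I \<Longrightarrow> b \<in> I \<Longrightarrow> (\<Sum>(u, v)\<in>A. \<mu> u v * (y u a * y v b)) = 0" and e: "(u, v) \<in> A"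
      have "(\<Sum>e\<in>A. product_row y i e * \<mu> (fst e) (snd e)) = 0" if "i \<in> Inl ` (I \<times> I) \<union> Inr ` A" for i
        using that Inl[of _ _ "\<lambda>e. \<mu> (fst e) (snd e)"] Inr[of _ _ "\<lambda>e. \<mu> (fst e) (snd e)"] sy z
        by auto
      from injective_systemD[OF inj this e] show "\<mu> u v = 0" by simp
    qed
  qed
qed

text \<open>The vectors may depend polynomially on the generic parameters instead of having free
  coordinates; the Gale vectors need this generality.\<close>

lemma indep_products_generic:
  assumes "finite A" "sym A" "algebraically_independent J x"
    and "\<And>u a. u \<in> fst ` A \<Longrightarrow> a \<in> I \<Longrightarrow> f u a \<in> ratpoly J"
    and "indep_products A I (\<lambda>u a. f u a xs)"
  shows "indep_products A I (\<lambda>u a. f u a x)"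
proof -
  have "injective_system (Inl ` (I \<times> I) \<union> Inr ` A) A (\<lambda>r e. product_row (\<lambda>u a. f u a x) r e)"
  proof (rule injective_system_generic[OF assms(1) _ assms(3),
        where A = "\<lambda>r e x. product_row (\<lambda>u a. f u a x) r e"])
    fix r and e :: "'a \<times> 'a" assume r: "r \<in> Inl ` (I \<times> I) \<union> Inr ` A" and e: "e \<in> A"
    have fs: "fst e \<in> fst ` A" "snd e \<in> fst ` A"
      using e symD[OF assms(2), of "fst e" "snd e"] by force+
    show "(\<lambda>x. product_row (\<lambda>u a. f u a x) r e) \<in> ratpoly J"
    proof (cases r)
      case (Inl ab)
      then have "(\<lambda>x. f (fst e) (fst ab) x * f (snd e) (snd ab) x) \<in> ratpoly J"
        using r fs by (intro ratpoly.mult assms(4)) auto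
      then show ?thesis by (simp add: Inl)
    next
      case (Inr e')
      then show ?thesis by (auto simp: ratpoly_0 ratpoly_1 ratpoly_uminus)
    qed
  next
    show "injective_system (Inl ` (I \<times> I) \<union> Inr ` A) A (\<lambda>r e. product_row (\<lambda>u a. f u a xs) r e)"
      using iffD1[OF indep_products_iff_injective_system[OF assms(1,2)] assms(5)] .
  qed
  then show ?thesis by (rule iffD2[OF indep_products_iff_injective_system[OF assms(1,2)]])
qed

text \<open>Checked at the point that sends \<open>N\<close> injectively to unit vectors. Taking
  \<open>k < K\<close> tests independence modulo the remaining basis vectors.\<close>

lemma generic_vectors_independent:
  assumes x: "algebraically_independent (V \<times> {..<K}) x" and "N \<subseteq> V" "finite N" "card N \<le> k" "k \<le> K"
    and c: "\<And>a. a < k \<Longrightarrow> (\<Sum>u\<in>N. c u * x (u, a)) = 0" and "u \<in> N"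
  shows "c u = 0"
proof -
  obtain idx where idx: "bij_betw idx N {..<card N}"
    using assms(3) ex_bij_betw_finite_nat atLeast0LessThan by metis
  have "injective_system {..<k} N (\<lambda>a u. x (u, a))"
  proof (rule injective_system_generic[OF assms(3) _ x])
    show "(\<lambda>x. x (u, a)) \<in> ratpoly (V \<times> {..<K})" if "a \<in> {..<k}" "u \<in> N" for a u
      using that assms by (intro ratpoly_intros) auto
    show "injective_system {..<k} N (\<lambda>a u. (\<lambda>(u, a). if a = idx u then 1 else 0) (u, a))"
    proof (rule injective_systemI)
      fix z u assume z: "\<And>a. a \<in> {..<k} \<Longrightarrow> (\<Sum>u\<in>N. (\<lambda>(u, a). if a = idx u then 1 else 0) (u, a) * z u) = (0::real)"
        and u: "u \<in> N"
      have "idx u < k" using bij_betwE[OF idx] u assms(4) by fastforce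
      then have "0 = (\<Sum>v\<in>N. (if idx u = idx v then 1 else 0) * z v)" using z[of "idx u"] by simp
      also have "\<dots> = (\<Sum>v\<in>N. if v = u then z v else 0)"
        using idx u by (intro sum.cong) (auto simp: bij_betw_def inj_on_def)
      finally show "z u = 0" using u assms(3) by simp
    qed
  qed
  from injective_systemD[OF this, of c u] show ?thesis
    using c assms(7) by (simp add: mult.commute)
qed

text \<open>Placing all of \<open>W\<close> at the last basis vector \<open>e\<close> sends the arcs that avoid \<open>W\<close> to products
  modulo \<open>e\<close>, one dimension lower, and the arcs that meet \<open>W\<close> to \<open>e\<close> times a vector.\<close>

lemma indep_products_cone:
  fixes A :: "('v \<times> 'v) set"
  assumes fin: "finite A" and sym: "sym A"
    and uniq: "\<And>u w w'. \<lbrakk>u \<notin> W; w \<in> W; w' \<in> W; (u, w) \<in> A; (u, w') \<in> A\<rbrakk> \<Longrightarrow> w = w'"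
    and N: "N = {u. u \<notin> W \<and> (\<exists>w\<in>W. (u, w) \<in> A)}"
    and inner: "A \<inter> W \<times> W = {} \<and> card N \<le> Suc k \<or>
      (\<exists>s s'. s \<noteq> s' \<and> A \<inter> W \<times> W = {(s, s'), (s', s)}) \<and> card N \<le> k"
    and IH: "\<exists>y. indep_products {(u, v) \<in> A. u \<notin> W \<and> v \<notin> W} {..<k} y"
  shows "\<exists>y. indep_products A {..<Suc k} y"
proof -
  define V where "V = fst ` A"
  define B where "B = {(u, v) \<in> A. u \<notin> W \<and> v \<notin> W}"
  define T where "T = {(u, v) \<in> A. u \<notin> W \<and> v \<in> W}"
  define T' where "T' = {(u, v) \<in> A. u \<in> W \<and> v \<notin> W}"
  define U where "U = A \<inter> W \<times> W"
  have finV: "finite V" and NV: "N \<subseteq> V"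
    using fin by (auto simp: V_def N intro: rev_image_eqI)
  have finN: "finite N" using finV NV finite_subset by blast
  obtain x where x: "algebraically_independent (V \<times> {..<Suc k}) x"
    using ex_algebraically_independent[of "V \<times> {..<Suc k}"] finV by auto
  obtain y0 where y0: "indep_products B {..<k} y0" using IH by (auto simp: B_def)
  have finB: "finite B" and symB: "sym B"
    using fin sym by (auto simp: B_def sym_def intro: finite_subset[OF _ fin])
  have ipB: "indep_products B {..<k} (\<lambda>u a. x (u, a))"
  proof (rule indep_products_generic[OF finB symB x, where f = "\<lambda>u a x. x (u, a)" and xs = "\<lambda>(u, a). y0 u a"])
    show "(\<lambda>x. x (u, a)) \<in> ratpoly (V \<times> {..<Suc k})" if "u \<in> fst ` B" "a \<in> {..<k}" for u a
      using that by (intro ratpoly_intros) (force simp: V_def B_def)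
  qed (use y0 in simp)
  define y where "y = (\<lambda>v a. if v \<in> W then (if a = k then 1 else 0) else x (v, a))"
  have "indep_products A {..<Suc k} y"
  proof (rule indep_productsI)
    fix \<mu> :: "'v \<Rightarrow> 'v \<Rightarrow> real" and p q
    assume sy: "\<And>u v. (u, v) \<in> A \<Longrightarrow> \<mu> u v = \<mu> v u"
      and z: "\<And>a b. a \<in> {..<Suc k} \<Longrightarrow> b \<in> {..<Suc k} \<Longrightarrow> (\<Sum>(u, v)\<in>A. \<mu> u v * (y u a * y v b)) = 0"
      and pq: "(p, q) \<in> A"
    \<comment> \<open>In coordinates below \<open>k\<close> the vectors of \<open>W\<close> vanish,
      so only arcs of \<open>B\<close> contribute and independence in dimension \<open>k\<close>
      applies.\<close>
    have B0: "\<mu> u v = 0" if "(u, v) \<in> B" for u v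
    proof (rule indep_productsD[OF ipB _ _ that])
      show "\<mu> u v = \<mu> v u" if "(u, v) \<in> B" for u v using that sy by (auto simp: B_def)
      fix a b assume ab: "a \<in> {..<k}" "b \<in> {..<k}"
      have "(\<Sum>(u, v)\<in>B. \<mu> u v * (x (u, a) * x (v, b))) = (\<Sum>(u, v)\<in>A. \<mu> u v * (y u a * y v b))"
        using ab fin by (intro sum.mono_neutral_cong_left) (auto simp: B_def y_def)
      then show "(\<Sum>(u, v)\<in>B. \<mu> u v * (x (u, a) * x (v, b))) = 0" using z ab by simp
    qed
    \<comment> \<open>The unique neighbour in \<open>W\<close>; it makes \<open>N\<close> an index
      set for \<open>T\<close>.\<close>
    define w where "w = (\<lambda>u. SOME w. w \<in> W \<and> (u, w) \<in> A)"
    have w: "w u \<in> W" "(u, w u) \<in> A" if "u \<in> N" for u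
      using that someI_ex[of "\<lambda>w. w \<in> W \<and> (u, w) \<in> A"] by (auto simp: w_def N)
    have T: "T = (\<lambda>u. (u, w u)) ` N"
    proof
      show "(\<lambda>u. (u, w u)) ` N \<subseteq> T" using w by (auto simp: T_def N)
      show "T \<subseteq> (\<lambda>u. (u, w u)) ` N"
      proof clarify
        fix u v assume "(u, v) \<in> T"
        then have "u \<in> N" "v \<in> W" "(u, v) \<in> A" by (auto simp: T_def N)
        moreover from this have "w u = v" using w[of u] by (auto simp: N intro: uniq)
        ultimately show "(u, v) \<in> (\<lambda>u. (u, w u)) ` N" by blast
      qed
    qed
    define c where "c = (\<lambda>u. \<mu> u (w u))"
    have sumT: "(\<Sum>(u, v)\<in>T. \<mu> u v * x (u, a)) = (\<Sum>u\<in>N. c u * x (u, a))" for a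
      unfolding T c_def by (subst sum.reindex) (auto simp: inj_on_def)
    \<comment> \<open>Coordinate \<open>(a, k)\<close>: an arc starting in \<open>W\<close> vanishes
      because of \<open>a\<close>, and arcs of \<open>B\<close> have coefficient 0. What remains is
      a relation between the generic vectors of \<open>N\<close>.\<close>
    have c1: "(\<Sum>u\<in>N. c u * x (u, a)) = 0" if a: "a < k" for a
    proof -
      have "(\<Sum>(u, v)\<in>T. \<mu> u v * x (u, a)) = (\<Sum>(u, v)\<in>A. \<mu> u v * (y u a * y v k))"
      proof (intro sum.mono_neutral_cong_left ballI)
        fix e assume "e \<in> A - T"
        then show "(case e of (u, v) \<Rightarrow> \<mu> u v * (y u a * y v k)) = 0"
          using a B0[of "fst e" "snd e"] by (cases e) (auto simp: y_def T_def B_def)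
      qed (use fin a in \<open>auto simp: T_def y_def\<close>)
      then show ?thesis using z[of a k] a by (simp add: sumT)
    qed
    have A: "A = U \<union> (T \<union> (T' \<union> B))"
      by (auto simp: U_def T_def T'_def B_def)
    have fins: "finite U" "finite T" "finite T'"
      using fin by (auto simp: U_def T_def T'_def intro: finite_subset[OF _ fin])
    have T': "T' = prod.swap ` T"
      using sym by (auto simp: T_def T'_def sym_def image_iff)
    have "(\<Sum>(u, v)\<in>T'. \<mu> u v * (y u k * y v k)) = (\<Sum>(u, v)\<in>T. \<mu> u v * (y u k * y v k))"
      unfolding T' by (subst sum.reindex) (auto intro!: sum.cong simp: T_def dest: sy)
    also have "\<dots> = (\<Sum>(u, v)\<in>T. \<mu> u v * x (u, k))"
      by (intro sum.cong) (auto simp: T_def y_def)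
    finally have sT': "(\<Sum>(u, v)\<in>T'. \<mu> u v * (y u k * y v k)) = (\<Sum>u\<in>N. c u * x (u, k))"
      by (simp add: sumT)
    have sT: "(\<Sum>(u, v)\<in>T. \<mu> u v * (y u k * y v k)) = (\<Sum>u\<in>N. c u * x (u, k))"
      unfolding sumT[symmetric] by (intro sum.cong) (auto simp: T_def y_def)
    have sU: "(\<Sum>(u, v)\<in>U. \<mu> u v * (y u k * y v k)) = (\<Sum>(u, v)\<in>U. \<mu> u v)"
      by (intro sum.cong) (auto simp: U_def y_def)
    have sB: "(\<Sum>(u, v)\<in>B. \<mu> u v * (y u k * y v k)) = 0"
      by (intro sum.neutral) (auto simp: B0)
    have "(\<Sum>(u, v)\<in>A. \<mu> u v * (y u k * y v k)) = (\<Sum>(u, v)\<in>U. \<mu> u v * (y u k * y v k))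
        + ((\<Sum>(u, v)\<in>T. \<mu> u v * (y u k * y v k)) + ((\<Sum>(u, v)\<in>T'. \<mu> u v * (y u k * y v k))
        + (\<Sum>(u, v)\<in>B. \<mu> u v * (y u k * y v k))))"
      unfolding A using fins finB
      by (subst sum.union_disjoint, simp, simp, force simp: U_def T_def T'_def B_def)+ simp
    \<comment> \<open>Coordinate \<open>(k, k)\<close> sees both orientations of the edges between
      \<open>N\<close> and \<open>W\<close>, hence the factor 2.\<close>
    then have c2: "(\<Sum>(u, v)\<in>U. \<mu> u v) + 2 * (\<Sum>u\<in>N. c u * x (u, k)) = 0"
      using z[of k k] by (simp add: sT sT' sU sB)
    \<comment> \<open>Without an inner edge, coordinate \<open>(k, k)\<close> completes the relation
      to \<open>Suc k\<close> coordinates. With one, that equation contains the coefficient of the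
      inner edge and is spent on it, which explains the smaller bound
      \<open>card N \<le> k\<close>.\<close>
    have c0: "c u = 0" if "u \<in> N" for u
      using inner
    proof
      assume *: "A \<inter> W \<times> W = {} \<and> card N \<le> Suc k"
      then have "(\<Sum>u\<in>N. c u * x (u, a)) = 0" if "a < Suc k" for a
        using c1[of a] c2 that by (cases "a = k") (auto simp: U_def)
      then show ?thesis
        using generic_vectors_independent[OF x NV finN, of "Suc k" c u] * that by auto
    next
      assume "(\<exists>s s'. s \<noteq> s' \<and> A \<inter> W \<times> W = {(s, s'), (s', s)}) \<and> card N \<le> k"
      then show ?thesis
        using generic_vectors_independent[OF x NV finN, of k c u] c1 that by auto
    qed
    then have U0: "(\<Sum>(u, v)\<in>U. \<mu> u v) = 0" using c2 by simp
    have T0: "\<mu> u v = 0" if "(u, v) \<in> T" for u v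
      using that c0 unfolding T by (auto simp: c_def)
    have U: "\<mu> u v = 0" if uv: "(u, v) \<in> U" for u v
    proof -
      obtain s s' where s: "s \<noteq> s'" "U = {(s, s'), (s', s)}"
        using inner uv by (auto simp: U_def)
      then have "\<mu> s s' + \<mu> s' s = 0" using U0 by simp
      moreover have "\<mu> s s' = \<mu> s' s" using s by (intro sy) (auto simp: U_def)
      ultimately show ?thesis using uv s by auto
    qed
    have "(p, q) \<in> U \<or> (p, q) \<in> T \<or> (q, p) \<in> T \<or> (p, q) \<in> B"
      using pq symD[OF sym pq] by (auto simp: U_def T_def B_def)
    then show "\<mu> p q = 0" using U T0 B0 sy[OF pq] by auto
  qed
  then show ?thesis by blast
qed

section \<open>Products along paths and cycles\<close>

lemma card_symmetric:
  assumes "finite A" "sym A" "irrefl A"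
  shows "card A = 2 * card ((\<lambda>(u, v). {u, v}) ` A)"
  using assms
proof (induction A rule: finite_psubset_induct)
  case (psubset A)
  show ?case
  proof (cases "A = {}")
    case False
    then obtain u v where uv: "(u, v) \<in> A" by auto
    then have vu: "(v, u) \<in> A" "u \<noteq> v" using psubset.prems by (auto dest: symD simp: irrefl_def)
    let ?B = "A - {(u, v), (v, u)}"
    have "?B \<subset> A" using uv by auto
    moreover have "sym ?B" using psubset.prems by (auto simp: sym_def)
    moreover have "irrefl ?B" using psubset.prems by (auto simp: irrefl_def)
    ultimately have "card ?B = 2 * card ((\<lambda>(u, v). {u, v}) ` ?B)" by (rule psubset.IH)
    moreover have "card ((\<lambda>(u, v). {u, v}) ` A) = Suc (card ((\<lambda>(u, v). {u, v}) ` ?B))"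
    proof -
      have "(\<lambda>(u, v). {u, v}) ` A = insert {u, v} ((\<lambda>(u, v). {u, v}) ` ?B)"
        using uv vu by auto
      moreover have "{u, v} \<notin> (\<lambda>(u, v). {u, v}) ` ?B"
        by (auto simp: doubleton_eq_iff)
      ultimately show ?thesis using psubset.hyps by simp
    qed
    moreover have "card ?B + 2 = card A"
    proof -
      have "card {(u, v), (v, u)} = 2" using vu by auto
      moreover have "card {(u, v), (v, u)} \<le> card A" using uv vu psubset.hyps by (intro card_mono) auto
      ultimately show ?thesis using uv vu psubset.hyps by (subst card_Diff_subset) auto
    qed
    ultimately show ?thesis by simp
  qed simp
qed

text \<open>For irreflexive \<open>A\<close> the three vertices are distinct automatically.\<close>

definition triangle_free :: "('v \<times> 'v) set \<Rightarrow> bool" where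
  "triangle_free A \<longleftrightarrow> (\<forall>a b c. (a, b) \<in> A \<longrightarrow> (b, c) \<in> A \<longrightarrow> (c, a) \<notin> A)"

locale paths_and_cycles =
  fixes A :: "('v \<times> 'v) set"
  assumes fin: "finite A" and sym: "sym A" and irrefl: "irrefl A"
    and deg_le: "card (A `` {v}) \<le> 2"
begin

definition deg :: "'v \<Rightarrow> nat" where "deg v = card (A `` {v})"

definition active :: "'v set" where "active = {v. A `` {v} \<noteq> {}}"

definition near :: "'v \<Rightarrow> 'v set" where
  "near v = insert v (A `` {v} \<union> A `` (A `` {v}))"

text \<open>In the applications \<open>S\<close> is empty or the one edge allowed inside
  \<open>W\<close>. Apart from the ends of that edge, distinct vertices of \<open>W\<close> are at
  distance at least 3.\<close>

definition separated :: "'v set \<Rightarrow> 'v set \<Rightarrow> bool" where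
  "separated S W \<longleftrightarrow> (\<forall>w\<in>W. \<forall>w'\<in>W. w \<noteq> w' \<longrightarrow>
     A `` {w} \<inter> A `` {w'} = {} \<and> ((w, w') \<in> A \<longrightarrow> {w, w'} = S))"

section \<open>Neighbourhoods, degree sums and greedy separated sets\<close>

lemma arc_sym: "(u, v) \<in> A \<longleftrightarrow> (v, u) \<in> A"
  using sym by (auto dest: symD)

lemma arc_irrefl: "(u, u) \<notin> A"
  using irrefl by (simp add: irrefl_def)

lemma finite_nbrs: "finite (A `` X)"
  by (rule finite_subset[OF _ finite_imageI[OF fin, of snd]]) force

lemma active_eq: "active = fst ` A"
  by (force simp: active_def)

lemma finite_active: "finite active"
  unfolding active_eq using fin by simp

lemma deg_pos: "v \<in> active \<Longrightarrow> deg v \<ge> 1"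
  unfolding active_def deg_def using finite_nbrs[of "{v}"] by (simp add: Suc_le_eq card_gt_0_iff)

lemma finite_near: "finite (near v)"
  unfolding near_def using finite_nbrs by simp

text \<open>Count \<open>v\<close>, its \<open>deg v\<close> neighbours and at most one further
  vertex behind each of them; the leading 1 is at most \<open>deg v\<close> because \<open>v\<close>
  is active.\<close>

lemma card_near: 
  assumes "v \<in> active"
  shows "card (near v) \<le> 3 * deg v"
proof -
  have "near v \<subseteq> {v} \<union> (A `` {v} \<union> (\<Union>w\<in>A `` {v}. A `` {w} - {v}))"
    unfolding near_def by auto
  then have "card (near v) \<le> card ({v} \<union> (A `` {v} \<union> (\<Union>w\<in>A `` {v}. A `` {w} - {v})))"
    using finite_nbrs by (intro card_mono) auto
  also have "\<dots> \<le> card {v} + (deg v + card (\<Union>w\<in>A `` {v}. A `` {w} - {v}))"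
    unfolding deg_def by (intro order_trans[OF card_Un_le] add_mono order_refl card_Un_le)
  also have "card (\<Union>w\<in>A `` {v}. A `` {w} - {v}) \<le> (\<Sum>w\<in>A `` {v}. card (A `` {w} - {v}))"
    by (rule card_UN_le[OF finite_nbrs])
  also have "\<dots> \<le> (\<Sum>w\<in>A `` {v}. 1)"
  proof (rule sum_mono)
    fix w assume "w \<in> A `` {v}"
    then have "v \<in> A `` {w}" using arc_sym by auto
    then show "card (A `` {w} - {v}) \<le> 1"
      using deg_le[of w] finite_nbrs[of "{w}"] by (simp add: card_Diff_singleton)
  qed
  also have "\<dots> = deg v" by (simp add: deg_def)
  finally show ?thesis using deg_pos[OF assms] by simp
qed

lemma card_arcs: "card A = (\<Sum>v\<in>active. deg v)"
proof -
  have "A = Sigma active (\<lambda>v. A `` {v})" by (auto simp: active_def)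
  also have "card \<dots> = (\<Sum>v\<in>active. deg v)"
    unfolding deg_def using finite_active finite_nbrs by (intro card_SigmaI) auto
  finally show ?thesis .
qed

lemma card_arcs_le: "card A \<le> 2 * card active"
  using sum_mono[of active deg "\<lambda>_. 2"] deg_le by (simp add: card_arcs deg_def mult.commute)

lemma card_arcs_less:
  assumes "v \<in> active" "deg v \<noteq> 2"
  shows "card A < 2 * card active"
proof -
  have "(\<Sum>v\<in>active. deg v) < (\<Sum>v\<in>active. 2)"
    using assms deg_le by (intro sum_strict_mono_ex1 finite_active) (auto simp: deg_def intro!: bexI[of _ v] le_neq_implies_less)
  then show ?thesis by (simp add: card_arcs)
qed

lemma ex_far_vertex:
  assumes "W \<subseteq> active" "3 * sum deg W < card active"
  shows "\<exists>v\<in>active. v \<notin> (\<Union>w\<in>W. near w)"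
proof (rule ccontr)
  have finW: "finite W" using assms(1) finite_active finite_subset by blast
  assume "\<not> ?thesis"
  then have "card active \<le> card (\<Union>w\<in>W. near w)"
    using finW finite_near by (intro card_mono) auto
  also have "\<dots> \<le> (\<Sum>w\<in>W. card (near w))" by (rule card_UN_le[OF finW])
  also have "\<dots> \<le> (\<Sum>w\<in>W. 3 * deg w)" using assms(1) card_near by (intro sum_mono) auto
  also have "\<dots> = 3 * sum deg W" by (simp add: sum_distrib_left)
  finally show False using assms(2) by simp
qed

lemma separated_insert:
  assumes "separated S W" "v \<notin> (\<Union>w\<in>W. near w)"
  shows "separated S (insert v W)"
proof -
  have "v \<noteq> w \<and> A `` {v} \<inter> A `` {w} = {} \<and> (v, w) \<notin> A \<and> (w, v) \<notin> A" if "w \<in> W" for w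
    using assms(2) that arc_sym by (fastforce simp: near_def)
  then show ?thesis
    using assms(1) unfolding separated_def by (auto simp: Int_commute)
qed

lemma notin_W_if_far: "v \<notin> (\<Union>w\<in>W. near w) \<Longrightarrow> v \<notin> W"
  by (auto simp: near_def)

lemma maximal_separated:
  assumes "P W0" and le: "\<And>W. P W \<Longrightarrow> sum deg W \<le> M"
  obtains W where "P W" "\<And>W'. P W' \<Longrightarrow> sum deg W' \<le> sum deg W"
  using ex_has_greatest_nat[of P W0 "sum deg" "Suc M"] assms by (metis le_imp_less_Suc)

lemma sum_deg_insert:
  assumes "W \<subseteq> active" "v \<notin> W"
  shows "sum deg (insert v W) = sum deg W + deg v"
  using assms finite_subset[OF assms(1) finite_active] by simp

text \<open>Hitting \<open>M\<close> exactly could fail when the deficit is 1 and only vertices of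
  degree 2 are left. Hence two maximal choices: \<open>W1\<close> among the sets with even deficit,
  then \<open>W\<close> above \<open>W1\<close> without parity. If \<open>W\<close> falls short, a
  far vertex of degree 1 extends \<open>W\<close> and one of degree 2 extends \<open>W1\<close>;
  either contradicts maximality.\<close>

lemma separated_fill:
  assumes "separated S W0" "W0 \<subseteq> active" "sum deg W0 \<le> M" "even (M - sum deg W0)"
    and count: "\<And>W. \<lbrakk>W0 \<subseteq> W; W \<subseteq> active; sum deg W < M\<rbrakk> \<Longrightarrow> 3 * sum deg W < card active"
  shows "\<exists>W. W0 \<subseteq> W \<and> W \<subseteq> active \<and> separated S W \<and> sum deg W = M"
proof -
  define P where "P W \<longleftrightarrow> W0 \<subseteq> W \<and> W \<subseteq> active \<and> separated S W \<and> sum deg W \<le> M \<and> even (M - sum deg W)" for W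
  have "P W0" using assms by (auto simp: P_def)
  then obtain W1 where W1: "P W1" and max1: "\<And>W'. P W' \<Longrightarrow> sum deg W' \<le> sum deg W1"
    by (rule maximal_separated[of _ _ M]) (auto simp: P_def)
  define Q where "Q W \<longleftrightarrow> W1 \<subseteq> W \<and> W \<subseteq> active \<and> separated S W \<and> sum deg W \<le> M" for W
  have "Q W1" using W1 by (auto simp: P_def Q_def)
  then obtain W where W: "Q W" and max2: "\<And>W'. Q W' \<Longrightarrow> sum deg W' \<le> sum deg W"
    by (rule maximal_separated[of _ _ M]) (auto simp: Q_def)
  have step: "s + 2 \<le> m \<and> even (m - (s + 2))" if "s < m" "even (m - s)" for s m :: nat
    using that by presburger
  have "sum deg W = M"
  proof (rule ccontr)
    assume "sum deg W \<noteq> M"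
    then have lt: "sum deg W < M" using W by (auto simp: Q_def)
    then obtain v where v: "v \<in> active" "v \<notin> (\<Union>w\<in>W. near w)"
      using ex_far_vertex[of W] count[of W] W W1 by (auto simp: P_def Q_def)
    then have v1: "v \<notin> (\<Union>w\<in>W1. near w)" using W by (auto simp: Q_def)
    consider "deg v = 1" | "deg v = 2"
      using deg_pos[OF v(1)] deg_le[of v] by (fastforce simp: deg_def)
    then show False
    proof cases
      case 1
      have "sum deg (insert v W) = sum deg W + 1"
        using sum_deg_insert[of W v] notin_W_if_far[OF v(2)] W 1 by (simp add: Q_def)
      then show ?thesis
        using max2[of "insert v W"] separated_insert[OF _ v(2), of S] W v(1) lt by (auto simp: Q_def)
    next
      case 2
      have eq: "sum deg (insert v W1) = sum deg W1 + 2"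
        using sum_deg_insert[of W1 v] notin_W_if_far[OF v1] W1 2 by (simp add: P_def)
      have "sum deg W1 < M" using max2[OF \<open>Q W1\<close>] lt by simp
      then have "sum deg W1 + 2 \<le> M" "even (M - (sum deg W1 + 2))"
        using W1 step[of "sum deg W1" M] unfolding P_def by simp_all
      then have "P (insert v W1)"
        using separated_insert[OF _ v1, of S] W1 v(1) eq by (auto simp: P_def)
      then show ?thesis using max1 eq by fastforce
    qed
  qed
  then show ?thesis using W W1 by (auto simp: P_def Q_def)
qed

text \<open>With a final deficit of 1 tolerated, parity is no issue: as long as 2 is missing, any
  far vertex fits.\<close>

lemma separated_fill_almost:
  assumes "3 * (M - 2) < card active"
  shows "\<exists>W. W \<subseteq> active \<and> separated {} W \<and> sum deg W \<le> M \<and> M \<le> sum deg W + 1"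
proof -
  define P where "P W \<longleftrightarrow> W \<subseteq> active \<and> separated {} W \<and> sum deg W \<le> M" for W
  have "P {}" by (auto simp: P_def separated_def)
  then obtain W where W: "P W" and max: "\<And>W'. P W' \<Longrightarrow> sum deg W' \<le> sum deg W"
    by (rule maximal_separated[of _ _ M]) (auto simp: P_def)
  have "M \<le> sum deg W + 1"
  proof (rule ccontr)
    assume "\<not> ?thesis"
    then have le: "sum deg W \<le> M - 2" "sum deg W + 2 \<le> M" by auto
    then obtain v where v: "v \<in> active" "v \<notin> (\<Union>w\<in>W. near w)"
      using ex_far_vertex[of W] W assms by (auto simp: P_def)
    have eq: "sum deg (insert v W) = sum deg W + deg v"
      using sum_deg_insert[of W v] notin_W_if_far[OF v(2)] W by (simp add: P_def)
    moreover have "P (insert v W)"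
      using separated_insert[OF _ v(2), of "{}"] W v(1) le eq deg_le[of v] by (auto simp: P_def deg_def)
    ultimately show False using max[of "insert v W"] deg_pos[OF v(1)] by simp
  qed
  then show ?thesis using W by (auto simp: P_def)
qed

lemma card_split_arcs:
  assumes "N = {u. u \<notin> W \<and> (\<exists>w\<in>W. (u, w) \<in> A)}"
    and uniq: "\<And>u w w'. \<lbrakk>u \<notin> W; w \<in> W; w' \<in> W; (u, w) \<in> A; (u, w') \<in> A\<rbrakk> \<Longrightarrow> w = w'"
  shows "card A = card {(u, v) \<in> A. u \<notin> W \<and> v \<notin> W} + 2 * card N + card (A \<inter> W \<times> W)"
proof -
  define B where "B = {(u, v) \<in> A. u \<notin> W \<and> v \<notin> W}"
  define T where "T = {(u, v) \<in> A. u \<notin> W \<and> v \<in> W}"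
  define T' where "T' = {(u, v) \<in> A. u \<in> W \<and> v \<notin> W}"
  have fins: "finite B" "finite T" "finite T'" "finite (A \<inter> W \<times> W)"
    using fin by (auto simp: B_def T_def T'_def intro: finite_subset[OF _ fin])
  have "card T = card (fst ` T)"
    by (rule card_image[symmetric]) (auto simp: T_def inj_on_def dest: uniq)
  also have "fst ` T = N" unfolding assms(1) by (force simp: T_def)
  finally have T: "card T = card N" .
  have "T' = prod.swap ` T" using arc_sym by (auto simp: T_def T'_def image_iff)
  then have T': "card T' = card N" using T by (simp add: card_image)
  have "A = B \<union> (T \<union> (T' \<union> (A \<inter> W \<times> W)))" by (auto simp: B_def T_def T'_def)
  also have "card \<dots> = card B + (card T + (card T' + card (A \<inter> W \<times> W)))"
  proof -
    have "B \<inter> (T \<union> (T' \<union> (A \<inter> W \<times> W))) = {}" "T \<inter> (T' \<union> (A \<inter> W \<times> W)) = {}" "T' \<inter> (A \<inter> W \<times> W) = {}"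
      by (auto simp: B_def T_def T'_def)
    then show ?thesis using fins by (simp add: card_Un_disjoint)
  qed
  finally show ?thesis using T T' by (simp add: B_def)
qed

text \<open>\<open>e\<close> counts inner edges. The degree sum counts an inner edge twice, so
  \<open>W\<close> meets \<open>sum deg W - e\<close> edges; the two bounds in \<open>M\<close> say
  that these are at most \<open>Suc k\<close> and that at most \<open>k * Suc k\<close> arcs avoid
  \<open>W\<close>.\<close>

lemma separated_cone_set:
  assumes W: "W \<subseteq> active" "separated S W" and S: "S = {} \<and> e = 0 \<or> (\<exists>s s'. S = {s, s'} \<and> S \<subseteq> W \<and> (s, s') \<in> A) \<and> e = 1"
    and M: "sum deg W \<le> Suc k + e" "card A + 2 * e \<le> k * Suc k + 2 * sum deg W"
  defines "N \<equiv> {u. u \<notin> W \<and> (\<exists>w\<in>W. (u, w) \<in> A)}"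
  shows "(\<forall>u w w'. u \<notin> W \<longrightarrow> w \<in> W \<longrightarrow> w' \<in> W \<longrightarrow> (u, w) \<in> A \<longrightarrow> (u, w') \<in> A \<longrightarrow> w = w')
    \<and> (A \<inter> W \<times> W = {} \<and> card N \<le> Suc k \<or>
      (\<exists>s s'. s \<noteq> s' \<and> A \<inter> W \<times> W = {(s, s'), (s', s)}) \<and> card N \<le> k)
    \<and> card {(u, v) \<in> A. u \<notin> W \<and> v \<notin> W} \<le> k * Suc k"
proof -
  have finW: "finite W" using W(1) finite_active finite_subset by blast
  have uniq: "w = w'" if "w \<in> W" "w' \<in> W" "(u, w) \<in> A" "(u, w') \<in> A" for u w w'
    using W(2) that arc_sym unfolding separated_def by blast
  have split: "card A = card {(u, v) \<in> A. u \<notin> W \<and> v \<notin> W} + 2 * card N + card (A \<inter> W \<times> W)"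
    by (rule card_split_arcs) (auto simp: N_def intro: uniq)
  have UN: "card (\<Union>w\<in>W. A `` {w}) = sum deg W"
    unfolding deg_def using finW finite_nbrs W(2)
    by (intro card_UN_disjoint) (auto simp: separated_def)
  have N: "N = (\<Union>w\<in>W. A `` {w}) - W" using arc_sym by (auto simp: N_def)
  from S show ?thesis
  proof
    assume S: "S = {} \<and> e = 0"
    then have "(a, b) \<notin> A" if "a \<in> W" "b \<in> W" for a b
      using W(2) arc_irrefl that unfolding separated_def by (metis insert_not_empty)
    then have inner: "A \<inter> W \<times> W = {}" by auto
    then have "N = (\<Union>w\<in>W. A `` {w})" unfolding N by auto
    then show ?thesis using UN inner split M S uniq by auto
  next
    assume "(\<exists>s s'. S = {s, s'} \<and> S \<subseteq> W \<and> (s, s') \<in> A) \<and> e = 1"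
    then obtain s s' where s: "S = {s, s'}" "s \<in> W" "s' \<in> W" "(s, s') \<in> A" "e = 1" by auto
    have ne: "s \<noteq> s'" using s arc_irrefl by auto
    have inner_iff: "(u, v) \<in> A \<inter> W \<times> W \<longleftrightarrow> (u, v) \<in> {(s, s'), (s', s)}" for u v
    proof
      assume "(u, v) \<in> A \<inter> W \<times> W"
      then have "{u, v} = {s, s'}"
        using W(2) arc_irrefl s(1) unfolding separated_def by (metis IntE mem_Sigma_iff)
      then show "(u, v) \<in> {(s, s'), (s', s)}" by (auto simp: doubleton_eq_iff)
    qed (use s arc_sym in auto)
    then have inner: "A \<inter> W \<times> W = {(s, s'), (s', s)}" by (intro set_eqI) (metis prod.exhaust)
    have "u \<in> {s, s'}" if "u \<in> W" "w \<in> W" "(w, u) \<in> A" for u w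
      using inner_iff[of w u] that by blast
    then have "N = (\<Union>w\<in>W. A `` {w}) - {s, s'}"
      unfolding N using s(2,3) by blast
    moreover have "{s, s'} \<subseteq> (\<Union>w\<in>W. A `` {w})" using s arc_sym by auto
    ultimately have "card N = sum deg W - 2"
      using UN ne by (simp add: card_Diff_subset)
    moreover have "card (A \<inter> W \<times> W) = 2" unfolding inner using ne by simp
    ultimately have "card N \<le> k" "card {(u, v) \<in> A. u \<notin> W \<and> v \<notin> W} \<le> k * Suc k"
      using split M s(5) by auto
    then show ?thesis using inner ne uniq by blast
  qed
qed

text \<open>If the upper bound is not attained, meeting \<open>k\<close> edges is enough and the
  degree sum may be off by one. If it is attained, exactly \<open>Suc k\<close> edges have to be
  met, and parity decides the start of the greedy choice: a vertex of degree 1 corrects it if there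
  is one, otherwise an inner edge does.\<close>

lemma ex_cone_set:
  assumes tri: "triangle_free A"
    and lower: "k * Suc k < card A" and upper: "card A \<le> Suc k * Suc (Suc k)"
  shows "\<exists>W. (\<forall>u w w'. u \<notin> W \<longrightarrow> w \<in> W \<longrightarrow> w' \<in> W \<longrightarrow> (u, w) \<in> A \<longrightarrow> (u, w') \<in> A \<longrightarrow> w = w')
    \<and> (A \<inter> W \<times> W = {} \<and> card {u. u \<notin> W \<and> (\<exists>w\<in>W. (u, w) \<in> A)} \<le> Suc k \<or>
      (\<exists>s s'. s \<noteq> s' \<and> A \<inter> W \<times> W = {(s, s'), (s', s)}) \<and> card {u. u \<notin> W \<and> (\<exists>w\<in>W. (u, w) \<in> A)} \<le> k)
    \<and> card {(u, v) \<in> A. u \<notin> W \<and> v \<notin> W} \<le> k * Suc k"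
proof (cases "card A \<le> k * Suc k + 2 * k")
  case True
  have "2 * (3 * (Suc k - 2)) < card A"
  proof -
    have "6 * (int k - 1) \<le> int k * (int k + 1)"
    proof -
      \<comment> \<open>The claim is \<open>(k - 2) (k - 3) \<ge> 0\<close>. The square equals four
        times this product plus 1, and integrality absorbs the 1.\<close>
      have "0 \<le> (2 * int k - 5)\<^sup>2" by simp
      then show ?thesis by (simp add: power2_eq_square algebra_simps)
    qed
    then have "6 * (int k - 1) < int (card A)" using lower by (simp add: algebra_simps flip: of_nat_mult of_nat_add)
    then show ?thesis using lower by (cases k) auto
  qed
  then obtain W where W: "W \<subseteq> active" "separated {} W" "sum deg W \<le> Suc k" "Suc k \<le> sum deg W + 1"
    using separated_fill_almost[of "Suc k"] card_arcs_le by auto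
  show ?thesis
    by (rule exI, rule separated_cone_set[OF W(1,2), where e = 0]) (use W True in auto)
next
  case False
  have cA: "card A = k * k + 3 * k + 2"
  proof -
    have "even (card A)" using card_symmetric[OF fin sym irrefl] by simp
    moreover have "even (k * k + 3 * k + 2)" by auto
    moreover have "k * k + 3 * k + 1 \<le> card A" "card A \<le> k * k + 3 * k + 2" using False upper by auto
    ultimately show ?thesis by presburger
  qed
  \<comment> \<open>Equivalent to \<open>(k - 1) (k - 2) \<ge> 0\<close>. The 6 is the 3 of
    \<open>ex_far_vertex\<close> times the 2 of \<open>card_arcs_le\<close>.\<close>
  have ineq: "6 * k \<le> k * k + 3 * k + 2" 
  proof -
    have "0 \<le> (int k - 1) * (int k - 2)"
      by (cases "k \<le> 1") (auto simp: mult_nonpos_nonpos)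
    then have "6 * int k \<le> int k * int k + 3 * int k + 2" by (simp add: algebra_simps)
    then show ?thesis by (simp flip: of_nat_mult of_nat_add)
  qed
  have *: ?thesis if "W \<subseteq> active" "separated S W" "sum deg W = Suc k + e"
    "S = {} \<and> e = 0 \<or> (\<exists>s s'. S = {s, s'} \<and> S \<subseteq> W \<and> (s, s') \<in> A) \<and> e = 1" for S W e
    by (rule exI, rule separated_cone_set[OF that(1,2,4)]) (use that(3) cA in auto)
  show ?thesis
  proof (cases "\<exists>v\<in>active. deg v \<noteq> 2")
    case True
    then obtain l where l: "l \<in> active" "deg l \<noteq> 2" by blast
    then have l1: "deg l = 1" using deg_pos[of l] deg_le[of l] by (auto simp: deg_def)
    have count: "3 * sum deg W < card active" if "sum deg W < Suc k" for W
      using card_arcs_less[OF l] that cA ineq by linarith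
    \<comment> \<open>One vertex of degree 1 adjusts the parity of the remaining deficit.\<close>
    define W0 where "W0 = (if even (Suc k) then {} else {l})"
    have "\<exists>W. W0 \<subseteq> W \<and> W \<subseteq> active \<and> separated {} W \<and> sum deg W = Suc k"
    proof (rule separated_fill)
      show "sum deg W0 \<le> Suc k" "even (Suc k - sum deg W0)" using l1 by (auto simp: W0_def)
    qed (use l in \<open>auto simp: W0_def separated_def intro: count\<close>)
    then obtain W where "W \<subseteq> active" "separated {} W" "sum deg W = Suc k" by blast
    then show ?thesis by (intro *[of W "{}" 0]) simp_all
  next
    case reg: False
    have sumdeg: "sum deg W = 2 * card W" if "W \<subseteq> active" for W
      using that reg by (simp add: subset_iff)
    have parity: "s + 1 \<le> k" if "even s" "even (Suc k)" "s < Suc k" for s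
      using that by presburger
    have parity': "s \<le> k" if "even s" "odd (Suc k)" "s < Suc k + 1" for s
      using that by presburger
    have cact: "2 * card active = k * k + 3 * k + 2"
      using card_arcs sumdeg[of active] cA by simp
    show ?thesis
    proof (cases "even (Suc k)")
      case True
      have "\<exists>W. {} \<subseteq> W \<and> W \<subseteq> active \<and> separated {} W \<and> sum deg W = Suc k"
      proof (rule separated_fill)
        fix W assume "W \<subseteq> active" "sum deg W < Suc k"
        then have "even (sum deg W)" using sumdeg by simp
        then have "sum deg W + 1 \<le> k" using True \<open>sum deg W < Suc k\<close> parity[of "sum deg W"] by simp
        then show "3 * sum deg W < card active" using cact ineq by simp
      qed (use True in \<open>auto simp: separated_def\<close>)
      then obtain W where "W \<subseteq> active" "separated {} W" "sum deg W = Suc k" by blast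
      then show ?thesis by (intro *[of W "{}" 0]) simp_all
    next
      case odd: False
      have "A \<noteq> {}" using cA by (intro notI) simp
      then obtain s s' where ss': "(s, s') \<in> A" by (metis equals0I surj_pair)
      then have act: "s \<in> active" "s' \<in> active" "s \<noteq> s'"
        using arc_sym arc_irrefl by (auto simp: active_def)
      have "card {s, s'} \<le> card active" using act by (intro card_mono finite_active) auto
      then have "card active \<ge> 2" using act by simp
      then have "k \<noteq> 0" using cact by (intro notI) simp
      then have k2: "k \<ge> 2" using odd by (cases "k = 1") auto
      \<comment> \<open>The edge between \<open>s\<close> and \<open>s'\<close> is counted at both
        ends, so meeting \<open>Suc k\<close> edges means degree sum
        \<open>Suc k + 1\<close>.\<close>
      have "\<exists>W. {s, s'} \<subseteq> W \<and> W \<subseteq> active \<and> separated {s, s'} W \<and> sum deg W = Suc k + 1"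
      proof (rule separated_fill)
        have "sum deg {s, s'} = 4" using act sumdeg[of "{s, s'}"] by simp
        then show "sum deg {s, s'} \<le> Suc k + 1" "even (Suc k + 1 - sum deg {s, s'})"
          using k2 odd by auto
        \<comment> \<open>A common neighbour of \<open>s\<close> and \<open>s'\<close> would close a
          triangle.\<close>
        show "separated {s, s'} {s, s'}"
          using tri arc_sym ss' unfolding separated_def triangle_free_def by (auto simp: insert_commute)
        fix W assume W: "{s, s'} \<subseteq> W" "W \<subseteq> active" "sum deg W < Suc k + 1"
        have "even (sum deg W)" using sumdeg W(2) by simp
        then have lek: "sum deg W \<le> k" using W(3) odd parity' by simp
        have "sum deg {s, s'} \<le> sum deg W"
          using W finite_subset[OF W(2) finite_active] by (intro sum_mono2) auto
        \<comment> \<open>For \<open>k = 2\<close> the strict count below fails, but then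
          \<open>s\<close> and \<open>s'\<close> already fill the degree sum; an unfilled
          \<open>W\<close> forces \<open>k\<close> to be larger.\<close>
        then have "4 \<le> k" using \<open>sum deg {s, s'} = 4\<close> lek by simp
        then have "4 * k \<le> k * k" by simp
        then have "6 * k < 2 * card active" unfolding cact using \<open>4 \<le> k\<close> by linarith
        then show "3 * sum deg W < card active" using lek by simp
      qed (use act in auto)
      then obtain W where W: "{s, s'} \<subseteq> W" "W \<subseteq> active" "separated {s, s'} W" "sum deg W = Suc k + 1"
        by blast
      have "(\<exists>t t'. {s, s'} = {t, t'} \<and> {s, s'} \<subseteq> W \<and> (t, t') \<in> A) \<and> (1 :: nat) = 1"
        using W(1) ss' by blast
      then show ?thesis by (intro *[OF W(2-4)] disjI2)
    qed
  qed
qed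

end

lemma paths_and_cycles_subset:
  assumes "paths_and_cycles A" "B \<subseteq> A" "sym B"
  shows "paths_and_cycles B"
proof -
  interpret paths_and_cycles A by fact
  show ?thesis
  proof
    show "finite B" by (rule finite_subset[OF assms(2) fin])
    show "irrefl B" using irrefl assms(2) by (auto simp: irrefl_def)
    have "card (B `` {v}) \<le> card (A `` {v})" for v
      by (intro card_mono finite_nbrs Image_mono assms(2) subset_refl)
    then show "card (B `` {v}) \<le> 2" for v using deg_le order_trans by blast
  qed fact
qed

text \<open>Deleting arcs preserves both structural hypotheses, so the arcs avoiding the coned set
  satisfy the induction hypothesis. If there are few arcs already, the last coordinate is
  ignored.\<close>

theorem ex_indep_products:
  assumes "paths_and_cycles A" "triangle_free A"
    and "card A \<le> k * Suc k"
  shows "\<exists>y. indep_products A {..<k} y"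
  using assms
proof (induction k arbitrary: A)
  case 0
  then have "A = {}" using paths_and_cycles.fin[OF 0(1)] 0(3) card_0_eq by (metis le_zero_eq mult_zero_left)
  then show ?case by (simp add: indep_products_def)
next
  case (Suc k)
  interpret paths_and_cycles A by fact
  show ?case
  proof (cases "card A \<le> k * Suc k")
    case True
    obtain y where "indep_products A {..<k} y"
      using Suc.IH[OF Suc.prems(1,2) True] by (rule exE)
    then have "indep_products A {..<Suc k} y" by (rule indep_products_mono) auto
    then show ?thesis by (intro exI)
  next
    case False
    then have lt: "k * Suc k < card A" by simp
    obtain W where W: "\<forall>u w w'. u \<notin> W \<longrightarrow> w \<in> W \<longrightarrow> w' \<in> W \<longrightarrow> (u, w) \<in> A \<longrightarrow> (u, w') \<in> A \<longrightarrow> w = w'"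
      "A \<inter> W \<times> W = {} \<and> card {u. u \<notin> W \<and> (\<exists>w\<in>W. (u, w) \<in> A)} \<le> Suc k \<or>
      (\<exists>s s'. s \<noteq> s' \<and> A \<inter> W \<times> W = {(s, s'), (s', s)}) \<and> card {u. u \<notin> W \<and> (\<exists>w\<in>W. (u, w) \<in> A)} \<le> k"
      "card {(u, v) \<in> A. u \<notin> W \<and> v \<notin> W} \<le> k * Suc k"
      using ex_cone_set[OF Suc.prems(2) lt Suc.prems(3)] by (elim exE conjE)
    have uniq: "w = w'" if "u \<notin> W" "w \<in> W" "w' \<in> W" "(u, w) \<in> A" "(u, w') \<in> A" for u w w'
      using W(1) that by blast
    let ?B = "{(u, v) \<in> A. u \<notin> W \<and> v \<notin> W}"
    have "paths_and_cycles ?B"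
      by (rule paths_and_cycles_subset[OF Suc.prems(1)]) (use arc_sym in \<open>auto simp: sym_def\<close>)
    then have "\<exists>y. indep_products ?B {..<k} y"
      using Suc.prems(2) W(3) by (intro Suc.IH) (auto simp: triangle_free_def)
    with W(2) show ?thesis
      using indep_products_cone[OF fin sym, of W "{u. u \<notin> W \<and> (\<exists>w\<in>W. (u, w) \<in> A)}" k] uniq by blast
  qed
qed

section \<open>Gale duality\<close>

lemma sum_swap_products:
  fixes y :: "'v \<Rightarrow> 'i \<Rightarrow> real"
  shows "(\<Sum>(u, v)\<in>A. \<mu> u v * ((\<Sum>a\<in>I. y u a * s a) * (\<Sum>b\<in>I. y v b * t b)))
    = (\<Sum>a\<in>I. \<Sum>b\<in>I. (\<Sum>(u, v)\<in>A. \<mu> u v * (y u a * y v b)) * (s a * t b))"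
proof -
  have "(\<Sum>(u, v)\<in>A. \<mu> u v * ((\<Sum>a\<in>I. y u a * s a) * (\<Sum>b\<in>I. y v b * t b)))
      = (\<Sum>e\<in>A. \<Sum>a\<in>I. \<Sum>b\<in>I. \<mu> (fst e) (snd e) * (y (fst e) a * y (snd e) b) * (s a * t b))"
    unfolding case_prod_beta sum_product
    by (simp add: sum_distrib_left mult.assoc) (simp add: mult.left_commute)
  also have "\<dots> = (\<Sum>a\<in>I. \<Sum>e\<in>A. \<Sum>b\<in>I. \<mu> (fst e) (snd e) * (y (fst e) a * y (snd e) b) * (s a * t b))"
    by (rule sum.swap)
  also have "\<dots> = (\<Sum>a\<in>I. \<Sum>b\<in>I. \<Sum>e\<in>A. \<mu> (fst e) (snd e) * (y (fst e) a * y (snd e) b) * (s a * t b))"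
    by (intro sum.cong refl, rule sum.swap)
  finally show ?thesis by (simp add: sum_distrib_right case_prod_beta)
qed

text \<open>The linear map \<open>s\<close> carries a relation between products of the
  \<open>y v\<close> to the same relation between products of the \<open>z v\<close>, so
  independence passes back to \<open>y\<close>.\<close>

lemma indep_products_coordinates:
  assumes "indep_products A J z" and "\<And>v j. v \<in> fst ` A \<Longrightarrow> j \<in> J \<Longrightarrow> z v j = (\<Sum>a\<in>I. y v a * s a j)"
    and "sym A"
  shows "indep_products A I y"
proof (rule indep_productsI)
  fix \<mu> u v
  assume sy: "\<And>u v. (u, v) \<in> A \<Longrightarrow> \<mu> u v = \<mu> v u" and uv: "(u, v) \<in> A"
    and 0: "\<And>a b. a \<in> I \<Longrightarrow> b \<in> I \<Longrightarrow> (\<Sum>(u, v)\<in>A. \<mu> u v * (y u a * y v b)) = 0"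
  show "\<mu> u v = 0"
  proof (rule indep_productsD[OF assms(1) sy _ uv])
    fix i j assume ij: "i \<in> J" "j \<in> J"
    have "u \<in> fst ` A \<and> v \<in> fst ` A" if "(u, v) \<in> A" for u v
      using that symD[OF assms(3) that] by force
    then have "(\<Sum>(u, v)\<in>A. \<mu> u v * (z u i * z v j))
        = (\<Sum>(u, v)\<in>A. \<mu> u v * ((\<Sum>a\<in>I. y u a * s a i) * (\<Sum>b\<in>I. y v b * s b j)))"
      using assms(2) ij by (intro sum.cong refl) auto
    also have "\<dots> = 0" unfolding sum_swap_products using 0 by simp
    finally show "(\<Sum>(u, v)\<in>A. \<mu> u v * (z u i * z v j)) = 0" .
  qed
qed

text \<open>A factor per vertex is absorbed into the coefficients, a factor per coordinate into the
  equations.\<close>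

lemma indep_products_rescale:
  assumes "indep_products A I z" and "\<And>v a. v \<in> fst ` A \<Longrightarrow> a \<in> I \<Longrightarrow> z v a = s a * r v * y v a"
    and r: "\<And>v. r v \<noteq> 0" and "sym A"
  shows "indep_products A I y"
proof (rule indep_productsI)
  fix \<mu> u v
  assume sy: "\<And>u v. (u, v) \<in> A \<Longrightarrow> \<mu> u v = \<mu> v u" and uv: "(u, v) \<in> A"
    and 0: "\<And>a b. a \<in> I \<Longrightarrow> b \<in> I \<Longrightarrow> (\<Sum>(u, v)\<in>A. \<mu> u v * (y u a * y v b)) = 0"
  have "\<mu> u v / (r u * r v) = 0"
  proof (rule indep_productsD[OF assms(1) _ _ uv, where \<mu> = "\<lambda>u v. \<mu> u v / (r u * r v)"])
    fix a b assume ab: "a \<in> I" "b \<in> I"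
    have "u \<in> fst ` A \<and> v \<in> fst ` A" if "(u, v) \<in> A" for u v
      using that symD[OF assms(4) that] by force
    then have "(\<Sum>(u, v)\<in>A. \<mu> u v / (r u * r v) * (z u a * z v b))
        = (\<Sum>(u, v)\<in>A. (s a * s b) * (\<mu> u v * (y u a * y v b)))"
      using assms(2) ab r by (intro sum.cong refl) auto
    also have "\<dots> = (s a * s b) * (\<Sum>(u, v)\<in>A. \<mu> u v * (y u a * y v b))"
      by (simp add: sum_distrib_left case_prod_beta)
    finally show "(\<Sum>(u, v)\<in>A. \<mu> u v / (r u * r v) * (z u a * z v b)) = 0"
      using 0[OF ab] by simp
  qed (use sy in \<open>auto simp: mult.commute\<close>)
  then show "\<mu> u v = 0" using r by auto
qed

text \<open>\<open>b0\<close> and the \<open>d\<close> vertices \<open>b j\<close> will form an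
  affine frame of dimension \<open>d\<close>; \<open>Q\<close> holds the remaining vertices, and
  \<open>card Q\<close> is the \<open>k\<close> of the overview.\<close>

locale affine_base =
  fixes V Q :: "'v set" and b0 :: 'v and b :: "nat \<Rightarrow> 'v" and d :: nat
  assumes finite_V: "finite V" and Q_subset: "Q \<subseteq> V" and b0: "b0 \<in> V" "b0 \<notin> Q"
    and b: "bij_betw b {..<d} (V - Q - {b0})"
begin

definition b_index :: "'v \<Rightarrow> nat" where "b_index = inv_into {..<d} b"

lemma b_index_b [simp]: "j < d \<Longrightarrow> b_index (b j) = j"
  unfolding b_index_def using b by (intro inv_into_f_f) (auto simp: bij_betw_def)

lemma b_in: "j < d \<Longrightarrow> b j \<in> V - Q - {b0}"
  using b by (auto simp: bij_betw_def)

lemma b_simps [simp]: "j < d \<Longrightarrow> b j \<notin> Q" "j < d \<Longrightarrow> b j \<noteq> b0" "j < d \<Longrightarrow> b j \<in> V"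
  using b_in by auto

lemma b_inj [simp]: "i < d \<Longrightarrow> j < d \<Longrightarrow> b i = b j \<longleftrightarrow> i = j"
  by (metis b_index_b)

lemma V_cases [consumes 1, case_names Q base0 base]:
  assumes "v \<in> V"
  obtains "v \<in> Q" | "v = b0" | j where "j < d" "v = b j"
  using assms b unfolding bij_betw_def by blast

lemma b_index_less: "v \<in> V \<Longrightarrow> v \<notin> Q \<Longrightarrow> v \<noteq> b0 \<Longrightarrow> b_index v < d"
  by (cases v rule: V_cases) auto

lemma finite_Q: "finite Q"
  using Q_subset finite_V finite_subset by blast

lemma sum_V: "sum f V = sum f Q + f b0 + (\<Sum>j<d. f (b j))"
proof -
  have "V = Q \<union> (insert b0 (b ` {..<d}))"
    using b Q_subset b0 unfolding bij_betw_def by auto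
  then have "sum f V = sum f (Q \<union> (insert b0 (b ` {..<d})))" by simp
  also have "\<dots> = sum f Q + sum f (insert b0 (b ` {..<d}))"
    using finite_Q b0 by (intro sum.union_disjoint) auto
  also have "sum f (insert b0 (b ` {..<d})) = f b0 + sum f (b ` {..<d})"
  proof (rule sum.insert)
    show "b0 \<notin> b ` {..<d}" using b by (simp add: bij_betw_def)
  qed simp
  also have "sum f (b ` {..<d}) = (\<Sum>j<d. f (b j))"
    using b by (subst sum.reindex) (auto simp: bij_betw_def)
  finally show ?thesis by (simp add: add_ac)
qed

lemma card_V: "card V = card Q + Suc d"
  using sum_V[of "\<lambda>_. 1 :: nat"] by simp

text \<open>For fixed \<open>a\<close>, the coefficients of the affine dependency that writes the
  point of \<open>a\<close> in terms of the frame, with \<open>c a j\<close> its affine coordinates.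
  For fixed \<open>v\<close>, the Gale dual vector of \<open>v\<close>.\<close>

definition gale :: "('v \<Rightarrow> nat \<Rightarrow> real) \<Rightarrow> 'v \<Rightarrow> 'v \<Rightarrow> real" where
  "gale c v a = (if v \<in> Q then (if v = a then 1 else 0)
     else if v = b0 then - 1 + (\<Sum>j<d. c a j) else - c a (b_index v))"

text \<open>For vertices in \<open>Q\<close> the parameters are affine coordinates relative to the
  frame, not positions. There are still \<open>d\<close> parameters per vertex, while the
  dependencies become polynomial in them.\<close>

definition place :: "('v \<times> nat \<Rightarrow> real) \<Rightarrow> 'v \<Rightarrow> nat \<Rightarrow> real" where
  "place x v i = (if v \<in> Q then x (b0, i) + (\<Sum>j<d. x (v, j) * (x (b j, i) - x (b0, i))) else x (v, i))"

lemma sum_gale: "a \<in> Q \<Longrightarrow> (\<Sum>v\<in>V. gale c v a) = 0"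
  using finite_Q b0 by (simp add: sum_V gale_def sum_negf)

lemma sum_gale_place:
  assumes "a \<in> Q"
  shows "(\<Sum>v\<in>V. gale (\<lambda>a j. x (a, j)) v a * place x v i) = 0"
proof -
  have "(\<Sum>v\<in>Q. gale (\<lambda>a j. x (a, j)) v a * place x v i) = (\<Sum>v\<in>Q. if v = a then place x v i else 0)"
    by (intro sum.cong) (auto simp: gale_def)
  also have "\<dots> = place x a i" using assms finite_Q by simp
  finally show ?thesis
    using b0 assms by (simp add: sum_V gale_def place_def sum_negf algebra_simps sum_subtractf
        sum_distrib_left sum_distrib_right)
qed

text \<open>Checked with \<open>b0\<close> at the origin and the \<open>b j\<close> at unit
  vectors.\<close>

lemma base_independent:
  assumes x: "algebraically_independent (V \<times> {..<d}) x"
  shows "injective_system {..<d} {..<d} (\<lambda>i j. x (b j, i) - x (b0, i))"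
proof (rule injective_system_generic[OF _ _ x, where A = "\<lambda>i j x. x (b j, i) - x (b0, i)"])
  show "(\<lambda>x. x (b j, i) - x (b0, i)) \<in> ratpoly (V \<times> {..<d})" if "i \<in> {..<d}" "j \<in> {..<d}" for i j
    using that b0 by (intro ratpoly_intros) auto
  let ?x = "\<lambda>(v, i). if v \<noteq> b0 \<and> i = b_index v then 1 else 0 :: real"
  show "injective_system {..<d} {..<d} (\<lambda>i j. ?x (b j, i) - ?x (b0, i))"
  proof (rule injective_systemI)
    fix z j assume z: "\<And>i. i \<in> {..<d} \<Longrightarrow> (\<Sum>j\<in>{..<d}. (?x (b j, i) - ?x (b0, i)) * z j) = 0" and j: "j \<in> {..<d}"
    have "(\<Sum>l<d. (?x (b l, j) - ?x (b0, j)) * z l) = (\<Sum>l<d. if l = j then z l else 0)"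
      by (intro sum.cong) auto
    then show "z j = 0" using z[OF j] j by simp
  qed
qed simp

lemma base_solve:
  assumes "algebraically_independent (V \<times> {..<d}) x"
  shows "\<exists>z. \<forall>i<d. (\<Sum>j<d. z j * (x (b j, i) - x (b0, i))) = t i"
proof -
  obtain z where "\<forall>i\<in>{..<d}. (\<Sum>j\<in>{..<d}. (x (b j, i) - x (b0, i)) * z j) = t i"
    using injective_system_surjective[OF _ _ _ base_independent[OF assms], of t] by auto
  then show ?thesis by (intro exI[of _ z]) (simp add: mult.commute)
qed

text \<open>A rational polynomial vanishing at \<open>place x\<close> vanishes at every
  \<open>place x'\<close>. Every generic placement has this form, since its points in
  \<open>Q\<close> have affine coordinates relative to its frame; so the polynomial is zero.\<close>

lemma generic_place:
  assumes x: "algebraically_independent (V \<times> {..<d}) x"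
  shows "generic d V (place x)"
  unfolding generic_def algebraically_independent_alt
proof (intro ballI impI)
  fix P assume P: "P \<in> poly_on (V \<times> {..<d})" and 0: "eval_poly P (\<lambda>(v, i). place x v i) = 0"
  have "(\<lambda>x. (\<lambda>(v, i). place x v i) vi) \<in> ratpoly (V \<times> {..<d})" if "vi \<in> V \<times> {..<d}" for vi
    using that b0 unfolding place_def by (cases vi) (auto intro!: ratpoly_intros)
  then have "(\<lambda>x. eval_poly P (\<lambda>vi. (\<lambda>(v, i). place x v i) vi)) \<in> ratpoly (V \<times> {..<d})"
    by (intro eval_poly_ratpoly[OF P])
  from ratpoly_nonzero[OF x this] 0 have zero: "eval_poly P (\<lambda>(v, i). place x v i) = 0" for x by auto
  obtain y where y: "algebraically_independent (V \<times> {..<d}) y"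
    using ex_algebraically_independent[of "V \<times> {..<d}"] finite_V by auto
  have "\<exists>z. \<forall>i<d. (\<Sum>j<d. z j * (y (b j, i) - y (b0, i))) = y (v, i) - y (b0, i)" for v
    by (rule base_solve[OF y])
  then obtain c where c: "\<And>v i. i < d \<Longrightarrow> (\<Sum>j<d. c v j * (y (b j, i) - y (b0, i))) = y (v, i) - y (b0, i)"
    by metis
  define x' where "x' = (\<lambda>(v, i). if v \<in> Q then c v i else y (v, i))"
  have "place x' v i = y (v, i)" if "i < d" for v i
    using c[OF that, of v] b0 by (simp add: place_def x'_def)
  then have "eval_poly P y = eval_poly P (\<lambda>(v, i). place x' v i)"
    unfolding eval_poly_def using P
    by (intro sum.cong prod.cong refl arg_cong2[where f = "(*)"] arg_cong2[where f = "(^)"])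
      (fastforce simp: poly_on_def)
  then show "P = 0" using y P zero by (simp add: algebraically_independent_alt)
qed

text \<open>Independence is available for generic vectors, whereas Gale vectors must be unit vectors
  on \<open>Q\<close> and have total sum 0. A change of basis achieves the former, and a diagonal
  rescaling the latter once the sum over the frame has no zero coordinate.\<close>

lemma ex_indep_gale:
  assumes fin: "finite A" and sym: "sym A" and AV: "A \<subseteq> V \<times> V" and y0: "indep_products A {..<card Q} y0"
  shows "\<exists>c. indep_products A Q (gale c)"
proof -
  define k where "k = card Q"
  obtain y where y: "algebraically_independent (V \<times> {..<k}) y"
    using ex_algebraically_independent[of "V \<times> {..<k}"] finite_V by auto
  have ip: "indep_products A {..<k} (\<lambda>v i. y (v, i))"
  proof (rule indep_products_generic[OF fin sym y, where f = "\<lambda>v i y. y (v, i)" and xs = "\<lambda>(v, i). y0 v i"])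
    show "(\<lambda>y. y (v, i)) \<in> ratpoly (V \<times> {..<k})" if "v \<in> fst ` A" "i \<in> {..<k}" for v i
      using that AV by (intro ratpoly_intros) auto
  qed (use y0 in \<open>simp add: k_def\<close>)
  have inj: "injective_system {..<k} Q (\<lambda>i a. y (a, i))"
  proof (rule injective_systemI)
    fix z a assume "\<And>i. i \<in> {..<k} \<Longrightarrow> (\<Sum>a\<in>Q. y (a, i) * z a) = 0" "a \<in> Q"
    then show "z a = 0"
      using generic_vectors_independent[OF y Q_subset finite_Q, of k z a] by (simp add: k_def mult.commute)
  qed
  have "\<exists>z. \<forall>i\<in>{..<k}. (\<Sum>a\<in>Q. y (a, i) * z a) = y (v, i)" for v
    by (rule injective_system_surjective[OF _ finite_Q _ inj]) (simp_all add: k_def)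
  then obtain h where h: "\<And>v i. i \<in> {..<k} \<Longrightarrow> (\<Sum>a\<in>Q. y (a, i) * h v a) = y (v, i)" by metis
  \<comment> \<open>Coordinates with respect to the basis formed by the vectors of
    \<open>Q\<close>.\<close>
  define g where "g = (\<lambda>v a. if v \<in> Q then (if v = a then 1 else 0) else h v a)"
  have "indep_products A Q g"
  proof (rule indep_products_coordinates[OF ip _ sym])
    fix v j assume j: "j \<in> {..<k}"
    show "y (v, j) = (\<Sum>a\<in>Q. g v a * y (a, j))"
    proof (cases "v \<in> Q")
      case True
      then have "(\<Sum>a\<in>Q. g v a * y (a, j)) = (\<Sum>a\<in>Q. if a = v then y (a, j) else 0)"
        by (intro sum.cong) (auto simp: g_def)
      then show ?thesis using True finite_Q by simp
    next
      case False
      then show ?thesis using h[OF j, of v] by (simp add: g_def mult.commute)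
    qed
  qed
  note ipg = this
  \<comment> \<open>An unconstrained parametrisation in which \<open>- x (a, d)\<close> is
    coordinate \<open>a\<close> of the sum over the frame vertices; \<open>xs\<close> reproduces
    \<open>g\<close>. At a generic point that sum has no zero coordinate.\<close>
  define f where "f = (\<lambda>v a (x :: 'v \<times> nat \<Rightarrow> real). if v \<in> Q then (if v = a then 1 else 0)
    else if v = b0 then - x (a, d) - (\<Sum>j<d. x (a, j)) else x (a, b_index v))"
  obtain x where x: "algebraically_independent (Q \<times> {..<Suc d}) x"
    using ex_algebraically_independent[of "Q \<times> {..<Suc d}"] finite_Q by auto
  define xs where "xs = (\<lambda>(a, j). if j = d then - g b0 a - (\<Sum>j<d. g (b j) a) else g (b j) a)"
  have "indep_products A Q (\<lambda>v a. f v a x)"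
  proof (rule indep_products_generic[OF fin sym x, where f = f and xs = xs])
    show "f v a \<in> ratpoly (Q \<times> {..<Suc d})" if "v \<in> fst ` A" "a \<in> Q" for v a
    proof -
      have "v \<in> V" using that AV by auto
      then show ?thesis
        unfolding f_def using that b_index_less[of v] by (intro ratpoly_intros) auto
    qed
    have "f v a xs = g v a" if "v \<in> V" "a \<in> Q" for v a
      using that(1) by (cases v rule: V_cases) (use b0 in \<open>auto simp: f_def xs_def g_def\<close>)
    then show "indep_products A Q (\<lambda>v a. f v a xs)"
      using AV by (intro indep_products_rescale[OF ipg, where s = "\<lambda>_. 1" and r = "\<lambda>_. 1"] sym) auto
  qed
  note ipf = this
  \<comment> \<open>Dividing coordinate \<open>a\<close> by \<open>x (a, d)\<close> makes the frame
    sum -1, as \<open>gale\<close> demands; \<open>r\<close> on \<open>Q\<close> compensates so that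
    the unit vectors remain.\<close>
  define r where "r v = (if v \<in> Q then 1 / x (v, d) else 1)" for v
  define c where "c a j = - x (a, j) / x (a, d)" for a j
  have nz: "x (a, d) \<noteq> 0" if "a \<in> Q" for a
    using ratpoly_nonzero[OF x ratpoly.var[of "(a, d)"], of "\<lambda>_. 1"] that by simp
  have "indep_products A Q (gale c)"
  proof (rule indep_products_rescale[OF ipf, where s = "\<lambda>a. x (a, d)" and r = r])
    show "f v a x = x (a, d) * r v * gale c v a" if "v \<in> fst ` A" "a \<in> Q" for v a
    proof -
      have "v \<in> V" using that AV by auto
      then show ?thesis
        by (cases v rule: V_cases)
          (use b0 nz that in \<open>auto simp: f_def gale_def r_def c_def field_simps sum_negf sum_divide_distrib[symmetric]\<close>)
    qed
  qed (use nz sym in \<open>auto simp: r_def\<close>)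
  then show ?thesis by blast
qed

end

section \<open>Rigidity\<close>

definition sq_dist :: "nat \<Rightarrow> ('v \<Rightarrow> nat \<Rightarrow> real) \<Rightarrow> 'v \<Rightarrow> 'v \<Rightarrow> real" where
  "sq_dist d p u v = (\<Sum>i<d. (p u i - p v i)\<^sup>2)"

lemma dist_dim_eq_iff: "dist_dim d (q u) (q v) = dist_dim d (p u) (p v) \<longleftrightarrow> sq_dist d q u v = sq_dist d p u v"
  by (simp add: dist_dim_def L2_set_def sq_dist_def)

lemma sq_dist_commute: "sq_dist d p u v = sq_dist d p v u"
  by (simp add: sq_dist_def power2_commute)

lemma sq_dist_self: "sq_dist d p u u = 0"
  by (simp add: sq_dist_def)

text \<open>In the expansion of the squared differences the pure squares drop out because the
  weights sum to 0; only the mixed term is left.\<close>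

lemma sum_weighted_sq_dist:
  fixes \<alpha> \<beta> :: "'v \<Rightarrow> real"
  assumes "(\<Sum>v\<in>V. \<alpha> v) = 0" "(\<Sum>v\<in>V. \<beta> v) = 0"
  shows "(\<Sum>u\<in>V. \<Sum>v\<in>V. \<alpha> u * \<beta> v * sq_dist d q u v)
    = - 2 * (\<Sum>i<d. (\<Sum>u\<in>V. \<alpha> u * q u i) * (\<Sum>v\<in>V. \<beta> v * q v i))"
proof -
  have 1: "(\<Sum>u\<in>V. \<Sum>v\<in>V. \<alpha> u * \<beta> v * (x u - x v)\<^sup>2)
      = - 2 * ((\<Sum>u\<in>V. \<alpha> u * x u) * (\<Sum>v\<in>V. \<beta> v * x v))" for x :: "'v \<Rightarrow> real"
  proof -
    have "(\<Sum>u\<in>V. \<Sum>v\<in>V. \<alpha> u * \<beta> v * (x u - x v)\<^sup>2)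
        = (\<Sum>u\<in>V. \<Sum>v\<in>V. (\<alpha> u * (x u)\<^sup>2) * \<beta> v + \<alpha> u * (\<beta> v * (x v)\<^sup>2) - 2 * ((\<alpha> u * x u) * (\<beta> v * x v)))"
      by (intro sum.cong refl) (simp add: power2_eq_square algebra_simps)
    also have "\<dots> = (\<Sum>u\<in>V. \<alpha> u * (x u)\<^sup>2) * (\<Sum>v\<in>V. \<beta> v) + (\<Sum>u\<in>V. \<alpha> u) * (\<Sum>v\<in>V. \<beta> v * (x v)\<^sup>2)
        - 2 * ((\<Sum>u\<in>V. \<alpha> u * x u) * (\<Sum>v\<in>V. \<beta> v * x v))"
      unfolding sum_product by (simp add: sum.distrib sum_subtractf sum_distrib_left)
    finally show ?thesis using assms by simp
  qed
  have "(\<Sum>u\<in>V. \<Sum>v\<in>V. \<alpha> u * \<beta> v * sq_dist d q u v)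
      = (\<Sum>u\<in>V. \<Sum>v\<in>V. \<Sum>i<d. \<alpha> u * \<beta> v * (q u i - q v i)\<^sup>2)"
    by (simp add: sq_dist_def sum_distrib_left)
  also have "\<dots> = (\<Sum>u\<in>V. \<Sum>i<d. \<Sum>v\<in>V. \<alpha> u * \<beta> v * (q u i - q v i)\<^sup>2)"
    by (intro sum.cong refl, rule sum.swap)
  also have "\<dots> = (\<Sum>i<d. \<Sum>u\<in>V. \<Sum>v\<in>V. \<alpha> u * \<beta> v * (q u i - q v i)\<^sup>2)"
    by (rule sum.swap)
  also have "\<dots> = - 2 * (\<Sum>i<d. (\<Sum>u\<in>V. \<alpha> u * q u i) * (\<Sum>v\<in>V. \<beta> v * q v i))"
    by (simp add: 1[of "\<lambda>v. q v _"] sum_distrib_left)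
  finally show ?thesis .
qed

lemma sum_abs_le_card:
  fixes g :: "'a \<Rightarrow> real" and K :: real
  assumes "\<And>l. l \<in> L \<Longrightarrow> \<bar>g l\<bar> \<le> K"
  shows "(\<Sum>l\<in>L. \<bar>g l\<bar>) \<le> card L * K"
  using sum_bounded_above[of L "\<lambda>l. \<bar>g l\<bar>" K] assms by simp

text \<open>The vectors \<open>f\<^sub>l\<close> and \<open>s\<close> are linearly dependent, being \<open>d + 1\<close> vectors in dimension \<open>d\<close>,
  and \<open>f\<^sub>l\<close> are nearly orthonormal, so \<open>s\<close> is a combination of them with small coefficients.\<close>

lemma inner_small_if_nearly_orthonormal:
  fixes f :: "nat \<Rightarrow> nat \<Rightarrow> real"
  assumes f: "\<And>l r. l < d \<Longrightarrow> r < d \<Longrightarrow> \<bar>(\<Sum>i<d. f l i * f r i) - (if l = r then 1 else 0)\<bar> \<le> \<eta>"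
    and s: "\<And>l. l < d \<Longrightarrow> \<bar>\<Sum>i<d. s i * f l i\<bar> \<le> \<eta>"
    and t: "\<And>l. l < d \<Longrightarrow> \<bar>\<Sum>i<d. t i * f l i\<bar> \<le> \<eta>"
    and small: "real d * \<eta> < 1 / 2" and "\<eta> \<ge> 0"
  shows "\<bar>\<Sum>i<d. s i * t i\<bar> \<le> 2 * real d * \<eta>\<^sup>2"
proof -
  define D where "D l r = (\<Sum>i<d. f l i * f r i) - (if l = r then 1 else 0)" for l r
  have D\<eta>: "\<bar>D l r\<bar> \<le> \<eta>" if "l < d" "r < d" for l r
    using f[OF that] by (simp only: D_def)
  have comb: "(\<Sum>i<d. (\<Sum>l<d. z l * f l i) * f r i) = z r + (\<Sum>l<d. z l * D l r)" if "r < d" for z r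
  proof -
    have "(\<Sum>i<d. (\<Sum>l<d. z l * f l i) * f r i) = (\<Sum>l<d. \<Sum>i<d. z l * (f l i * f r i))"
      unfolding sum_distrib_right by (subst sum.swap) (simp add: mult.assoc)
    also have "\<dots> = (\<Sum>l<d. (if l = r then z l else 0) + z l * D l r)"
      by (intro sum.cong refl) (simp add: D_def sum_distrib_left[symmetric] algebra_simps)
    finally show ?thesis using that by (simp add: sum.distrib)
  qed
  \<comment> \<open>Quantitative inversion of the Gram matrix \<open>1 + D\<close>: summing the row
    estimates puts \<open>S\<close> on both sides, and \<open>real d * \<eta> < 1 / 2\<close>
    absorbs half of it.\<close>
  have bound: "(\<Sum>l<d. \<bar>z l\<bar>) \<le> 2 * real d * K"
    if z: "\<And>r. r < d \<Longrightarrow> \<bar>z r + (\<Sum>l<d. z l * D l r)\<bar> \<le> K" and "K \<ge> 0" for z K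
  proof -
    define S where "S = (\<Sum>l<d. \<bar>z l\<bar>)"
    have "S \<ge> 0" by (simp add: S_def sum_nonneg)
    have "\<bar>z r\<bar> \<le> K + \<eta> * S" if r: "r < d" for r
    proof -
      have "\<bar>\<Sum>l<d. z l * D l r\<bar> \<le> (\<Sum>l<d. \<bar>z l\<bar> * \<eta>)"
        using D\<eta> r by (intro order_trans[OF sum_abs] sum_mono) (auto simp: abs_mult intro!: mult_left_mono)
      also have "\<dots> = \<eta> * S" by (simp add: S_def sum_distrib_left mult.commute)
      finally show ?thesis using z[OF r] by linarith
    qed
    then have "S \<le> card {..<d} * (K + \<eta> * S)"
      using sum_abs_le_card[where L = "{..<d}" and g = z and K = "K + \<eta> * S"] by (simp add: S_def)
    also have "\<dots> = real d * K + (real d * \<eta>) * S" by (simp add: algebra_simps)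
    also have "(real d * \<eta>) * S \<le> 1 / 2 * S"
      using small \<open>S \<ge> 0\<close> by (intro mult_right_mono) auto
    finally show ?thesis by (simp add: S_def)
  qed
  obtain z where z: "\<exists>j\<in>{..<Suc d}. z j \<noteq> 0"
    "\<forall>i\<in>{..<d}. (\<Sum>j\<in>{..<Suc d}. (if j < d then f j i else s i) * z j) = 0"
    using ex_nontrivial_solution[of "{..<d}" "{..<Suc d}" "\<lambda>i j. if j < d then f j i else s i"]
    by (simp only: finite_lessThan card_lessThan lessI) blast
  have dep: "(\<Sum>j<d. z j * f j i) + z d * s i = 0" if "i < d" for i
    using z(2) that by (simp add: mult.commute)
  \<comment> \<open>With \<open>K = 0\<close> the bound is linear independence of the
    \<open>f l\<close>, so \<open>s\<close> takes part in the relation.\<close>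
  have zd: "z d \<noteq> 0"
  proof
    assume zd: "z d = 0"
    have "(\<Sum>l<d. \<bar>z l\<bar>) \<le> 2 * real d * 0"
    proof (rule bound)
      fix r assume "r < d"
      then show "\<bar>z r + (\<Sum>l<d. z l * D l r)\<bar> \<le> 0"
        using dep zd by (simp add: comb[symmetric])
    qed simp
    then have "(\<Sum>l<d. \<bar>z l\<bar>) = 0" by (intro order_antisym sum_nonneg) simp_all
    then have "\<forall>l<d. z l = 0" by (simp add: sum_nonneg_eq_0_iff)
    then show False using z(1) zd by (auto simp: less_Suc_eq)
  qed
  define \<alpha> where "\<alpha> j = - z j / z d" for j
  have s_eq: "s i = (\<Sum>l<d. \<alpha> l * f l i)" if "i < d" for i
    using dep[OF that] zd by (simp add: \<alpha>_def sum_negf sum_divide_distrib[symmetric] field_simps)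
  have \<alpha>: "(\<Sum>l<d. \<bar>\<alpha> l\<bar>) \<le> 2 * real d * \<eta>"
  proof (rule bound)
    fix r assume r: "r < d"
    show "\<bar>\<alpha> r + (\<Sum>l<d. \<alpha> l * D l r)\<bar> \<le> \<eta>"
      using s[OF r] by (simp add: comb[OF r, symmetric] s_eq)
  qed fact
  have "(\<Sum>i<d. s i * t i) = (\<Sum>i<d. \<Sum>l<d. \<alpha> l * (t i * f l i))"
    by (simp add: s_eq sum_distrib_left mult_ac)
  also have "\<dots> = (\<Sum>l<d. \<alpha> l * (\<Sum>i<d. t i * f l i))"
    by (subst sum.swap) (simp add: sum_distrib_left)
  also have "\<bar>\<dots>\<bar> \<le> (\<Sum>l<d. \<bar>\<alpha> l\<bar> * \<eta>)"
    using t by (intro order_trans[OF sum_abs] sum_mono) (auto simp: abs_mult intro!: mult_left_mono)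
  also have "\<dots> \<le> (2 * real d * \<eta>) * \<eta>"
    using mult_right_mono[OF \<alpha> \<open>\<eta> \<ge> 0\<close>] by (simp add: sum_distrib_right)
  finally show ?thesis by (simp add: power2_eq_square mult.assoc)
qed

text \<open>Quantitative independence: \<open>C\<close> sums the absolute entries of a left inverse
  of the system in \<open>product_row\<close>, whose symmetry rows evaluate to 0.\<close>

lemma indep_products_bound:
  assumes fin: "finite A" and sym: "sym A" and I: "finite I" and ip: "indep_products A I y"
  shows "\<exists>C\<ge>0. \<forall>\<mu> K. (\<forall>(u, v)\<in>A. \<mu> u v = \<mu> v u) \<longrightarrow>
    (\<forall>a\<in>I. \<forall>b\<in>I. \<bar>\<Sum>(u, v)\<in>A. \<mu> u v * (y u a * y v b)\<bar> \<le> K) \<longrightarrow> K \<ge> 0 \<longrightarrow>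
    (\<Sum>(u, v)\<in>A. \<bar>\<mu> u v\<bar>) \<le> C * K"
proof -
  define R where "R = Inl ` (I \<times> I) \<union> Inr ` A"
  have finR: "finite R" using fin I by (simp add: R_def)
  have inj: "injective_system R A (product_row y)"
    using iffD1[OF indep_products_iff_injective_system[OF fin sym] ip] by (simp only: R_def)
  obtain w where w: "\<forall>l\<in>A. \<forall>j\<in>A. (\<Sum>i\<in>R. w l i * product_row y i j) = (if j = l then 1 else 0)"
    using injective_system_left_inverse[OF fin finR inj] by (rule exE)
  define C where "C = (\<Sum>l\<in>A. \<Sum>i\<in>R. \<bar>w l i\<bar>)"
  have "(\<Sum>(u, v)\<in>A. \<bar>\<mu> u v\<bar>) \<le> C * K"
    if sy: "\<forall>(u, v)\<in>A. \<mu> u v = \<mu> v u" and K: "\<forall>a\<in>I. \<forall>b\<in>I. \<bar>\<Sum>(u, v)\<in>A. \<mu> u v * (y u a * y v b)\<bar> \<le> K" "K \<ge> 0"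
    for \<mu> K
  proof -
    define m where "m e = \<mu> (fst e) (snd e)" for e
    have row: "\<bar>\<Sum>e\<in>A. product_row y i e * m e\<bar> \<le> K" if "i \<in> R" for i
      using that unfolding R_def
    proof
      assume "i \<in> Inl ` (I \<times> I)"
      then obtain a b where i: "i = Inl (a, b)" "a \<in> I" "b \<in> I" by auto
      have "(\<Sum>e\<in>A. product_row y i e * m e) = (\<Sum>(u, v)\<in>A. \<mu> u v * (y u a * y v b))"
        unfolding i by (intro sum.cong) (auto simp: m_def mult_ac)
      then show ?thesis using K(1) i by simp
    next
      assume "i \<in> Inr ` A"
      then obtain u v where i: "i = Inr (u, v)" "(u, v) \<in> A" by auto
      have "(v, u) \<in> A" using i sym by (auto dest: symD)
      have "(\<Sum>e\<in>A. product_row y i e * m e) = (\<Sum>e\<in>A. (if e = (u, v) then m e else 0) - (if e = (v, u) then m e else 0))"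
        by (simp add: i left_diff_distrib if_distrib[where f = "\<lambda>c. c * _"] cong: if_cong)
      also have "\<dots> = m (u, v) - m (v, u)" using fin i \<open>(v, u) \<in> A\<close> by (simp add: sum_subtractf)
      also have "\<dots> = 0" using sy i by (auto simp: m_def)
      finally show ?thesis using K by simp
    qed
    have "\<bar>m l\<bar> \<le> (\<Sum>i\<in>R. \<bar>w l i\<bar>) * K" if l: "l \<in> A" for l
    proof -
      have "(\<Sum>i\<in>R. w l i * (\<Sum>e\<in>A. product_row y i e * m e)) = (\<Sum>e\<in>A. (\<Sum>i\<in>R. w l i * product_row y i e) * m e)"
        unfolding sum_distrib_left sum_distrib_right by (subst sum.swap) (simp add: mult.assoc)
      also have "\<dots> = (\<Sum>e\<in>A. if e = l then m e else 0)"
        using w l by (intro sum.cong) auto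
      also have "\<dots> = m l" using l fin by simp
      finally have "\<bar>m l\<bar> = \<bar>\<Sum>i\<in>R. w l i * (\<Sum>e\<in>A. product_row y i e * m e)\<bar>" by simp
      also have "\<dots> \<le> (\<Sum>i\<in>R. \<bar>w l i\<bar> * K)"
        using row by (intro order_trans[OF sum_abs] sum_mono) (auto simp: abs_mult intro!: mult_left_mono)
      finally show ?thesis by (simp add: sum_distrib_right)
    qed
    then have "(\<Sum>l\<in>A. \<bar>m l\<bar>) \<le> (\<Sum>l\<in>A. (\<Sum>i\<in>R. \<bar>w l i\<bar>) * K)" by (intro sum_mono)
    then show ?thesis by (simp add: C_def sum_distrib_right m_def case_prod_beta)
  qed
  moreover have "C \<ge> 0" unfolding C_def by (intro sum_nonneg) auto
  ultimately show ?thesis by blast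
qed

text \<open>With \<open>M\<close> the change of squared lengths and \<open>y\<close> affine dependencies of \<open>p\<close>, the matrix
  \<open>y\<^sup>T M y\<close> equals \<open>- 2 s s\<^sup>T\<close> for \<open>s = y\<^sup>T q\<close>, and \<open>s\<close> is linear in \<open>M\<close> up to the near-isometry
  given by \<open>\<delta>\<close>. Hence \<open>M\<close> is bounded by its own square.\<close>

lemma rigid_gap:
  fixes p :: "'v \<Rightarrow> nat \<Rightarrow> real"
  assumes V: "finite V" and AV: "A \<subseteq> V \<times> V" and sym: "sym A" and I: "finite I"
    and ip: "indep_products A I y"
    and y: "\<And>a. a \<in> I \<Longrightarrow> (\<Sum>v\<in>V. y v a) = 0"
      "\<And>a i. a \<in> I \<Longrightarrow> i < d \<Longrightarrow> (\<Sum>v\<in>V. y v a * p v i) = 0"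
    and \<delta>: "\<And>l. l < d \<Longrightarrow> (\<Sum>v\<in>V. \<delta> v l) = 0"
      "\<And>l i. l < d \<Longrightarrow> i < d \<Longrightarrow> (\<Sum>v\<in>V. \<delta> v l * p v i) = (if i = l then 1 else 0)"
  shows "\<exists>\<epsilon>>0. \<forall>q. (\<forall>u\<in>V. \<forall>v\<in>V. (u, v) \<notin> A \<longrightarrow> sq_dist d q u v = sq_dist d p u v) \<longrightarrow>
    (\<Sum>u\<in>V. \<Sum>v\<in>V. \<bar>sq_dist d q u v - sq_dist d p u v\<bar>) < \<epsilon> \<longrightarrow>
    (\<Sum>u\<in>V. \<Sum>v\<in>V. \<bar>sq_dist d q u v - sq_dist d p u v\<bar>) = 0"
proof -
  have fin: "finite A" using finite_subset[OF AV] V by simp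
  obtain C where C: "C \<ge> 0" "\<And>\<mu> K. (\<forall>(u, v)\<in>A. \<mu> u v = \<mu> v u) \<Longrightarrow>
    (\<forall>a\<in>I. \<forall>b\<in>I. \<bar>\<Sum>(u, v)\<in>A. \<mu> u v * (y u a * y v b)\<bar> \<le> K) \<Longrightarrow> K \<ge> 0 \<Longrightarrow>
    (\<Sum>(u, v)\<in>A. \<bar>\<mu> u v\<bar>) \<le> C * K"
    using indep_products_bound[OF fin sym I ip] by blast
  define B where "B = (\<Sum>v\<in>V. \<Sum>a\<in>I. \<bar>y v a\<bar>) + (\<Sum>v\<in>V. \<Sum>l<d. \<bar>\<delta> v l\<bar>)"
  have B1: "\<bar>y v a\<bar> \<le> B" if "v \<in> V" "a \<in> I" for v a
  proof -
    have "\<bar>y v a\<bar> \<le> (\<Sum>a\<in>I. \<bar>y v a\<bar>)" using that I by (intro member_le_sum) auto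
    also have "\<dots> \<le> (\<Sum>v\<in>V. \<Sum>a\<in>I. \<bar>y v a\<bar>)"
      using that V by (intro member_le_sum[where f = "\<lambda>v. \<Sum>a\<in>I. \<bar>y v a\<bar>"]) (auto intro: sum_nonneg)
    finally show ?thesis unfolding B_def by (smt (verit) sum_nonneg abs_ge_zero)
  qed
  have B2: "\<bar>\<delta> v l\<bar> \<le> B" if "v \<in> V" "l < d" for v l
  proof -
    have "\<bar>\<delta> v l\<bar> \<le> (\<Sum>l<d. \<bar>\<delta> v l\<bar>)" using that by (intro member_le_sum) auto
    also have "\<dots> \<le> (\<Sum>v\<in>V. \<Sum>l<d. \<bar>\<delta> v l\<bar>)"
      using that V by (intro member_le_sum[where f = "\<lambda>v. \<Sum>l<d. \<bar>\<delta> v l\<bar>"]) (auto intro: sum_nonneg)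
    finally show ?thesis unfolding B_def by (smt (verit) sum_nonneg abs_ge_zero)
  qed
  have "B \<ge> 0" unfolding B_def by (intro add_nonneg_nonneg sum_nonneg) auto
  define K where "K = B\<^sup>2"
  define \<Lambda> where "\<Lambda> = C * (4 * real d * K\<^sup>2)"
  \<comment> \<open>The first bound yields \<open>real d * \<eta> < 1 / 2\<close>, the second
    \<open>\<Lambda> * m < 1\<close>; the added 1 keeps the denominators positive.\<close>
  define \<epsilon> where "\<epsilon> = min (1 / (2 * (real d * K) + 1)) (1 / (\<Lambda> + 1))"
  have "K \<ge> 0" "\<Lambda> \<ge> 0" using C(1) by (auto simp: K_def \<Lambda>_def)
  have "\<epsilon> > 0" unfolding \<epsilon>_def using \<open>K \<ge> 0\<close> \<open>\<Lambda> \<ge> 0\<close> by (simp add: add_nonneg_pos)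
  moreover have "m = 0"
    if q: "\<forall>u\<in>V. \<forall>v\<in>V. (u, v) \<notin> A \<longrightarrow> sq_dist d q u v = sq_dist d p u v"
      and m: "m = (\<Sum>u\<in>V. \<Sum>v\<in>V. \<bar>sq_dist d q u v - sq_dist d p u v\<bar>)" and m\<epsilon>: "m < \<epsilon>" for q m
  proof -
    define M where "M u v = sq_dist d q u v - sq_dist d p u v" for u v
    have m0: "m \<ge> 0" unfolding m by (intro sum_nonneg) auto
    \<comment> \<open>\<open>M\<close> vanishes off \<open>A\<close>, so sums over all pairs reduce
      to sums over arcs.\<close>
    have restrict: "(\<Sum>u\<in>V. \<Sum>v\<in>V. g u v) = (\<Sum>(u, v)\<in>A. g u v)"
      if "\<And>u v. M u v = 0 \<Longrightarrow> g u v = 0" for g :: "'v \<Rightarrow> 'v \<Rightarrow> real"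
      unfolding sum.cartesian_product using V AV q that
      by (intro sum.mono_neutral_right) (auto simp: M_def)
    have MA: "m = (\<Sum>(u, v)\<in>A. \<bar>M u v\<bar>)"
      unfolding m M_def[symmetric] by (rule restrict) simp
    have wsum: "\<bar>\<Sum>u\<in>V. \<Sum>v\<in>V. \<alpha> u * \<beta> v * M u v\<bar> \<le> K * m"
      if "\<And>v. v \<in> V \<Longrightarrow> \<bar>\<alpha> v\<bar> \<le> B" "\<And>v. v \<in> V \<Longrightarrow> \<bar>\<beta> v\<bar> \<le> B" for \<alpha> \<beta>
    proof -
      have "\<bar>\<Sum>u\<in>V. \<Sum>v\<in>V. \<alpha> u * \<beta> v * M u v\<bar> \<le> (\<Sum>u\<in>V. \<bar>\<Sum>v\<in>V. \<alpha> u * \<beta> v * M u v\<bar>)"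
        by (rule sum_abs)
      also have "\<dots> \<le> (\<Sum>u\<in>V. \<Sum>v\<in>V. K * \<bar>M u v\<bar>)"
      proof (intro sum_mono order_trans[OF sum_abs])
        fix u v assume "u \<in> V" "v \<in> V"
        then have "\<bar>\<alpha> u\<bar> * \<bar>\<beta> v\<bar> \<le> B * B"
          using that \<open>B \<ge> 0\<close> by (intro mult_mono) auto
        then show "\<bar>\<alpha> u * \<beta> v * M u v\<bar> \<le> K * \<bar>M u v\<bar>"
          by (simp add: abs_mult K_def power2_eq_square mult_right_mono)
      qed
      also have "\<dots> = K * m" by (simp add: m M_def sum_distrib_left)
      finally show ?thesis .
    qed
    define \<eta> where "\<eta> = K * m"
    have "\<eta> \<ge> 0" using \<open>K \<ge> 0\<close> m0 by (simp add: \<eta>_def)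
    define f where "f l i = (\<Sum>v\<in>V. \<delta> v l * q v i)" for l i
    define s where "s a i = (\<Sum>v\<in>V. y v a * q v i)" for a i
    have Msplit: "(\<Sum>u\<in>V. \<Sum>v\<in>V. \<alpha> u * \<beta> v * M u v)
        = - 2 * (\<Sum>i<d. (\<Sum>u\<in>V. \<alpha> u * q u i) * (\<Sum>v\<in>V. \<beta> v * q v i))
          + 2 * (\<Sum>i<d. (\<Sum>u\<in>V. \<alpha> u * p u i) * (\<Sum>v\<in>V. \<beta> v * p v i))"
      if "(\<Sum>v\<in>V. \<alpha> v) = 0" "(\<Sum>v\<in>V. \<beta> v) = 0" for \<alpha> \<beta>
    proof -
      have "(\<Sum>u\<in>V. \<Sum>v\<in>V. \<alpha> u * \<beta> v * M u v)
        = (\<Sum>u\<in>V. \<Sum>v\<in>V. \<alpha> u * \<beta> v * sq_dist d q u v) - (\<Sum>u\<in>V. \<Sum>v\<in>V. \<alpha> u * \<beta> v * sq_dist d p u v)"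
        by (simp add: M_def right_diff_distrib sum_subtractf)
      then show ?thesis by (simp add: sum_weighted_sq_dist[OF that])
    qed
    have half: "\<bar>x\<bar> \<le> \<eta>" if "g = - 2 * x" "\<bar>g\<bar> \<le> \<eta>" for g x :: real
      using that by linarith
    have ff: "\<bar>(\<Sum>i<d. f l i * f r i) - (if l = r then 1 else 0)\<bar> \<le> \<eta>" if "l < d" "r < d" for l r
    proof -
      have "(\<Sum>i<d. (\<Sum>u\<in>V. \<delta> u l * p u i) * (\<Sum>v\<in>V. \<delta> v r * p v i))
          = (\<Sum>i<d. if i = l then (if l = r then 1 else 0) else 0)"
        using \<delta>(2) that by (intro sum.cong) auto
      also have "\<dots> = (if l = r then 1 else 0)" using that by simp
      finally have "(\<Sum>u\<in>V. \<Sum>v\<in>V. \<delta> u l * \<delta> v r * M u v)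
          = - 2 * ((\<Sum>i<d. f l i * f r i) - (if l = r then 1 else 0))"
        using Msplit[OF \<delta>(1) \<delta>(1), of l r] that by (simp add: f_def)
      moreover have "\<bar>\<Sum>u\<in>V. \<Sum>v\<in>V. \<delta> u l * \<delta> v r * M u v\<bar> \<le> \<eta>"
        unfolding \<eta>_def by (rule wsum) (use B2 that in auto)
      ultimately show ?thesis by (rule half)
    qed
    have sf: "\<bar>\<Sum>i<d. s a i * f l i\<bar> \<le> \<eta>" if "a \<in> I" "l < d" for a l
    proof -
      have "(\<Sum>i<d. (\<Sum>u\<in>V. y u a * p u i) * (\<Sum>v\<in>V. \<delta> v l * p v i)) = 0"
        using y(2) that by (intro sum.neutral) auto
      then have "(\<Sum>u\<in>V. \<Sum>v\<in>V. y u a * \<delta> v l * M u v) = - 2 * (\<Sum>i<d. s a i * f l i)"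
        using Msplit[OF y(1) \<delta>(1), of a l] that by (simp add: f_def s_def)
      moreover have "\<bar>\<Sum>u\<in>V. \<Sum>v\<in>V. y u a * \<delta> v l * M u v\<bar> \<le> \<eta>"
        unfolding \<eta>_def by (rule wsum) (use B1 B2 that in auto)
      ultimately show ?thesis by (rule half)
    qed
    have "real d * \<eta> < 1 / 2"
    proof -
      have "0 < 2 * (real d * K) + 1" using \<open>K \<ge> 0\<close> by (simp add: add_nonneg_pos)
      moreover have "m < 1 / (2 * (real d * K) + 1)" using m\<epsilon> by (simp add: \<epsilon>_def)
      ultimately have "m * (2 * (real d * K) + 1) < 1" by (simp only: pos_less_divide_eq)
      then show ?thesis using m0 by (simp add: \<eta>_def algebra_simps)
    qed
    then have ss: "\<bar>\<Sum>i<d. s a i * s b i\<bar> \<le> 2 * real d * \<eta>\<^sup>2" if "a \<in> I" "b \<in> I" for a b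
      using that \<open>\<eta> \<ge> 0\<close> by (intro inner_small_if_nearly_orthonormal[of d f] ff sf)
    \<comment> \<open>The 4 combines the factor -2 of \<open>Msplit\<close> with the 2 of
      \<open>inner_small_if_nearly_orthonormal\<close>. As \<open>\<eta> = K * m\<close>, the right
      side is quadratic in \<open>m\<close>.\<close>
    have "m \<le> C * (4 * real d * \<eta>\<^sup>2)"
      unfolding MA
    proof (rule C(2))
      show "\<forall>(u, v)\<in>A. M u v = M v u" by (auto simp: M_def sq_dist_commute)
      show "\<forall>a\<in>I. \<forall>b\<in>I. \<bar>\<Sum>(u, v)\<in>A. M u v * (y u a * y v b)\<bar> \<le> 4 * real d * \<eta>\<^sup>2"
      proof (intro ballI)
        fix a b assume ab: "a \<in> I" "b \<in> I"
        have "(\<Sum>(u, v)\<in>A. M u v * (y u a * y v b)) = (\<Sum>u\<in>V. \<Sum>v\<in>V. M u v * (y u a * y v b))"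
          by (rule restrict[symmetric]) simp
        also have "\<dots> = (\<Sum>u\<in>V. \<Sum>v\<in>V. y u a * y v b * M u v)"
          by (simp add: mult.commute)
        also have "\<dots> = - 2 * (\<Sum>i<d. s a i * s b i)"
          using Msplit[OF y(1) y(1), of a b] ab y(2) by (simp add: s_def)
        finally show "\<bar>\<Sum>(u, v)\<in>A. M u v * (y u a * y v b)\<bar> \<le> 4 * real d * \<eta>\<^sup>2"
          using ss[OF ab] by simp
      qed
    qed simp
    also have "\<dots> = \<Lambda> * m * m" by (simp add: \<eta>_def \<Lambda>_def power2_eq_square mult_ac)
    finally have le: "m \<le> \<Lambda> * m * m" .
    have lt: "\<Lambda> * m < 1"
    proof -
      have "0 < \<Lambda> + 1" using \<open>\<Lambda> \<ge> 0\<close> by simp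
      moreover have "m < 1 / (\<Lambda> + 1)" using m\<epsilon> by (simp add: \<epsilon>_def)
      ultimately have "m * (\<Lambda> + 1) < 1" by (simp only: pos_less_divide_eq)
      then show ?thesis using m0 by (simp add: algebra_simps)
    qed
    show ?thesis
    proof (rule ccontr)
      assume "m \<noteq> 0"
      then have "\<Lambda> * m * m < 1 * m" using m0 by (intro mult_strict_right_mono lt) simp
      with le show False by simp
    qed
  qed
  ultimately show ?thesis by (intro exI[of _ \<epsilon>]) auto
qed

text \<open>The total change \<open>m\<close> is continuous in time, starts at 0 and omits the value
  \<open>\<epsilon> / 2\<close>.\<close>

lemma rigid_framework_if_gap:
  assumes fin: "finite (verts G)" and "\<epsilon> > 0"
    and A: "\<And>u v. u \<in> verts G \<Longrightarrow> v \<in> verts G \<Longrightarrow> (u, v) \<notin> A \<Longrightarrow> u = v \<or> {u, v} \<in> edges G"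
    and gap: "\<And>q. (\<forall>u\<in>verts G. \<forall>v\<in>verts G. (u, v) \<notin> A \<longrightarrow> sq_dist d q u v = sq_dist d p u v) \<Longrightarrow>
      (\<Sum>u\<in>verts G. \<Sum>v\<in>verts G. \<bar>sq_dist d q u v - sq_dist d p u v\<bar>) < \<epsilon> \<Longrightarrow>
      (\<Sum>u\<in>verts G. \<Sum>v\<in>verts G. \<bar>sq_dist d q u v - sq_dist d p u v\<bar>) = 0"
  shows "rigid_framework d G p"
  unfolding rigid_framework_def dist_dim_eq_iff
proof (intro allI impI ballI)
  fix q :: "real \<Rightarrow> _" and t :: real and u v
  assume q: "continuous_motion d G p q" and t: "t \<in> {0..1}" and uv: "u \<in> verts G" "v \<in> verts G"
    and len: "\<forall>t\<in>{0..1}. \<forall>u\<in>verts G. \<forall>v\<in>verts G. {u, v} \<in> edges G \<longrightarrow> sq_dist d (q t) u v = sq_dist d p u v"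
  define m where "m t = (\<Sum>u\<in>verts G. \<Sum>v\<in>verts G. \<bar>sq_dist d (q t) u v - sq_dist d p u v\<bar>)" for t
  have m0: "m t \<ge> 0" for t unfolding m_def by (intro sum_nonneg) auto
  have gap': "m t = 0" if "t \<in> {0..1}" "m t < \<epsilon>" for t
    unfolding m_def
  proof (rule gap)
    show "\<forall>u\<in>verts G. \<forall>v\<in>verts G. (u, v) \<notin> A \<longrightarrow> sq_dist d (q t) u v = sq_dist d p u v"
    proof (intro ballI impI)
      fix u v assume uv: "u \<in> verts G" "v \<in> verts G" "(u, v) \<notin> A"
      from A[OF this] show "sq_dist d (q t) u v = sq_dist d p u v"
        using len that(1) uv by (auto simp: sq_dist_self)
    qed
  qed (use that(2) in \<open>simp add: m_def\<close>)
  have cont: "continuous_on {0..1} m"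
    unfolding m_def sq_dist_def using q
    by (intro continuous_intros) (auto simp: continuous_motion_def)
  have "q 0 v i = p v i" if "v \<in> verts G" "i < d" for v i
    using q that by (auto simp: continuous_motion_def)
  then have "m 0 = 0" unfolding m_def sq_dist_def by simp
  have "m t = 0"
  proof (rule ccontr)
    assume "m t \<noteq> 0"
    then have "\<epsilon> \<le> m t" using gap'[OF t] by force
    then have "\<exists>x\<ge>0. x \<le> t \<and> m x = \<epsilon> / 2"
      using t \<open>\<epsilon> > 0\<close> \<open>m 0 = 0\<close> continuous_on_subset[OF cont] by (intro IVT') auto
    then obtain x where "0 \<le> x" "x \<le> t" "m x = \<epsilon> / 2" by blast
    then show False using gap'[of x] \<open>\<epsilon> > 0\<close> t by simp
  qed
  then have "(\<Sum>v\<in>verts G. \<bar>sq_dist d (q t) u v - sq_dist d p u v\<bar>) = 0"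
    using uv(1) fin unfolding m_def by (subst (asm) sum_nonneg_eq_0_iff) (auto intro: sum_nonneg)
  then show "sq_dist d (q t) u v = sq_dist d p u v"
    using uv(2) fin by (subst (asm) sum_nonneg_eq_0_iff) auto
qed

section \<open>Rigidity of generic placements with independent Gale vectors\<close>

context affine_base
begin

lemma rigid_place:
  assumes "verts G = V" and AV: "A \<subseteq> V \<times> V" and sym: "sym A"
    and A: "\<And>u v. u \<in> V \<Longrightarrow> v \<in> V \<Longrightarrow> (u, v) \<notin> A \<Longrightarrow> u = v \<or> {u, v} \<in> edges G"
    and c: "indep_products A Q (gale c)" and x: "algebraically_independent (V \<times> {..<d}) x"
  shows "rigid_framework d G (place x)"
proof -
  have fin: "finite A" using finite_subset[OF AV] finite_V by simp
  have ip: "indep_products A Q (gale (\<lambda>a j. x (a, j)))"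
  proof (rule indep_products_generic[OF fin sym x, where f = "\<lambda>v a x. gale (\<lambda>a j. x (a, j)) v a" and xs = "\<lambda>(a, j). c a j"])
    fix v a assume "v \<in> fst ` A" "a \<in> Q"
    then have "v \<in> V" "a \<in> V" using AV Q_subset by auto
    then show "(\<lambda>x. gale (\<lambda>a j. x (a, j)) v a) \<in> ratpoly (V \<times> {..<d})"
      unfolding gale_def using b_index_less[of v] ratpoly.const[of "- 1"] by (intro ratpoly_intros) auto
  qed (use c in simp)
  have "\<exists>z. \<forall>i<d. (\<Sum>j<d. z j * (x (b j, i) - x (b0, i))) = (if i = l then 1 else 0)" for l
    by (rule base_solve[OF x])
  then obtain z where z: "\<And>l i. i < d \<Longrightarrow> (\<Sum>j<d. z l j * (x (b j, i) - x (b0, i))) = (if i = l then 1 else 0)"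
    by metis
  \<comment> \<open>Weights on the frame that sum to 0 and map the placement to the unit vectors, as
    \<open>rigid_gap\<close> requires.\<close>
  define \<delta> where "\<delta> v l = (if v \<in> Q then 0 else if v = b0 then - (\<Sum>j<d. z l j) else z l (b_index v))" for v l
  have "\<exists>\<epsilon>>0. \<forall>q. (\<forall>u\<in>V. \<forall>v\<in>V. (u, v) \<notin> A \<longrightarrow> sq_dist d q u v = sq_dist d (place x) u v) \<longrightarrow>
    (\<Sum>u\<in>V. \<Sum>v\<in>V. \<bar>sq_dist d q u v - sq_dist d (place x) u v\<bar>) < \<epsilon> \<longrightarrow>
    (\<Sum>u\<in>V. \<Sum>v\<in>V. \<bar>sq_dist d q u v - sq_dist d (place x) u v\<bar>) = 0"
  proof (rule rigid_gap[OF finite_V AV sym finite_Q ip sum_gale sum_gale_place])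
    fix l assume "l < d"
    show "(\<Sum>v\<in>V. \<delta> v l) = 0" using b0 by (simp add: sum_V \<delta>_def)
    fix i assume i: "i < d"
    show "(\<Sum>v\<in>V. \<delta> v l * place x v i) = (if i = l then 1 else 0)"
      using z[OF i, of l] b0
      by (simp add: sum_V \<delta>_def place_def right_diff_distrib sum_subtractf sum_distrib_right)
  qed
  then obtain \<epsilon> where "\<epsilon> > 0" and gap: "\<And>q. (\<forall>u\<in>V. \<forall>v\<in>V. (u, v) \<notin> A \<longrightarrow> sq_dist d q u v = sq_dist d (place x) u v) \<Longrightarrow>
    (\<Sum>u\<in>V. \<Sum>v\<in>V. \<bar>sq_dist d q u v - sq_dist d (place x) u v\<bar>) < \<epsilon> \<Longrightarrow>
    (\<Sum>u\<in>V. \<Sum>v\<in>V. \<bar>sq_dist d q u v - sq_dist d (place x) u v\<bar>) = 0"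
    by blast
  then show ?thesis
    using A finite_V by (intro rigid_framework_if_gap[of G \<epsilon> A]) (simp_all add: assms(1))
qed

theorem generically_rigid_if_indep_products:
  assumes "verts G = V" and AV: "A \<subseteq> V \<times> V" and sym: "sym A"
    and A: "\<And>u v. u \<in> V \<Longrightarrow> v \<in> V \<Longrightarrow> (u, v) \<notin> A \<Longrightarrow> u = v \<or> {u, v} \<in> edges G"
    and ip: "indep_products A {..<card Q} y"
  shows "generically_rigid d G"
proof -
  have fin: "finite A" using finite_subset[OF AV] finite_V by simp
  obtain c where c: "indep_products A Q (gale c)"
    using ex_indep_gale[OF fin sym AV ip] by blast
  obtain x where x: "algebraically_independent (V \<times> {..<d}) x"
    using ex_algebraically_independent[of "V \<times> {..<d}"] finite_V by auto
  show ?thesis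
    unfolding generically_rigid_def assms(1)
    using generic_place[OF x] rigid_place[OF assms(1-4) c x] by blast
qed

end

section \<open>Flexes\<close>

text \<open>Picard iteration. On the ball of radius \<open>r\<close> the quadratic estimate makes
  \<open>G\<close> a contraction with factor 1/2, uniformly in \<open>s\<close>; comparing the
  equations for two parameters gives Lipschitz constant 2, hence continuity. Coordinate sums serve
  as the norm because \<open>E\<close> is a set, not a type.\<close>

lemma quadratic_fixed_point_path:
  fixes G :: "('e \<Rightarrow> real) \<Rightarrow> 'e \<Rightarrow> real"
  assumes E: "finite E" and e0: "e0 \<in> E" and G0: "\<And>e. e \<in> E \<Longrightarrow> G (\<lambda>_. 0) e = 0"
    and G: "\<And>z w e. e \<in> E \<Longrightarrow>
      \<bar>G z e - G w e\<bar> \<le> C * ((\<Sum>e\<in>E. \<bar>z e - w e\<bar>) * ((\<Sum>e\<in>E. \<bar>z e\<bar>) + (\<Sum>e\<in>E. \<bar>w e\<bar>)))"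
  shows "\<exists>s0>0. \<exists>z. (\<forall>s\<in>{0..s0}. \<forall>e\<in>E. z s e = (if e = e0 then s else 0) - G (z s) e)
    \<and> (\<forall>e\<in>E. continuous_on {0..s0} (\<lambda>s. z s e)) \<and> (\<forall>e\<in>E. z 0 e = 0)"
proof -
  define N where "N z = (\<Sum>e\<in>E. \<bar>z e\<bar>)" for z :: "'e \<Rightarrow> real"
  define D where "D z w = (\<Sum>e\<in>E. \<bar>z e - w e\<bar>)" for z w :: "'e \<Rightarrow> real"
  have N0: "N z \<ge> 0" and D0: "D z w \<ge> 0" for z w by (auto simp: N_def D_def intro: sum_nonneg)
  have coord: "\<bar>z e - w e\<bar> \<le> D z w" if "e \<in> E" for z w e
    unfolding D_def using E that by (intro member_le_sum[where f = "\<lambda>e. \<bar>z e - w e\<bar>"]) auto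
  define m where "m = real (card E)"
  have m: "m > 0" using E e0 by (auto simp: m_def card_gt_0_iff)
  \<comment> \<open>Positive whatever the sign of \<open>C\<close>.\<close>
  define C' where "C' = \<bar>C\<bar> + 1"
  have C': "C' > 0" by (simp add: C'_def)
  \<comment> \<open>Chosen so that \<open>m * C' * 2 * r = 1 / 2\<close>.\<close>
  define r where "r = 1 / (4 * m * C')"
  have r: "r > 0" using m C' by (simp add: r_def)
  have contr: "(\<Sum>e\<in>E. \<bar>G z e - G w e\<bar>) \<le> D z w / 2" if "N z \<le> r" "N w \<le> r" for z w
  proof -
    have "\<bar>G z e - G w e\<bar> \<le> C' * (D z w * (2 * r))" if e: "e \<in> E" for e
    proof -
      have "\<bar>G z e - G w e\<bar> \<le> C * (D z w * (N z + N w))"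
        using G[OF e, of z w] by (simp add: N_def D_def)
      also have "\<dots> \<le> C' * (D z w * (N z + N w))"
        using N0 D0 by (intro mult_right_mono) (auto simp: C'_def)
      also have "\<dots> \<le> C' * (D z w * (2 * r))"
        using \<open>N z \<le> r\<close> \<open>N w \<le> r\<close> C' D0 by (intro mult_left_mono) auto
      finally show ?thesis .
    qed
    then have "(\<Sum>e\<in>E. \<bar>G z e - G w e\<bar>) \<le> m * (C' * (D z w * (2 * r)))"
      unfolding m_def by (rule sum_abs_le_card)
    also have "\<dots> = D z w / 2" using m C' by (simp add: r_def field_simps)
    finally show ?thesis .
  qed
  define I where "I s e = (if e = e0 then s else 0)" for s :: real and e
  have I: "(\<Sum>e\<in>E. \<bar>I s e - I t e\<bar>) = \<bar>s - t\<bar>" for s t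
  proof -
    have "(\<Sum>e\<in>E. \<bar>I s e - I t e\<bar>) = (\<Sum>e\<in>E. if e = e0 then \<bar>s - t\<bar> else 0)"
      by (intro sum.cong) (auto simp: I_def)
    then show ?thesis using E e0 by simp
  qed
  have step: "D (\<lambda>e. I s e - G z e) (\<lambda>e. I t e - G w e) \<le> \<bar>s - t\<bar> + D z w / 2"
    if "N z \<le> r" "N w \<le> r" for s t z w
  proof -
    have "D (\<lambda>e. I s e - G z e) (\<lambda>e. I t e - G w e) \<le> (\<Sum>e\<in>E. \<bar>I s e - I t e\<bar> + \<bar>G z e - G w e\<bar>)"
      unfolding D_def by (intro sum_mono) linarith
    then show ?thesis using contr[OF that] by (simp add: sum.distrib I)
  qed
  have N_eq: "N z = D z (\<lambda>_. 0)" for z by (simp add: N_def D_def)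
  have N_zero: "N (\<lambda>_. 0) = 0" by (simp add: N_def)
  have stepN: "N (\<lambda>e. I s e - G z e) \<le> \<bar>s\<bar> + N z / 2" if "N z \<le> r" for s z
  proof -
    have "N (\<lambda>e. I s e - G z e) = D (\<lambda>e. I s e - G z e) (\<lambda>e. I 0 e - G (\<lambda>_. 0) e)"
      unfolding N_def D_def by (intro sum.cong) (auto simp: I_def G0)
    also have "\<dots> \<le> \<bar>s\<bar> + N z / 2" using step[OF that, of "\<lambda>_. 0" s 0] r by (simp add: N_eq[symmetric] N_zero)
    finally show ?thesis .
  qed
  \<comment> \<open>Then \<open>\<bar>s\<bar> + r / 2 \<le> r\<close>, which keeps all iterates in
    the ball.\<close>
  define s0 where "s0 = r / 2"
  define Z where "Z s = rec_nat (\<lambda>_. 0) (\<lambda>_ z e. I s e - G z e)" for s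
  have Z0: "Z s 0 = (\<lambda>_. 0)" and ZS: "Z s (Suc j) = (\<lambda>e. I s e - G (Z s j) e)" for s j
    by (simp_all add: Z_def)
  have ZN: "N (Z s j) \<le> r" if "s \<in> {0..s0}" for s j
  proof (induction j)
    case 0
    then show ?case using r by (simp add: Z0 N_zero)
  next
    case (Suc j)
    have "N (Z s (Suc j)) \<le> \<bar>s\<bar> + N (Z s j) / 2" unfolding ZS by (rule stepN[OF Suc])
    then show ?case using Suc that by (simp add: s0_def)
  qed
  have ZD: "D (Z s (Suc j)) (Z s j) \<le> r * (1 / 2) ^ j" if "s \<in> {0..s0}" for s j
  proof (induction j)
    case 0
    show ?case using ZN[OF that, of "Suc 0"] by (simp add: Z0 N_eq)
  next
    case (Suc j)
    have "D (\<lambda>e. I s e - G (Z s (Suc j)) e) (\<lambda>e. I s e - G (Z s j) e) \<le> \<bar>s - s\<bar> + D (Z s (Suc j)) (Z s j) / 2"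
      by (rule step[OF ZN[OF that] ZN[OF that]])
    then show ?case using Suc unfolding ZS[symmetric] by simp
  qed
  define z where "z s e = lim (\<lambda>j. Z s j e)" for s e
  have lim: "(\<lambda>j. Z s j e) \<longlonglongrightarrow> z s e" if s: "s \<in> {0..s0}" and e: "e \<in> E" for s e
  proof -
    have "summable (\<lambda>j. Z s (Suc j) e - Z s j e)"
    proof (rule summable_comparison_test')
      show "summable (\<lambda>j. r * (1 / 2 :: real) ^ j)" by (intro summable_mult summable_geometric) simp
      show "norm (Z s (Suc j) e - Z s j e) \<le> r * (1 / 2) ^ j" for j
        using coord[OF e, of "Z s (Suc j)" "Z s j"] ZD[OF s, of j] by simp
    qed
    then have "(\<lambda>n. \<Sum>j<n. Z s (Suc j) e - Z s j e) \<longlonglongrightarrow> suminf (\<lambda>j. Z s (Suc j) e - Z s j e)"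
      by (rule summable_LIMSEQ)
    then have "convergent (\<lambda>n. Z s n e)"
      using sum_lessThan_telescope[of "\<lambda>j. Z s j e"] by (auto simp: Z0 convergent_def)
    then show ?thesis unfolding z_def by (simp add: convergent_LIMSEQ_iff)
  qed
  have zN: "N (z s) \<le> r" if s: "s \<in> {0..s0}" for s
  proof (rule LIMSEQ_le_const2)
    show "(\<lambda>j. N (Z s j)) \<longlonglongrightarrow> N (z s)"
      unfolding N_def by (intro tendsto_intros lim s)
  qed (use ZN s in auto)
  have zD: "(\<lambda>j. D (Z s j) (z s)) \<longlonglongrightarrow> 0" if s: "s \<in> {0..s0}" for s
  proof -
    have "(\<lambda>j. D (Z s j) (z s)) \<longlonglongrightarrow> D (z s) (z s)"
      unfolding D_def by (intro tendsto_intros lim s)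
    then show ?thesis by (simp add: D_def)
  qed
  have eq: "z s e = I s e - G (z s) e" if s: "s \<in> {0..s0}" and e: "e \<in> E" for s e
  proof -
    have "(\<lambda>j. Z s (Suc j) e - (I s e - G (z s) e)) \<longlonglongrightarrow> 0"
    proof (rule Lim_null_comparison[OF always_eventually zD[OF s]], rule allI)
      fix j
      have "\<bar>Z s (Suc j) e - (I s e - G (z s) e)\<bar> \<le> D (\<lambda>e. I s e - G (Z s j) e) (\<lambda>e. I s e - G (z s) e)"
        using coord[OF e, of "Z s (Suc j)" "\<lambda>e. I s e - G (z s) e"] by (simp add: ZS)
      also have "\<dots> \<le> D (Z s j) (z s)"
        using step[OF ZN[OF s, of j] zN[OF s], of s s] D0[of "Z s j" "z s"] by simp
      finally show "norm (Z s (Suc j) e - (I s e - G (z s) e)) \<le> D (Z s j) (z s)" by simp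
    qed
    then have "(\<lambda>j. Z s (Suc j) e) \<longlonglongrightarrow> I s e - G (z s) e" by (simp add: LIM_zero_iff)
    then show ?thesis using LIMSEQ_unique LIMSEQ_Suc[OF lim[OF s e]] by blast
  qed
  have lip: "D (z s) (z t) \<le> 2 * \<bar>s - t\<bar>" if "s \<in> {0..s0}" "t \<in> {0..s0}" for s t
  proof -
    have "D (z s) (z t) = D (\<lambda>e. I s e - G (z s) e) (\<lambda>e. I t e - G (z t) e)"
      unfolding D_def by (intro sum.cong refl) (simp only: eq[OF that(1)] eq[OF that(2)])
    also have "\<dots> \<le> \<bar>s - t\<bar> + D (z s) (z t) / 2" by (intro step zN that)
    finally show ?thesis by simp
  qed
  have "continuous_on {0..s0} (\<lambda>s. z s e)" if e: "e \<in> E" for e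
  proof (rule lipschitz_on_continuous_on[of 2])
    show "2-lipschitz_on {0..s0} (\<lambda>s. z s e)"
    proof (rule lipschitz_onI)
      fix s t assume "s \<in> {0..s0}" "t \<in> {0..s0}"
      then show "dist (z s e) (z t e) \<le> 2 * dist s t"
        using coord[OF e, of "z s" "z t"] lip[of s t] by (simp add: dist_real_def)
    qed simp
  qed
  moreover have "s0 > 0" using r by (simp add: s0_def)
  moreover have "z 0 e = 0" if "e \<in> E" for e
  proof -
    have 0: "0 \<in> {0..s0}" using \<open>s0 > 0\<close> by simp
    have "N (z 0) = N (\<lambda>e. I 0 e - G (z 0) e)"
      unfolding N_def by (intro sum.cong refl arg_cong[where f = abs] eq 0)
    also have "\<dots> \<le> N (z 0) / 2" using stepN[OF zN[OF 0], of 0] by simp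
    finally have "N (z 0) = 0" using N0[of "z 0"] by simp
    then show ?thesis using coord[OF that, of "z 0" "\<lambda>_. 0"] by (simp add: N_eq)
  qed
  ultimately show ?thesis
    using eq unfolding I_def by (intro exI[of _ s0] conjI exI[of _ z]) auto
qed

text \<open>\<open>Inl\<close> rows form the rigidity matrix; the sum over the edge avoids choosing
  an orientation, its term at \<open>fst wi\<close> being 0. \<open>Inr\<close> rows pin a single
  coordinate.\<close>

primrec rigidity_row :: "('v \<Rightarrow> nat \<Rightarrow> real) \<Rightarrow> 'v set + 'v \<times> nat \<Rightarrow> 'v \<times> nat \<Rightarrow> real" where
  "rigidity_row p (Inl e) wi =
     (if fst wi \<in> e then \<Sum>v\<in>e. p (fst wi) (snd wi) - p v (snd wi) else 0)"
| "rigidity_row p (Inr \<pi>) wi = (if wi = \<pi> then 1 else 0)"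

lemma sum_rigidity_row_edge:
  assumes "finite V" "u \<in> V" "v \<in> V" "u \<noteq> v"
  shows "(\<Sum>wi\<in>V \<times> {..<d}. rigidity_row p (Inl {u, v}) wi * x wi)
    = (\<Sum>i<d. (p u i - p v i) * (x (u, i) - x (v, i)))"
proof -
  have "(\<Sum>wi\<in>V \<times> {..<d}. rigidity_row p (Inl {u, v}) wi * x wi)
      = (\<Sum>w\<in>V. \<Sum>i<d. rigidity_row p (Inl {u, v}) (w, i) * x (w, i))"
    unfolding sum.cartesian_product by (intro sum.cong) auto
  also have "\<dots> = (\<Sum>w\<in>{u, v}. \<Sum>i<d. rigidity_row p (Inl {u, v}) (w, i) * x (w, i))"
    using assms by (intro sum.mono_neutral_right) auto
  also have "\<dots> = (\<Sum>i<d. (p u i - p v i) * (x (u, i) - x (v, i)))"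
    using assms(4) by (simp add: sum.distrib[symmetric] algebra_simps)
  finally show ?thesis .
qed

lemma sum_rigidity_row_pin:
  assumes "finite V" "\<pi> \<in> V \<times> {..<d}"
  shows "(\<Sum>wi\<in>V \<times> {..<d}. rigidity_row p (Inr \<pi>) wi * x wi) = x \<pi>"
proof -
  have "(\<Sum>wi\<in>V \<times> {..<d}. rigidity_row p (Inr \<pi>) wi * x wi) = (\<Sum>wi\<in>V \<times> {..<d}. if wi = \<pi> then x wi else 0)"
    by (intro sum.cong) auto
  then show ?thesis using assms by simp
qed

text \<open>First-order counterpart of \<open>sum_weighted_sq_dist\<close>: after expansion each of
  the four products contains a factor that vanishes by hypothesis.\<close>

lemma sum_affine_dependency_motion:
  fixes \<alpha> \<beta> :: "'v \<Rightarrow> real"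
  assumes "(\<Sum>v\<in>V. \<alpha> v) = 0" "(\<Sum>v\<in>V. \<beta> v) = 0"
    and "\<And>i. i < d \<Longrightarrow> (\<Sum>v\<in>V. \<alpha> v * p v i) = 0" "\<And>i. i < d \<Longrightarrow> (\<Sum>v\<in>V. \<beta> v * p v i) = 0"
  shows "(\<Sum>u\<in>V. \<Sum>v\<in>V. (\<Sum>i<d. (p u i - p v i) * (x (u, i) - x (v, i))) * (\<alpha> u * \<beta> v)) = (0 :: real)"
proof -
  have 1: "(\<Sum>u\<in>V. \<Sum>v\<in>V. (p u i - p v i) * (x (u, i) - x (v, i)) * (\<alpha> u * \<beta> v)) = 0" if "i < d" for i
  proof -
    have "(\<Sum>u\<in>V. \<Sum>v\<in>V. (p u i - p v i) * (x (u, i) - x (v, i)) * (\<alpha> u * \<beta> v))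
        = (\<Sum>u\<in>V. \<Sum>v\<in>V. (\<alpha> u * p u i * x (u, i)) * \<beta> v - (\<alpha> u * p u i) * (\<beta> v * x (v, i))
            - (\<alpha> u * x (u, i)) * (\<beta> v * p v i) + \<alpha> u * (\<beta> v * p v i * x (v, i)))"
      by (intro sum.cong refl) (simp add: algebra_simps)
    also have "\<dots> = (\<Sum>u\<in>V. \<alpha> u * p u i * x (u, i)) * (\<Sum>v\<in>V. \<beta> v) - (\<Sum>u\<in>V. \<alpha> u * p u i) * (\<Sum>v\<in>V. \<beta> v * x (v, i))
        - (\<Sum>u\<in>V. \<alpha> u * x (u, i)) * (\<Sum>v\<in>V. \<beta> v * p v i) + (\<Sum>u\<in>V. \<alpha> u) * (\<Sum>v\<in>V. \<beta> v * p v i * x (v, i))"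
      by (simp only: sum.distrib sum_subtractf sum_product)
    finally show ?thesis using assms that by simp
  qed
  have "(\<Sum>u\<in>V. \<Sum>v\<in>V. (\<Sum>i<d. (p u i - p v i) * (x (u, i) - x (v, i))) * (\<alpha> u * \<beta> v))
      = (\<Sum>u\<in>V. \<Sum>i<d. \<Sum>v\<in>V. (p u i - p v i) * (x (u, i) - x (v, i)) * (\<alpha> u * \<beta> v))"
    unfolding sum_distrib_right by (intro sum.cong refl, rule sum.swap)
  also have "\<dots> = (\<Sum>i<d. \<Sum>u\<in>V. \<Sum>v\<in>V. (p u i - p v i) * (x (u, i) - x (v, i)) * (\<alpha> u * \<beta> v))"
    by (rule sum.swap)
  also have "\<dots> = 0" using 1 by simp
  finally show ?thesis .
qed

text \<open>Along \<open>q = p + X z\<close> with dual velocities \<open>\<xi>\<close> the squared length of an edge \<open>e\<close> changes by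
  \<open>2 z\<^sub>e\<close> plus a quadratic term, so prescribing all squared lengths is a fixed point problem for \<open>z\<close>.\<close>

lemma flex_if_dual_velocities:
  fixes p :: "'v \<Rightarrow> nat \<Rightarrow> real"
  assumes V: "finite V" and E: "E \<subseteq> all_pairs V" and e0: "e0 \<in> E"
    and \<xi>: "\<forall>e\<in>E. \<forall>u v. {u, v} \<in> E \<longrightarrow>
      (\<Sum>i<d. (p u i - p v i) * (\<xi> e (u, i) - \<xi> e (v, i))) = (if {u, v} = e then 1 else 0 :: real)"
  shows "\<exists>q :: real \<Rightarrow> 'v \<Rightarrow> nat \<Rightarrow> real. (\<forall>v\<in>V. \<forall>i<d. continuous_on {0..1} (\<lambda>t. q t v i) \<and> q 0 v i = p v i) \<and>
    (\<forall>t\<in>{0..1}. \<forall>u v. {u, v} \<in> E \<longrightarrow> {u, v} \<noteq> e0 \<longrightarrow> sq_dist d (q t) u v = sq_dist d p u v) \<and>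
    (\<forall>u v. {u, v} = e0 \<longrightarrow> sq_dist d (q 1) u v \<noteq> sq_dist d p u v)"
proof -
  have "E \<subseteq> Pow V" using E by (auto simp: all_pairs_def)
  then have finE: "finite E" using V finite_subset by blast
  have pair: "u \<in> V \<and> v \<in> V \<and> u \<noteq> v" if "{u, v} \<in> E" for u v
    using that E by (auto simp: all_pairs_def subset_iff card_insert_if split: if_splits)
  define X where "X z v i = (\<Sum>e\<in>E. z e * \<xi> e (v, i))" for z :: "'v set \<Rightarrow> real" and v i
  \<comment> \<open>The double sum over an edge counts its squared length twice, so
    \<open>2 * G z e\<close> is the squared length in \<open>X z\<close>, written without orienting
    \<open>e\<close>.\<close>
  define G where "G z e = (\<Sum>u\<in>e. \<Sum>v\<in>e. sq_dist d (X z) u v) / 4" for z e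
  have G_eq: "2 * G z {u, v} = sq_dist d (X z) u v" if "{u, v} \<in> E" for z u v
    using pair[OF that] by (simp add: G_def sq_dist_self sq_dist_commute[of d _ v u])
  have q_eq: "sq_dist d (\<lambda>v i. p v i + X z v i) u v = sq_dist d p u v + 2 * (z {u, v} + G z {u, v})"
    if uv: "{u, v} \<in> E" for z u v
  proof -
    have "(\<Sum>i<d. (p u i - p v i) * (X z u i - X z v i))
        = (\<Sum>i<d. \<Sum>e\<in>E. z e * ((p u i - p v i) * (\<xi> e (u, i) - \<xi> e (v, i))))"
      unfolding X_def sum_subtractf[symmetric] sum_distrib_left
      by (intro sum.cong refl) (simp add: algebra_simps)
    also have "\<dots> = (\<Sum>e\<in>E. z e * (\<Sum>i<d. (p u i - p v i) * (\<xi> e (u, i) - \<xi> e (v, i))))"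
      by (subst sum.swap) (simp add: sum_distrib_left)
    also have "\<dots> = (\<Sum>e\<in>E. if e = {u, v} then z e else 0)"
      using \<xi> uv by (intro sum.cong refl) auto
    also have "\<dots> = z {u, v}" using finE uv by simp
    finally have lin: "(\<Sum>i<d. (p u i - p v i) * (X z u i - X z v i)) = z {u, v}" .
    have "sq_dist d (\<lambda>v i. p v i + X z v i) u v
        = (\<Sum>i<d. (p u i - p v i)\<^sup>2 + 2 * ((p u i - p v i) * (X z u i - X z v i)) + (X z u i - X z v i)\<^sup>2)"
      unfolding sq_dist_def by (intro sum.cong refl) (simp add: power2_eq_square algebra_simps)
    also have "\<dots> = sq_dist d p u v + 2 * z {u, v} + sq_dist d (X z) u v"
      by (simp add: sum.distrib sum_distrib_left[symmetric] lin sq_dist_def)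
    finally show ?thesis using G_eq[OF uv, of z] by simp
  qed
  define K where "K = 2 * (\<Sum>t\<in>E \<times> (V \<times> {..<d}). \<bar>\<xi> (fst t) (snd t)\<bar>)"
  have K: "\<bar>\<xi> e (u, i) - \<xi> e (v, i)\<bar> \<le> K" if "e \<in> E" "u \<in> V" "v \<in> V" "i < d" for e u v i
  proof -
    have "\<bar>\<xi> e (w, i)\<bar> \<le> K / 2" if "w \<in> V" for w
      using member_le_sum[of "(e, (w, i))" "E \<times> (V \<times> {..<d})" "\<lambda>t. \<bar>\<xi> (fst t) (snd t)\<bar>"]
        that \<open>e \<in> E\<close> \<open>i < d\<close> finE V by (simp add: K_def)
    from this[of u] this[of v] show ?thesis using that by linarith
  qed
  have "K \<ge> 0" unfolding K_def by (intro mult_nonneg_nonneg sum_nonneg) auto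
  have lin_bound: "\<bar>\<Sum>e\<in>E. g e * (\<xi> e (u, i) - \<xi> e (v, i))\<bar> \<le> K * (\<Sum>e\<in>E. \<bar>g e\<bar>)"
    if "u \<in> V" "v \<in> V" "i < d" for g u v i
  proof -
    have "\<bar>\<Sum>e\<in>E. g e * (\<xi> e (u, i) - \<xi> e (v, i))\<bar> \<le> (\<Sum>e\<in>E. \<bar>g e\<bar> * K)"
      using K that by (intro order_trans[OF sum_abs] sum_mono) (auto simp: abs_mult intro!: mult_left_mono)
    then show ?thesis by (simp add: sum_distrib_left mult.commute)
  qed
  have diff: "X z u i - X z v i = (\<Sum>e\<in>E. z e * (\<xi> e (u, i) - \<xi> e (v, i)))" for z u v i
    by (simp add: X_def sum_subtractf[symmetric] right_diff_distrib)
  have G_bound: "\<bar>G z e - G w e\<bar> \<le> real d * K\<^sup>2 * ((\<Sum>e\<in>E. \<bar>z e - w e\<bar>) * ((\<Sum>e\<in>E. \<bar>z e\<bar>) + (\<Sum>e\<in>E. \<bar>w e\<bar>)))"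
    (is "_ \<le> _ * (?D * ?S)") if e: "e \<in> E" for z w e
  proof -
    have sq: "\<bar>sq_dist d (X z) u v - sq_dist d (X w) u v\<bar> \<le> real d * (K\<^sup>2 * (?D * ?S))"
      if uv: "u \<in> V" "v \<in> V" for u v
    proof -
      have "\<bar>(X z u i - X z v i)\<^sup>2 - (X w u i - X w v i)\<^sup>2\<bar> \<le> K\<^sup>2 * (?D * ?S)" if i: "i < d" for i
      proof -
        have a: "\<bar>(X z u i - X z v i) - (X w u i - X w v i)\<bar> \<le> K * ?D"
          using lin_bound[OF uv i, of "\<lambda>e. z e - w e"]
          by (simp add: diff sum_subtractf[symmetric] left_diff_distrib)
        have b: "\<bar>(X z u i - X z v i) + (X w u i - X w v i)\<bar> \<le> K * ?S"
          using lin_bound[OF uv i, of z] lin_bound[OF uv i, of w] by (simp add: diff distrib_left)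
        have "\<bar>(X z u i - X z v i)\<^sup>2 - (X w u i - X w v i)\<^sup>2\<bar>
            = \<bar>(X z u i - X z v i) - (X w u i - X w v i)\<bar> * \<bar>(X z u i - X z v i) + (X w u i - X w v i)\<bar>"
          unfolding abs_mult[symmetric] by (simp add: power2_eq_square algebra_simps)
        also have "\<dots> \<le> (K * ?D) * (K * ?S)"
          using a b \<open>K \<ge> 0\<close> by (intro mult_mono) (auto intro: sum_nonneg mult_nonneg_nonneg)
        finally show ?thesis by (simp add: power2_eq_square mult_ac)
      qed
      then have "(\<Sum>i<d. \<bar>(X z u i - X z v i)\<^sup>2 - (X w u i - X w v i)\<^sup>2\<bar>) \<le> card {..<d} * (K\<^sup>2 * (?D * ?S))"
        by (intro sum_abs_le_card) auto
      moreover have "\<bar>sq_dist d (X z) u v - sq_dist d (X w) u v\<bar>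
          \<le> (\<Sum>i<d. \<bar>(X z u i - X z v i)\<^sup>2 - (X w u i - X w v i)\<^sup>2\<bar>)"
        unfolding sq_dist_def sum_subtractf[symmetric] by (rule sum_abs)
      ultimately show ?thesis unfolding card_lessThan by (rule order_trans[rotated])
    qed
    have "card e = 2" using e E by (auto simp: all_pairs_def)
    then obtain u v where uv: "e = {u, v}" by (metis card_2_iff)
    have "2 * \<bar>G z e - G w e\<bar> = \<bar>sq_dist d (X z) u v - sq_dist d (X w) u v\<bar>"
    proof -
      have "2 * (G z e - G w e) = sq_dist d (X z) u v - sq_dist d (X w) u v"
        using G_eq[of u v z] G_eq[of u v w] e unfolding uv by (simp add: right_diff_distrib)
      then show ?thesis by (metis abs_mult abs_numeral)
    qed
    also have "\<dots> \<le> real d * (K\<^sup>2 * (?D * ?S))" using sq pair e unfolding uv by blast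
    finally have "2 * \<bar>G z e - G w e\<bar> \<le> real d * (K\<^sup>2 * (?D * ?S))" .
    moreover have "a \<le> b" if "2 * a \<le> b" "0 \<le> a" for a b :: real using that by linarith
    ultimately show ?thesis unfolding mult.assoc using abs_ge_zero by blast
  qed
  have G0: "G (\<lambda>_. 0) e = 0" for e by (simp add: G_def X_def sq_dist_def)
  have "\<exists>s0>0. \<exists>z. (\<forall>s\<in>{0..s0}. \<forall>e\<in>E. z s e = (if e = e0 then s else 0) - G (z s) e)
    \<and> (\<forall>e\<in>E. continuous_on {0..s0} (\<lambda>s. z s e)) \<and> (\<forall>e\<in>E. z 0 e = 0)"
    by (rule quadratic_fixed_point_path[where G = G, OF finE e0 G0 G_bound])
  then obtain s0 z where s0: "s0 > 0" and z: "\<And>s e. s \<in> {0..s0} \<Longrightarrow> e \<in> E \<Longrightarrow> z s e = (if e = e0 then s else 0) - G (z s) e"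
    and cont: "\<And>e. e \<in> E \<Longrightarrow> continuous_on {0..s0} (\<lambda>s. z s e)" and z0: "\<And>e. e \<in> E \<Longrightarrow> z 0 e = 0"
    by blast
  \<comment> \<open>Rescales time to the unit interval; at time 1 the squared length of
    \<open>e0\<close> has changed by \<open>2 * s0\<close>.\<close>
  define q where "q t v i = p v i + X (z (t * s0)) v i" for t v i
  have sq: "sq_dist d (q t) u v = sq_dist d p u v + (if {u, v} = e0 then 2 * (t * s0) else 0)"
    if "t \<in> {0..1}" "{u, v} \<in> E" for t u v
  proof -
    have "t * s0 \<in> {0..s0}" using that(1) s0 by (auto simp: mult_le_cancel_right1)
    from z[OF this that(2)] q_eq[OF that(2), of "z (t * s0)"] show ?thesis
      unfolding q_def by simp
  qed
  have "continuous_on {0..1} (\<lambda>t. q t v i)" for v i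
  proof -
    have "continuous_on {0..1} (\<lambda>t. z (t * s0) e)" if "e \<in> E" for e
      by (rule continuous_on_compose2[OF cont[OF that]])
        (use s0 in \<open>auto intro!: continuous_intros simp: mult_le_cancel_right1\<close>)
    then show ?thesis unfolding q_def X_def by (intro continuous_intros) auto
  qed
  moreover have "q 0 v i = p v i" for v i
    by (simp add: q_def X_def z0)
  moreover have "sq_dist d (q 1) u v \<noteq> sq_dist d p u v" if "{u, v} = e0" for u v
    using sq[of 1 u v] that e0 s0 by simp
  moreover have "sq_dist d (q t) u v = sq_dist d p u v" if "t \<in> {0..1}" "{u, v} \<in> E" "{u, v} \<noteq> e0" for t u v
    using sq[OF that(1,2)] that(3) by simp
  ultimately show ?thesis by - (rule exI[of _ q], blast)
qed

definition edge_set :: "('v \<times> 'v) set \<Rightarrow> 'v set set" where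
  "edge_set A = (\<lambda>(u, v). {u, v}) ` A"

definition non_arcs :: "'v set \<Rightarrow> ('v \<times> 'v) set \<Rightarrow> ('v \<times> 'v) set" where
  "non_arcs V A = V \<times> V - Id - A"

lemma in_edge_set_iff: "sym A \<Longrightarrow> {u, v} \<in> edge_set A \<longleftrightarrow> (u, v) \<in> A"
  by (auto simp: edge_set_def doubleton_eq_iff dest: symD)

lemma card_non_arcs:
  assumes "finite V" "A \<subseteq> V \<times> V" "irrefl A"
  shows "card (non_arcs V A) + card A + card V = card V * card V"
proof -
  have fin: "finite A" "finite (non_arcs V A)" using assms finite_subset by (auto simp: non_arcs_def)
  have "V \<times> V = (non_arcs V A \<union> A) \<union> (\<lambda>v. (v, v)) ` V"
    using assms by (auto simp: non_arcs_def irrefl_def)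
  then have "card (V \<times> V) = card ((non_arcs V A \<union> A) \<union> (\<lambda>v. (v, v)) ` V)" by simp
  also have "\<dots> = card (non_arcs V A \<union> A) + card ((\<lambda>v. (v, v)) ` V)"
    using fin assms by (intro card_Un_disjoint) (auto simp: non_arcs_def irrefl_def)
  also have "card (non_arcs V A \<union> A) = card (non_arcs V A) + card A"
    using fin by (intro card_Un_disjoint) (auto simp: non_arcs_def)
  also have "card ((\<lambda>v. (v, v)) ` V) = card V" by (intro card_image) (auto simp: inj_on_def)
  finally show ?thesis by (simp add: card_cartesian_product)
qed

section \<open>Pinned rigidity matrices and dual velocities\<close>

context affine_base
begin

text \<open>All coordinates of \<open>b0\<close>, and coordinate \<open>l\<close> of
  \<open>b j\<close> for \<open>j < l\<close>: one pin for each of the \<open>d (d + 1) / 2\<close>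
  independent infinitesimal isometries, translations first, then skew-symmetric matrices.\<close>

definition pins :: "('v \<times> nat) set" where
  "pins = {b0} \<times> {..<d} \<union> (\<lambda>(l, j). (b j, l)) ` (SIGMA l:{..<d}. {..<l})"

lemma pins_subset: "pins \<subseteq> V \<times> {..<d}"
  using b0 by (auto simp: pins_def)

lemma card_pins: "2 * card pins \<le> d * Suc d"
proof -
  have "card pins \<le> card ({b0} \<times> {..<d}) + card ((\<lambda>(l, j). (b j, l)) ` (SIGMA l:{..<d}. {..<l}))"
    unfolding pins_def by (rule card_Un_le)
  also have "card ((\<lambda>(l, j). (b j, l)) ` (SIGMA l:{..<d}. {..<l})) \<le> card (SIGMA l:{..<d}. {..<l})"
    by (intro card_image_le) auto
  also have "card (SIGMA l:{..<d}. {..<l}) = (\<Sum>l<d. l)" by simp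
  finally have "card pins \<le> d + (\<Sum>l<d. l)" by (simp add: card_cartesian_product)
  moreover have "2 * (\<Sum>l<d. l) + d = d * d" by (induction d) auto
  ultimately show ?thesis by simp
qed

text \<open>The first-order length changes \<open>L\<close> of a kernel vector vanish off
  \<open>A\<close> by the edge rows, and on \<open>A\<close> because they form a symmetric relation
  between products of Gale vectors. So the vector is an infinitesimal isometry, and the pins at a
  standard frame leave only 0.\<close>

lemma pinned_system_injective_at_gale:
  assumes AV: "A \<subseteq> V \<times> V" and c: "indep_products A Q (gale c)"
    and p: "\<And>v i. p v i = (if v \<in> Q then c v i else if v = b0 then 0 else if i = b_index v then 1 else 0)"
  shows "injective_system (Inl ` edge_set (non_arcs V A) \<union> Inr ` pins) (V \<times> {..<d}) (rigidity_row p)"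
proof (rule injective_systemI)
  fix x wi
  assume 0: "\<And>r. r \<in> Inl ` edge_set (non_arcs V A) \<union> Inr ` pins \<Longrightarrow>
      (\<Sum>wi\<in>V \<times> {..<d}. rigidity_row p r wi * x wi) = 0"
    and wi: "wi \<in> V \<times> {..<d}"
  define L where "L u v = (\<Sum>i<d. (p u i - p v i) * (x (u, i) - x (v, i)))" for u v
  have L_sym: "L u v = L v u" for u v
    unfolding L_def by (intro sum.cong refl) (simp add: algebra_simps)
  have L1: "L u v = 0" if "u \<in> V" "v \<in> V" "(u, v) \<notin> A" for u v
  proof (cases "u = v")
    case False
    then have "{u, v} \<in> edge_set (non_arcs V A)"
      using that by (force simp: edge_set_def non_arcs_def)
    then show ?thesis
      using 0[of "Inl {u, v}"] sum_rigidity_row_edge[OF finite_V that(1,2) False, where p = p and x = x and d = d]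
      by (simp add: L_def del: rigidity_row.simps)
  qed (simp add: L_def)
  have dep: "(\<Sum>v\<in>V. gale c v a * p v i) = 0" if "a \<in> Q" "i < d" for a i
  proof -
    have "(\<Sum>v\<in>Q. gale c v a * p v i) = (\<Sum>v\<in>Q. if v = a then c v i else 0)"
      by (intro sum.cong) (auto simp: gale_def p)
    also have "\<dots> = c a i" using that finite_Q by simp
    moreover have "(\<Sum>j<d. gale c (b j) a * p (b j) i) = (\<Sum>j<d. if j = i then - c a j else 0)"
      by (intro sum.cong) (auto simp: gale_def p)
    ultimately show ?thesis using that b0 by (simp add: sum_V p)
  qed
  have L2: "L u v = 0" if "(u, v) \<in> A" for u v
  proof (rule indep_productsD[OF c L_sym _ that])
    fix a a' assume a: "a \<in> Q" "a' \<in> Q"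
    have "(\<Sum>(u, v)\<in>A. L u v * (gale c u a * gale c v a'))
        = (\<Sum>u\<in>V. \<Sum>v\<in>V. L u v * (gale c u a * gale c v a'))"
      unfolding sum.cartesian_product using AV finite_V L1
      by (intro sum.mono_neutral_left) auto
    also have "\<dots> = 0"
      unfolding L_def by (rule sum_affine_dependency_motion) (use a sum_gale dep in auto)
    finally show "(\<Sum>(u, v)\<in>A. L u v * (gale c u a * gale c v a')) = 0" .
  qed
  have L: "L u v = 0" if "u \<in> V" "v \<in> V" for u v
    using L1 L2 that by blast
  have pin: "x \<pi> = 0" if "\<pi> \<in> pins" for \<pi>
    using 0[of "Inr \<pi>"] that sum_rigidity_row_pin[OF finite_V, of \<pi> d p x] pins_subset
    by (auto simp del: rigidity_row.simps)
  have x0: "x (b0, i) = 0" if "i < d" for i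
    using that by (intro pin) (simp add: pins_def)
  have p0: "p b0 i = 0" for i using b0 by (simp add: p)
  have pb: "p (b j) i = (if i = j then 1 else 0)" if "j < d" for i j
    using that by (simp add: p)
  have Lb0: "L v b0 = (\<Sum>i<d. p v i * x (v, i))" for v
    unfolding L_def by (intro sum.cong) (auto simp: p0 x0)
  have pbx: "(\<Sum>i<d. p (b j) i * g i) = g j" if "j < d" for j and g :: "nat \<Rightarrow> real"
    using that by (simp add: pb if_distrib[where f = "\<lambda>c. c * _"] cong: if_cong)
  have Lb: "L v (b j) = L v b0 - (\<Sum>i<d. p v i * x (b j, i)) - x (v, j) + x (b j, j)" if "j < d" for v j
    unfolding Lb0 unfolding L_def
    by (simp add: left_diff_distrib right_diff_distrib sum_subtractf pbx that)
  have xjj: "x (b j, j) = 0" if "j < d" for j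
    using L[of "b j" b0] b0 that by (simp add: Lb0 pbx)
  have upper: "x (b j, l) = 0" if "j < l" "l < d" for j l
    using that by (intro pin) (force simp: pins_def)
  \<comment> \<open>\<open>L (b l) (b j) = 0\<close> makes the velocities of the frame
    skew-symmetric, so the pinned half determines the other.\<close>
  have xb: "x (b j, l) = 0" if "j < d" "l < d" for j l
  proof (cases j l rule: linorder_cases)
    case greater
    have "L (b l) (b j) = 0" using L that by simp
    then show ?thesis
      using that L[of "b l" b0] b0 upper[of l j] greater xjj by (simp add: Lb pbx)
  qed (use that upper xjj in auto)
  \<comment> \<open>Comparing \<open>L\<close> against \<open>b j\<close> and against
    \<open>b0\<close> isolates one coordinate of the velocity at \<open>v\<close>.\<close>
  have xv: "x (v, j) = 0" if "v \<in> V" "j < d" for v j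
    using L[of v "b j"] L[of v b0] b0 that by (simp add: Lb xb)
  then show "x wi = 0" using wi by auto
qed

text \<open>As many pins as there are trivial infinitesimal motions make the system square, so that at
  generic positions it is not only injective but also surjective.\<close>

lemma ex_dual_velocities:
  assumes AV: "A \<subseteq> V \<times> V" and sym: "sym A" and irrefl: "irrefl A" and c: "indep_products A Q (gale c)"
    and cardA: "card A = card Q * Suc (card Q)" and p: "generic d V p" and e: "e \<in> edge_set (non_arcs V A)"
  shows "\<exists>\<xi>. \<forall>u v. {u, v} \<in> edge_set (non_arcs V A) \<longrightarrow>
    (\<Sum>i<d. (p u i - p v i) * (\<xi> (u, i) - \<xi> (v, i))) = (if {u, v} = e then 1 else 0 :: real)"
proof -
  define E where "E = edge_set (non_arcs V A)"
  have symN: "sym (non_arcs V A)" using sym by (auto simp: non_arcs_def sym_def)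
  have finN: "finite (non_arcs V A)" using finite_V by (simp add: non_arcs_def)
  have finE: "finite E" using finN by (simp add: E_def edge_set_def)
  have finP: "finite pins" using pins_subset finite_V finite_subset by blast
  have EV: "x \<subseteq> V" if "x \<in> E" for x
    using that by (auto simp: E_def edge_set_def non_arcs_def)
  define ps where "ps = (\<lambda>(v, i). if v \<in> Q then c v i else if v = b0 then 0 else if i = b_index v then 1 else 0)"
  have inj: "injective_system (Inl ` E \<union> Inr ` pins) (V \<times> {..<d}) (\<lambda>r wi. rigidity_row (\<lambda>v i. (\<lambda>(v, i). p v i) (v, i)) r wi)"
  proof (rule injective_system_generic[OF _ _ p[unfolded generic_def],
        where A = "\<lambda>r wi x. rigidity_row (\<lambda>v i. x (v, i)) r wi"])
    fix r wi assume r: "r \<in> Inl ` E \<union> Inr ` pins" and wi: "wi \<in> V \<times> {..<d}"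
    show "(\<lambda>x. rigidity_row (\<lambda>v i. x (v, i)) r wi) \<in> ratpoly (V \<times> {..<d})"
    proof (cases r)
      case (Inl e')
      then have "e' \<subseteq> V" using r EV by auto
      then have "(\<lambda>x. \<Sum>v\<in>e'. x (fst wi, snd wi) - x (v, snd wi)) \<in> ratpoly (V \<times> {..<d})"
        using wi by (intro ratpoly_intros) auto
      then show ?thesis by (cases "fst wi \<in> e'") (simp_all add: Inl ratpoly_0)
    next
      case (Inr \<pi>)
      then show ?thesis by (simp add: ratpoly_0 ratpoly_1)
    qed
  next
    show "injective_system (Inl ` E \<union> Inr ` pins) (V \<times> {..<d}) (\<lambda>r wi. rigidity_row (\<lambda>v i. ps (v, i)) r wi)"
      unfolding E_def by (rule pinned_system_injective_at_gale[OF AV c]) (simp add: ps_def)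
  qed (use finite_V in simp)
  \<comment> \<open>With \<open>k = card Q\<close> and \<open>n = card V = k + d + 1\<close>, twice
    the number of rows is at most \<open>n (n - 1) - k (k + 1) + d (d + 1) = 2 d n\<close>.\<close>
  have le: "card (Inl ` E \<union> Inr ` pins) \<le> card (V \<times> {..<d})"
  proof -
    have "2 * card E = card (non_arcs V A)"
      unfolding E_def edge_set_def by (rule card_symmetric[OF finN symN, symmetric]) (auto simp: non_arcs_def irrefl_def)
    then have "2 * card E + card Q * Suc (card Q) + card V = card V * card V"
      using card_non_arcs[OF finite_V AV irrefl] cardA by simp
    then have "2 * card E + 2 * card pins \<le> 2 * (card V * d)"
      using card_pins by (simp add: card_V algebra_simps)
    moreover have "card (Inl ` E \<union> Inr ` pins) \<le> card E + card pins"
      by (intro order_trans[OF card_Un_le] add_mono card_image_le finE finP)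
    ultimately show ?thesis by (simp add: card_cartesian_product)
  qed
  obtain \<xi> where \<xi>: "\<forall>r\<in>Inl ` E \<union> Inr ` pins.
      (\<Sum>wi\<in>V \<times> {..<d}. rigidity_row p r wi * \<xi> wi) = (if r = Inl e then 1 else 0)"
    using injective_system_surjective[OF _ _ le inj, of "\<lambda>r. if r = Inl e then 1 else 0"] finE finP finite_V
    by auto
  show ?thesis
  proof (intro exI[of _ \<xi>] allI impI)
    fix u v assume uv: "{u, v} \<in> edge_set (non_arcs V A)"
    then have "(u, v) \<in> non_arcs V A" by (simp only: in_edge_set_iff[OF symN])
    then have "u \<in> V" "v \<in> V" "u \<noteq> v" by (auto simp: non_arcs_def)
    from sum_rigidity_row_edge[OF finite_V this, where d = d and p = p and x = \<xi>]
    show "(\<Sum>i<d. (p u i - p v i) * (\<xi> (u, i) - \<xi> (v, i))) = (if {u, v} = e then 1 else 0)"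
      using \<xi> uv by (auto simp: E_def simp del: rigidity_row.simps)
  qed
qed

text \<open>Holds for every generic \<open>p\<close>, as refuting \<open>generically_rigid\<close>
  requires. Some edge \<open>e0\<close> of the larger graph is not in \<open>G\<close>; the flex
  changes no other edge length of that graph, so it is an admissible motion of
  \<open>G\<close>.\<close>

theorem not_rigid_if_few_edges:
  assumes G: "verts G = V" and AV: "A \<subseteq> V \<times> V" and sym: "sym A" and irrefl: "irrefl A"
    and ip: "indep_products A {..<card Q} y" and cardA: "card A = card Q * Suc (card Q)"
    and p: "generic d V p"
    and edges: "edges G \<subset> edge_set (non_arcs V A)"
  shows "\<not> rigid_framework d G p"
proof
  assume rigid: "rigid_framework d G p"
  define E where "E = edge_set (non_arcs V A)"
  have "finite A" using finite_subset[OF AV] finite_V by simp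
  then obtain c where c: "indep_products A Q (gale c)"
    using ex_indep_gale[OF \<open>finite A\<close> sym AV ip] by (elim exE)
  have "\<forall>e\<in>E. \<exists>\<xi>. \<forall>u v. {u, v} \<in> E \<longrightarrow>
    (\<Sum>i<d. (p u i - p v i) * (\<xi> (u, i) - \<xi> (v, i))) = (if {u, v} = e then 1 else 0 :: real)"
    unfolding E_def by (intro ballI ex_dual_velocities[OF AV sym irrefl c cardA p])
  from bchoice[OF this] obtain \<xi> where \<xi>: "\<forall>e\<in>E. \<forall>u v. {u, v} \<in> E \<longrightarrow>
    (\<Sum>i<d. (p u i - p v i) * (\<xi> e (u, i) - \<xi> e (v, i))) = (if {u, v} = e then 1 else 0 :: real)"
    by (elim exE)
  obtain e0 where e0: "e0 \<in> E" "e0 \<notin> edges G" using edges by (auto simp: E_def)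
  have EP: "E \<subseteq> all_pairs V"
    by (auto simp: E_def edge_set_def non_arcs_def all_pairs_def)
  obtain q :: "real \<Rightarrow> 'v \<Rightarrow> nat \<Rightarrow> real" where q:
    "(\<forall>v\<in>V. \<forall>i<d. continuous_on {0..1} (\<lambda>t. q t v i) \<and> q 0 v i = p v i) \<and>
    (\<forall>t\<in>{0..1}. \<forall>u v. {u, v} \<in> E \<longrightarrow> {u, v} \<noteq> e0 \<longrightarrow> sq_dist d (q t) u v = sq_dist d p u v) \<and>
    (\<forall>u v. {u, v} = e0 \<longrightarrow> sq_dist d (q 1) u v \<noteq> sq_dist d p u v)"
    using flex_if_dual_velocities[OF finite_V EP e0(1) \<xi>] by (elim exE)
  obtain u v where uv: "e0 = {u, v}" "u \<in> V" "v \<in> V"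
    using e0(1) by (auto simp: E_def edge_set_def non_arcs_def)
  have "continuous_motion d G p q" using q by (simp add: continuous_motion_def G)
  moreover have "\<forall>t\<in>{0..1}. \<forall>u\<in>verts G. \<forall>v\<in>verts G. {u, v} \<in> edges G \<longrightarrow>
      sq_dist d (q t) u v = sq_dist d p u v"
  proof (intro ballI impI)
    fix t u v assume "t \<in> {0..1 :: real}" "{u, v} \<in> edges G"
    moreover from this have "{u, v} \<in> E" "{u, v} \<noteq> e0" using edges e0 by (auto simp: E_def)
    ultimately show "sq_dist d (q t) u v = sq_dist d p u v" using q by blast
  qed
  ultimately have "\<forall>t\<in>{0..1}. \<forall>u\<in>verts G. \<forall>v\<in>verts G. sq_dist d (q t) u v = sq_dist d p u v"
    using rigid unfolding rigid_framework_def dist_dim_eq_iff by blast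
  then have "sq_dist d (q 1) u v = sq_dist d p u v" using uv G by auto
  moreover have "sq_dist d (q 1) u v \<noteq> sq_dist d p u v"
    using q[THEN conjunct2, THEN conjunct2, rule_format, of u v] uv(1) by simp
  ultimately show False by simp
qed

end

section \<open>Maxwell sharpness\<close>

lemma two_times_choose_two: "2 * (Suc d choose 2) = d * Suc d"
  by (induction d) (auto simp: numeral_2_eq_2)

definition missing_arcs :: "'v graph \<Rightarrow> ('v \<times> 'v) set" where
  "missing_arcs G = {(u, v). u \<in> verts G \<and> v \<in> verts G \<and> u \<noteq> v \<and> {u, v} \<notin> edges G}"

lemma missing_arcs_subset: "missing_arcs G \<subseteq> verts G \<times> verts G"
  by (auto simp: missing_arcs_def)

lemma missing_arcs_commute: "(u, v) \<in> missing_arcs G \<longleftrightarrow> (v, u) \<in> missing_arcs G"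
  by (auto simp: missing_arcs_def insert_commute)

lemma sym_missing_arcs: "sym (missing_arcs G)"
  by (rule symI) (rule iffD1[OF missing_arcs_commute])

lemma irrefl_missing_arcs: "irrefl (missing_arcs G)"
  by (auto simp: missing_arcs_def irrefl_def)

lemma edges_eq_non_arcs:
  assumes "simple_graph G"
  shows "edges G = edge_set (non_arcs (verts G) (missing_arcs G))"
proof
  show "edges G \<subseteq> edge_set (non_arcs (verts G) (missing_arcs G))"
  proof
    fix e assume e: "e \<in> edges G"
    then have "e \<subseteq> verts G" "card e = 2" using assms by (auto simp: simple_graph_def all_pairs_def)
    then obtain u v where "e = {u, v}" "u \<noteq> v" "u \<in> verts G" "v \<in> verts G" by (auto simp: card_2_iff)
    then show "e \<in> edge_set (non_arcs (verts G) (missing_arcs G))"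
      using e by (force simp: edge_set_def non_arcs_def missing_arcs_def)
  qed
qed (auto simp: edge_set_def non_arcs_def missing_arcs_def)

lemma two_times_card_edges:
  assumes "simple_graph G"
  shows "2 * card (edges G) + card (missing_arcs G) + card (verts G) = card (verts G) * card (verts G)"
proof -
  let ?N = "non_arcs (verts G) (missing_arcs G)"
  have fin: "finite (verts G)" using assms by (simp add: simple_graph_def)
  have "2 * card (edge_set ?N) = card ?N"
    unfolding edge_set_def using fin
    by (intro card_symmetric[symmetric])
      (auto simp: non_arcs_def irrefl_def sym_def dest: symD[OF sym_missing_arcs])
  then show ?thesis
    using card_non_arcs[OF fin missing_arcs_subset irrefl_missing_arcs]
    by (simp add: edges_eq_non_arcs[OF assms, symmetric])
qed

text \<open>Rests on \<open>n (n - 1) = 2 d n - d (d + 1) + k (k + 1)\<close> for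
  \<open>n = k + d + 1\<close>, combined with \<open>two_times_card_edges\<close>.\<close>

lemma maxwell_condition_iff:
  assumes "simple_graph G" "card (verts G) = k + Suc d"
  shows "int d * int (card (verts G)) - int ((d + 1) choose 2) \<le> int (card (edges G))
    \<longleftrightarrow> card (missing_arcs G) \<le> k * Suc k"
proof -
  have "2 * int (card (edges G)) + int (card (missing_arcs G)) + (int k + int d + 1) = (int k + int d + 1) * (int k + int d + 1)"
    using arg_cong[OF two_times_card_edges[OF assms(1)], of int] by (simp add: assms(2) algebra_simps)
  moreover have "2 * int ((d + 1) choose 2) = int d * (int d + 1)"
    using arg_cong[OF two_times_choose_two[of d], of int] by (simp add: algebra_simps)
  moreover have "card (missing_arcs G) \<le> k * Suc k \<longleftrightarrow> int (card (missing_arcs G)) \<le> int k * (int k + 1)"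
    by (subst of_nat_le_iff[symmetric, where ?'a = int]) (simp add: algebra_simps)
  moreover have "int (card (verts G)) = int k + int d + 1" using assms(2) by simp
  ultimately show ?thesis by (simp add: algebra_simps) linarith
qed

lemma ex_affine_base:
  assumes "finite V" "card V = k + Suc d"
  shows "\<exists>Q b0 b. affine_base V Q b0 b d \<and> card Q = k"
proof -
  obtain Q where Q: "Q \<subseteq> V" "card Q = k" "finite Q"
    using obtain_subset_with_card_n[of k V] assms(2) by auto
  have "card (V - Q) = Suc d" using Q assms by (simp add: card_Diff_subset)
  then have "V - Q \<noteq> {}" by (intro notI) simp
  then obtain b0 where b0: "b0 \<in> V - Q" by blast
  then have "card (V - Q - {b0}) = d" using \<open>card (V - Q) = Suc d\<close> assms(1) by simp
  then obtain b where "bij_betw b {..<d} (V - Q - {b0})"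
    using ex_bij_betw_nat_finite[of "V - Q - {b0}"] assms(1) by (auto simp: atLeast0LessThan)
  then have "affine_base V Q b0 b d" using Q b0 assms(1) by unfold_locales auto
  then show ?thesis using Q(2) by blast
qed

theorem generically_rigid_iff_missing_arcs:
  assumes G: "simple_graph G" and n: "card (verts G) = k + Suc d"
    and pc: "paths_and_cycles (missing_arcs G)" and tri: "triangle_free (missing_arcs G)"
  shows "generically_rigid d G \<longleftrightarrow> card (missing_arcs G) \<le> k * Suc k"
proof -
  let ?A = "missing_arcs G"
  interpret A: paths_and_cycles ?A by (rule pc)
  have fin: "finite (verts G)" using G by (simp add: simple_graph_def)
  obtain Q b0 b where base: "affine_base (verts G) Q b0 b d" and Q: "card Q = k"
    using ex_affine_base[OF fin n] by (elim exE conjE)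
  interpret affine_base "verts G" Q b0 b d by (rule base)
  show ?thesis
  proof
    assume le: "card ?A \<le> k * Suc k"
    obtain y where y: "indep_products ?A {..<card Q} y"
      using ex_indep_products[OF pc tri le] unfolding Q by (elim exE)
    show "generically_rigid d G"
      by (rule generically_rigid_if_indep_products[OF refl missing_arcs_subset sym_missing_arcs _ y])
        (auto simp: missing_arcs_def)
  next
    assume rigid: "generically_rigid d G"
    then obtain p where p: "generic d (verts G) p" "rigid_framework d G p"
      by (auto simp: generically_rigid_def)
    show "card ?A \<le> k * Suc k"
    proof (rule ccontr)
      assume "\<not> card ?A \<le> k * Suc k"
      moreover have cA: "card ?A = 2 * card (edge_set ?A)"
        unfolding edge_set_def by (rule card_symmetric) (fact A.fin A.sym A.irrefl)+
      moreover have half: "2 * (k * Suc k div 2) = k * Suc k" by simp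
      ultimately have lt: "k * Suc k div 2 < card (edge_set ?A)" by linarith
      \<comment> \<open>Keep just \<open>k (k + 1) / 2\<close> of the missing edges: the graph
        missing only these is tight, as the square system requires, and still has more edges than
        \<open>G\<close>.\<close>
      then obtain F where F: "F \<subseteq> edge_set ?A" "card F = k * Suc k div 2"
        using obtain_subset_with_card_n[of "k * Suc k div 2" "edge_set ?A"] by auto
      define B where "B = {(u, v) \<in> ?A. {u, v} \<in> F}"
      have BA: "B \<subseteq> ?A" by (auto simp: B_def)
      have symB: "sym B" using A.arc_sym by (auto simp: B_def sym_def insert_commute)
      have pcB: "paths_and_cycles B" by (rule paths_and_cycles_subset[OF pc BA symB])
      interpret B: paths_and_cycles B by (rule pcB)
      have "edge_set B = F" using F(1) by (force simp: B_def edge_set_def)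
      then have cardB: "card B = k * Suc k"
        using card_symmetric[OF B.fin B.sym B.irrefl] half F(2) by (simp add: edge_set_def)
      have triB: "triangle_free B" using tri BA unfolding triangle_free_def by blast
      obtain y where y: "indep_products B {..<card Q} y"
        using ex_indep_products[OF pcB triB, of k] cardB unfolding Q by auto
      have "F \<noteq> edge_set ?A" using lt F(2) by auto
      then obtain u v where uv: "(u, v) \<in> ?A" "{u, v} \<notin> F"
        using F(1) by (auto simp: edge_set_def)
      then have new: "{u, v} \<in> edge_set (non_arcs (verts G) B)" "{u, v} \<notin> edges G"
        by (force simp: edge_set_def non_arcs_def missing_arcs_def B_def, simp add: missing_arcs_def)
      have "edges G \<subseteq> edge_set (non_arcs (verts G) B)"
        unfolding edges_eq_non_arcs[OF G] using BA by (auto simp: edge_set_def non_arcs_def)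
      with new have "edges G \<subset> edge_set (non_arcs (verts G) B)" by blast
      then have "\<not> rigid_framework d G p"
        using cardB by (intro not_rigid_if_few_edges[OF refl _ symB B.irrefl y _ p(1)])
          (use BA missing_arcs_subset[of G] Q in auto)
      then show False using p(2) by blast
    qed
  qed
qed

text \<open>With degree at most 2 in the complement, the vertices of a triangle have no further
  neighbours, so the triangle is a whole component.\<close>

lemma triangle_free_if_no_C3_component:
  assumes deg: "\<And>v. card (missing_arcs G `` {v}) \<le> 2" and fin: "finite (verts G)"
    and no: "\<And>H. H \<in> connected_components (complement G) \<Longrightarrow> \<not> graph_isomorphic H (cycle_graph 3)"
  shows "triangle_free (missing_arcs G)"
  unfolding triangle_free_def
proof (intro allI impI notI)
  let ?A = "missing_arcs G"
  fix a b c assume abc: "(a, b) \<in> ?A" "(b, c) \<in> ?A" "(c, a) \<in> ?A"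
  note sym = missing_arcs_commute[of _ _ G]
  have V: "a \<in> verts G" "b \<in> verts G" "c \<in> verts G" "a \<noteq> b" "b \<noteq> c" "c \<noteq> a"
    using abc by (auto simp: missing_arcs_def)
  have finA: "finite (?A `` {v})" for v
    by (rule finite_subset[OF _ fin]) (auto simp: missing_arcs_def)
  have nbrs: "?A `` {u} = {v, w}" if "(u, v) \<in> ?A" "(u, w) \<in> ?A" "v \<noteq> w" for u v w
    using card_seteq[OF finA[of u], of "{v, w}"] deg[of u] that by auto
  have N: "?A `` {a} = {b, c}" "?A `` {b} = {a, c}" "?A `` {c} = {a, b}"
    by (rule nbrs; use abc sym V in blast)+
  have edge: "{u, v} \<in> edges (complement G) \<longleftrightarrow> (u, v) \<in> ?A" for u v
    by (auto simp: complement_def all_pairs_def missing_arcs_def card_insert_if)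
  define S where "S = {u \<in> verts (complement G). (\<lambda>x y. {x, y} \<in> edges (complement G))\<^sup>*\<^sup>* a u}"
  have "u \<in> {a, b, c}" if "(\<lambda>x y. {x, y} \<in> edges (complement G))\<^sup>*\<^sup>* a u" for u
    using that
  proof induction
    case (step x y)
    then have "y \<in> ?A `` {x}" by (simp add: edge)
    then show ?case using step.IH N by auto
  qed simp
  moreover have "{a, b, c} \<subseteq> S"
    using V r_into_rtranclp[of "\<lambda>x y. {x, y} \<in> edges (complement G)" a] abc sym[of a c]
    unfolding S_def edge by (simp add: complement_def)
  ultimately have S: "S = {a, b, c}" by (auto simp: S_def)
  define H where "H = induced_subgraph (complement G) S"
  have "H \<in> connected_components (complement G)"
    unfolding H_def S_def connected_components_def using V(1) by (auto simp: complement_def)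
  moreover have "graph_isomorphic H (cycle_graph 3)"
  proof -
    define f where "f v = (if v = a then 0 else if v = b then 1 else 2 :: nat)" for v
    have "bij_betw f {a, b, c} {..<3}"
      unfolding bij_betw_def using V by (auto simp: f_def inj_on_def)
    moreover have "{f u, f v} \<in> edges (cycle_graph 3) \<longleftrightarrow> u \<noteq> v"
      if "u \<in> {a, b, c}" "v \<in> {a, b, c}" for u v
    proof -
      have "edges (cycle_graph 3) = (\<lambda>i. {i, (i + 1) mod 3}) ` {..<3}"
        unfolding cycle_graph_def by auto
      also have "{..<3} = {0, 1, 2 :: nat}" by auto
      finally have "edges (cycle_graph 3) = {{0, 1}, {1, 2}, {2, 0}}" by (simp add: numeral_2_eq_2)
      then show ?thesis using that V by (auto simp: f_def doubleton_eq_iff)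
    qed
    moreover have "{u, v} \<in> edges H \<longleftrightarrow> u \<noteq> v" if "u \<in> {a, b, c}" "v \<in> {a, b, c}" for u v
    proof -
      have "{u, v} \<in> edges H \<longleftrightarrow> (u, v) \<in> ?A"
        using that by (simp add: H_def induced_subgraph_def edge S)
      moreover have "(x, x) \<notin> ?A" for x by (simp add: missing_arcs_def)
      moreover have "(b, a) \<in> ?A" "(c, b) \<in> ?A" "(a, c) \<in> ?A"
        by (rule iffD1[OF missing_arcs_commute], fact abc)+
      ultimately show ?thesis using that abc by auto
    qed
    moreover have "verts H = {a, b, c}" "verts (cycle_graph 3) = {..<3}"
      by (simp_all add: H_def induced_subgraph_def S cycle_graph_def)
    ultimately show ?thesis
      unfolding graph_isomorphic_def by (intro exI[of _ f]) simp
  qed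
  ultimately show False using no by blast
qed

lemma card_missing_arcs_nbrs:
  assumes G: "simple_graph G" and deg: "\<And>v. v \<in> verts G \<Longrightarrow> card (verts G) \<le> degree G v + 3"
  shows "card (missing_arcs G `` {v}) \<le> 2"
proof (cases "v \<in> verts G")
  case True
  have fin: "finite (verts G)" using G by (simp add: simple_graph_def)
  define N where "N = {u \<in> verts G. {u, v} \<in> edges G}"
  have "v \<notin> N" using G by (auto simp: N_def simple_graph_def all_pairs_def)
  have disj: "N \<inter> missing_arcs G `` {v} = {}"
    by (auto simp: N_def missing_arcs_def insert_commute)
  have "v \<notin> N \<union> missing_arcs G `` {v}"
    using \<open>v \<notin> N\<close> by (auto simp: missing_arcs_def)
  moreover have fins: "finite N" "finite (missing_arcs G `` {v})"
    by (auto simp: N_def missing_arcs_def intro: finite_subset[OF _ fin])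
  moreover have "card (insert v (N \<union> missing_arcs G `` {v})) \<le> card (verts G)"
    using True fin by (intro card_mono) (auto simp: N_def missing_arcs_def)
  ultimately have "Suc (card N + card (missing_arcs G `` {v})) \<le> card (verts G)"
    using card_Un_disjoint[OF fins disj] by simp
  then show ?thesis using deg[OF True] by (simp add: degree_def N_def)
next
  case False
  then have "missing_arcs G `` {v} = {}" by (auto simp: missing_arcs_def)
  then show ?thesis by simp
qed

theorem theorem1p4:
  fixes G :: "'a graph" and n :: nat
  assumes "n \<ge> 4"
    and "simple_graph G"
    and "card (verts G) = n"
    and "min_degree G \<ge> n - 3"
    and "\<forall>H\<in>connected_components (complement G).
           \<not> graph_isomorphic H (cycle_graph 3) \<and> \<not> graph_isomorphic H (cycle_graph 4)"
  shows "maxwell_sharp G"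
proof -
  have fin: "finite (verts G)" using assms(2) by (simp add: simple_graph_def)
  have "card (verts G) \<le> degree G v + 3" if "v \<in> verts G" for v
  proof -
    have "min_degree G \<le> degree G v" unfolding min_degree_def using fin that by (intro Min_le) auto
    then show ?thesis using assms(3,4) by simp
  qed
  from card_missing_arcs_nbrs[OF assms(2) this]
  have deg: "card (missing_arcs G `` {v}) \<le> 2" for v .
  have pc: "paths_and_cycles (missing_arcs G)"
    using deg fin finite_subset[OF missing_arcs_subset[of G]] sym_missing_arcs irrefl_missing_arcs
    by unfold_locales auto
  have tri: "triangle_free (missing_arcs G)"
    using triangle_free_if_no_C3_component[OF deg fin] assms(5) by blast
  have "generically_rigid d G \<longleftrightarrow>
      int d * int (card (verts G)) - int ((d + 1) choose 2) \<le> int (card (edges G))"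
    if "d \<le> card (verts G) - 1" for d
  proof -
    \<comment> \<open>The bound on \<open>d\<close> keeps the truncated subtraction exact; the
      difference is \<open>k = n - 1 - d\<close>.\<close>
    have card: "card (verts G) = (card (verts G) - Suc d) + Suc d" using that assms(1,3) by simp
    show ?thesis
      unfolding generically_rigid_iff_missing_arcs[OF assms(2) card pc tri]
        maxwell_condition_iff[OF assms(2) card] ..
  qed
  then show ?thesis
    unfolding maxwell_sharp_def rigidity_dim_def maxwell_dim_def
    by (intro arg_cong[where f = Max]) auto
qed

end
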